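(* Let $K$ be a field of characteristic $0$, $m>1$ an integer, and $E_1,E_2$ elliptic curves over $K$ with an isomorphism $E_1[m]\simeq E_2[m]=:\Delta$ of group schemes over $K$. Let $A=(E_1\times E_2)/\Delta_E$ and let $\mu_1:E_1(K)\to H^1(K,\Delta)$, $\mu_2:E_2(K)\to H^1(K,\Delta)$ be the Kummer maps. Then: (a) $\mu_1\circ p_*=-\mu_2\circ q_*$ on $A(K)$; (b) the sequence $E_1(K)\times E_2(K)\xrightarrow{p^*+q^*}A(K)\xrightarrow{\mu_1 p_*}H^1(K,\Delta)$ is exact; (c) the sequence $A(K)\xrightarrow{p_*\times q_*}E_1(K)\times E_2(K)\xrightarrow{\mu_1+\mu_2}H^1(K,\Delta)$ is exact, where $(\mu_1+\mu_2)(e_1,e_2)=\mu_1(e_1)+\mu_2(e_2)$.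
   Context: $\Delta_E\subset E_1[m]\times E_2[m]$ is the anti-diagonal embedding of $\Delta$, i.e. $\{(T,-T):T\in\Delta\}$ under the identification $E_1[m]\simeq\Delta\simeq E_2[m]$, and $A=(E_1\times E_2)/\Delta_E$. The morphisms $p^*:E_1\to A$ and $q^*:E_2\to A$ are induced by $P\mapsto(P,0)$ and $Q\mapsto(0,Q)$; $p^*+q^*:E_1\times E_2\to A$ is the quotient map. Since $\Delta_E\subset (E_1\times E_2)[m]$, multiplication by $m$ on $E_1\times E_2$ factors as $(p_*\times q_* )\circ(p^*+q^* )$ for an isogeny $p_*\times q_*:A\to E_1\times E_2$ with components $p_*:A\to E_1$, $q_*:A\to E_2$. The Kummer map $\mu_i$ is the connecting homomorphism $E_i(K)\to H^1(K,E_i[m])$ of $0\to E_i[m]\to E_i\xrightarrow{m}E_i\to 0$, with $H^1(K,E_i[m])$ identified with $H^1(K,\Delta)$ via the given isomorphism. *)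

theory Defs
  imports
    "HOL-Algebra.Algebra"
    "HOL-Algebra.Algebraic_Closure_Type"
    "HOL-Analysis.Abstract_Topology"
begin

section \<open>Weierstrass curves\<close>

datatype 'a weierstrass =
  Weierstrass (wa1: 'a) (wa2: 'a) (wa3: 'a) (wa4: 'a) (wa6: 'a)

datatype 'a ec_point = Infinity | Affine 'a 'a

text \<open>The discriminant is expressed through the usual quantities $b_2, b_4, b_6, b_8$.\<close>

definition discriminant :: "'a::field weierstrass \<Rightarrow> 'a" where
  "discriminant W =
    (let a1 = wa1 W; a2 = wa2 W; a3 = wa3 W; a4 = wa4 W; a6 = wa6 W;
         b2 = a1^2 + 4 * a2;
         b4 = 2 * a4 + a1 * a3;
         b6 = a3^2 + 4 * a6;
         b8 = a1^2 * a6 + 4 * a2 * a6 - a1 * a3 * a4 + a2 * a3^2 - a4^2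
     in - (b2^2 * b8) - 8 * b4^3 - 27 * b6^2 + 9 * b2 * b4 * b6)"

definition elliptic_curve :: "'a::field weierstrass \<Rightarrow> bool" where
  "elliptic_curve W \<longleftrightarrow> discriminant W \<noteq> 0"

fun on_curve :: "'a::field weierstrass \<Rightarrow> 'a ec_point \<Rightarrow> bool" where
  "on_curve W Infinity \<longleftrightarrow> True"
| "on_curve W (Affine x y) \<longleftrightarrow>
     y^2 + wa1 W * x * y + wa3 W * y = x^3 + wa2 W * x^2 + wa4 W * x + wa6 W"

text \<open>The chord and tangent law: \<open>l\<close> is the slope of the line through the two points.\<close>

fun ec_add :: "'a::field weierstrass \<Rightarrow> 'a ec_point \<Rightarrow> 'a ec_point \<Rightarrow> 'a ec_point" where
  "ec_add W Infinity Q = Q"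
| "ec_add W (Affine x1 y1) Infinity = Affine x1 y1"
| "ec_add W (Affine x1 y1) (Affine x2 y2) =
    (if x1 = x2 \<and> y1 + y2 + wa1 W * x2 + wa3 W = 0 then Infinity
     else
       let l = (if x1 = x2
                then (3 * x1^2 + 2 * wa2 W * x1 + wa4 W - wa1 W * y1) /
                     (2 * y1 + wa1 W * x1 + wa3 W)
                else (y2 - y1) / (x2 - x1));
           x3 = l^2 + wa1 W * l - wa2 W - x1 - x2;
           y3 = - (y1 + l * (x3 - x1)) - wa1 W * x3 - wa3 W
       in Affine x3 y3)"

definition ec_group :: "'a::field weierstrass \<Rightarrow> 'a ec_point monoid" where
  "ec_group W = \<lparr>carrier = {P. on_curve W P}, monoid.mult = ec_add W, one = Infinity\<rparr>"

definition geometric_points :: "'k::field weierstrass \<Rightarrow> 'k alg_closure ec_point monoid" where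
  "geometric_points W = ec_group (map_weierstrass to_ac W)"

text \<open>$E(K)$, regarded as a subgroup of $E(\bar K)$.\<close>

definition rational_points :: "'k::field weierstrass \<Rightarrow> 'k alg_closure ec_point monoid" where
  "rational_points W =
     (geometric_points W)\<lparr>carrier := map_ec_point to_ac ` carrier (ec_group W)\<rparr>"

definition torsion :: "'a monoid \<Rightarrow> nat \<Rightarrow> 'a monoid" where
  "torsion M m = M\<lparr>carrier := kernel M M (\<lambda>P. P [^]\<^bsub>M\<^esub> m)\<rparr>"


section \<open>The absolute Galois group and its first cohomology\<close>

text \<open>Only fields of characteristic 0 occur, so that the algebraic closure is separable.\<close>

definition absolute_galois :: "('k::field alg_closure \<Rightarrow> 'k alg_closure) set" where
  "absolute_galois =
     {\<sigma>. bij \<sigma> \<and> (\<forall>x y. \<sigma> (x + y) = \<sigma> x + \<sigma> y) \<and> (\<forall>x y. \<sigma> (x * y) = \<sigma> x * \<sigma> y) \<and>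
         (\<forall>a. \<sigma> (to_ac a) = to_ac a)}"

text \<open>A basic open set is a coset of the group fixing the finite extension $K(S)$ pointwise.\<close>

definition krull_topology :: "('k::field alg_closure \<Rightarrow> 'k alg_closure) topology" where
  "krull_topology = topology_generated_by
     {{\<tau> \<in> absolute_galois. \<forall>x\<in>S. \<tau> x = \<sigma> x} |\<sigma> S. \<sigma> \<in> absolute_galois \<and> finite S}"

text \<open>A Galois module is given by an abelian group \<open>M\<close>, in multiplicative notation as usual in
  HOL-Algebra, and an action \<open>act\<close>. Cochains are extensional functions on the Galois group.\<close>

type_synonym ('k, 'a) galois_action = "('k alg_closure \<Rightarrow> 'k alg_closure) \<Rightarrow> 'a \<Rightarrow> 'a"
type_synonym ('k, 'a) cochain = "('k alg_closure \<Rightarrow> 'k alg_closure) \<Rightarrow> 'a"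

definition cocycles :: "'a monoid \<Rightarrow> ('k::field, 'a) galois_action \<Rightarrow> ('k, 'a) cochain set" where
  "cocycles M act =
     {c \<in> absolute_galois \<rightarrow>\<^sub>E carrier M.
        continuous_map krull_topology (discrete_topology (carrier M)) c \<and>
        (\<forall>\<sigma>\<in>absolute_galois. \<forall>\<tau>\<in>absolute_galois. c (\<sigma> \<circ> \<tau>) = c \<sigma> \<otimes>\<^bsub>M\<^esub> act \<sigma> (c \<tau>))}"

definition coboundaries :: "'a monoid \<Rightarrow> ('k::field, 'a) galois_action \<Rightarrow> ('k, 'a) cochain set" where
  "coboundaries M act =
     (\<lambda>b. \<lambda>\<sigma>\<in>absolute_galois. act \<sigma> b \<otimes>\<^bsub>M\<^esub> inv\<^bsub>M\<^esub> b) ` carrier M"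

definition cocycle_group :: "'a monoid \<Rightarrow> ('k::field, 'a) galois_action \<Rightarrow> ('k, 'a) cochain monoid" where
  "cocycle_group M act =
     \<lparr>carrier = cocycles M act,
      monoid.mult = (\<lambda>c d. \<lambda>\<sigma>\<in>absolute_galois. c \<sigma> \<otimes>\<^bsub>M\<^esub> d \<sigma>),
      one = (\<lambda>\<sigma>\<in>absolute_galois. \<one>\<^bsub>M\<^esub>)\<rparr>"

definition H1 :: "'a monoid \<Rightarrow> ('k::field, 'a) galois_action \<Rightarrow> ('k, 'a) cochain set monoid" where
  "H1 M act = cocycle_group M act Mod coboundaries M act"

definition cohomology_class ::
    "'a monoid \<Rightarrow> ('k::field, 'a) galois_action \<Rightarrow> ('k, 'a) cochain \<Rightarrow> ('k, 'a) cochain set" where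
  "cohomology_class M act c = coboundaries M act #>\<^bsub>cocycle_group M act\<^esub> c"

text \<open>The map $H^1(K, M) \to H^1(K, N)$ induced by an equivariant homomorphism \<open>f\<close>.\<close>

definition H1_map ::
    "'b monoid \<Rightarrow> ('k::field, 'b) galois_action \<Rightarrow> ('a \<Rightarrow> 'b) \<Rightarrow>
     ('k, 'a) cochain set \<Rightarrow> ('k, 'b) cochain set" where
  "H1_map N act f C =
     the_elem ((\<lambda>c. cohomology_class N act (\<lambda>\<sigma>\<in>absolute_galois. f (c \<sigma>))) ` C)"

text \<open>The connecting homomorphism $C^G \to H^1(K, \ker f)$ of $0 \to \ker f \to B \to C \to 0$
  for a surjective equivariant homomorphism $f : B \to C$.\<close>

definition connecting ::
    "'b monoid \<Rightarrow> 'c monoid \<Rightarrow> ('k::field, 'b) galois_action \<Rightarrow> ('b \<Rightarrow> 'c) \<Rightarrow>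
     'c \<Rightarrow> ('k, 'b) cochain set" where
  "connecting B C act f x =
     (let b = (SOME b. b \<in> carrier B \<and> f b = x)
      in cohomology_class (B\<lparr>carrier := kernel B C f\<rparr>) act
           (\<lambda>\<sigma>\<in>absolute_galois. act \<sigma> b \<otimes>\<^bsub>B\<^esub> inv\<^bsub>B\<^esub> b))"

definition kummer ::
    "'k::field weierstrass \<Rightarrow> nat \<Rightarrow> 'k alg_closure ec_point \<Rightarrow>
     ('k, 'k alg_closure ec_point) cochain set" where
  "kummer W m =
     connecting (geometric_points W) (geometric_points W) map_ec_point
       (\<lambda>P. P [^]\<^bsub>geometric_points W\<^esub> m)"


section \<open>The quotient surface\<close>

text \<open>Throughout, \<open>\<phi>\<close> is the given isomorphism from $E_1[m]$ to $\Delta = E_2[m]$.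
  The quotient \<open>A\<close> is represented by its group of geometric points, on which the Galois group acts
  through representatives; its rational points are the invariant ones.\<close>

type_synonym 'k ec_pair = "'k alg_closure ec_point \<times> 'k alg_closure ec_point"
type_synonym 'k torsion_map = "'k alg_closure ec_point \<Rightarrow> 'k alg_closure ec_point"

definition torsion_isomorphism ::
    "'k::field weierstrass \<Rightarrow> 'k weierstrass \<Rightarrow> nat \<Rightarrow> 'k torsion_map \<Rightarrow> bool" where
  "torsion_isomorphism W1 W2 m \<phi> \<longleftrightarrow>
     \<phi> \<in> iso (torsion (geometric_points W1) m) (torsion (geometric_points W2) m) \<and>
     (\<forall>\<sigma>\<in>absolute_galois. \<forall>T\<in>carrier (torsion (geometric_points W1) m).
        \<phi> (map_ec_point \<sigma> T) = map_ec_point \<sigma> (\<phi> T))"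

definition antidiagonal ::
    "'k::field weierstrass \<Rightarrow> 'k weierstrass \<Rightarrow> nat \<Rightarrow> 'k torsion_map \<Rightarrow> 'k ec_pair set" where
  "antidiagonal W1 W2 m \<phi> =
     (\<lambda>T. (T, inv\<^bsub>geometric_points W2\<^esub> (\<phi> T))) ` carrier (torsion (geometric_points W1) m)"

definition quotient_surface ::
    "'k::field weierstrass \<Rightarrow> 'k weierstrass \<Rightarrow> nat \<Rightarrow> 'k torsion_map \<Rightarrow> 'k ec_pair set monoid" where
  "quotient_surface W1 W2 m \<phi> =
     (geometric_points W1 \<times>\<times> geometric_points W2) Mod antidiagonal W1 W2 m \<phi>"

definition quotient_rational_points ::
    "'k::field weierstrass \<Rightarrow> 'k weierstrass \<Rightarrow> nat \<Rightarrow> 'k torsion_map \<Rightarrow> 'k ec_pair set monoid" where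
  "quotient_rational_points W1 W2 m \<phi> =
     (quotient_surface W1 W2 m \<phi>)
       \<lparr>carrier := {D \<in> carrier (quotient_surface W1 W2 m \<phi>).
                   \<forall>\<sigma>\<in>absolute_galois. map_prod (map_ec_point \<sigma>) (map_ec_point \<sigma>) ` D = D}\<rparr>"

definition p_pull ::
    "'k::field weierstrass \<Rightarrow> 'k weierstrass \<Rightarrow> nat \<Rightarrow> 'k torsion_map \<Rightarrow>
     'k alg_closure ec_point \<Rightarrow> 'k ec_pair set" where
  "p_pull W1 W2 m \<phi> P =
     antidiagonal W1 W2 m \<phi> #>\<^bsub>geometric_points W1 \<times>\<times> geometric_points W2\<^esub>
       (P, \<one>\<^bsub>geometric_points W2\<^esub>)"

definition q_pull ::
    "'k::field weierstrass \<Rightarrow> 'k weierstrass \<Rightarrow> nat \<Rightarrow> 'k torsion_map \<Rightarrow>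
     'k alg_closure ec_point \<Rightarrow> 'k ec_pair set" where
  "q_pull W1 W2 m \<phi> Q =
     antidiagonal W1 W2 m \<phi> #>\<^bsub>geometric_points W1 \<times>\<times> geometric_points W2\<^esub>
       (\<one>\<^bsub>geometric_points W1\<^esub>, Q)"

definition pq_pull ::
    "'k::field weierstrass \<Rightarrow> 'k weierstrass \<Rightarrow> nat \<Rightarrow> 'k torsion_map \<Rightarrow>
     'k ec_pair \<Rightarrow> 'k ec_pair set" where
  "pq_pull W1 W2 m \<phi> = (\<lambda>(P, Q).
     p_pull W1 W2 m \<phi> P \<otimes>\<^bsub>quotient_surface W1 W2 m \<phi>\<^esub> q_pull W1 W2 m \<phi> Q)"

text \<open>The map induced on cosets by multiplication by \<open>m\<close> on $E_1 \times E_2$.\<close>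

definition pq_push ::
    "'k::field weierstrass \<Rightarrow> 'k weierstrass \<Rightarrow> nat \<Rightarrow> 'k ec_pair set \<Rightarrow> 'k ec_pair" where
  "pq_push W1 W2 m D =
     the_elem ((\<lambda>R. R [^]\<^bsub>geometric_points W1 \<times>\<times> geometric_points W2\<^esub> m) ` D)"

definition p_push ::
    "'k::field weierstrass \<Rightarrow> 'k weierstrass \<Rightarrow> nat \<Rightarrow> 'k ec_pair set \<Rightarrow> 'k alg_closure ec_point" where
  "p_push W1 W2 m D = fst (pq_push W1 W2 m D)"

definition q_push ::
    "'k::field weierstrass \<Rightarrow> 'k weierstrass \<Rightarrow> nat \<Rightarrow> 'k ec_pair set \<Rightarrow> 'k alg_closure ec_point" where
  "q_push W1 W2 m D = snd (pq_push W1 W2 m D)"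

text \<open>$H^1(K, \Delta)$ and the two Kummer maps into it, the first one through \<open>\<phi>\<close>.\<close>

definition H1_Delta ::
    "'k::field weierstrass \<Rightarrow> nat \<Rightarrow> ('k, 'k alg_closure ec_point) cochain set monoid" where
  "H1_Delta W2 m = H1 (torsion (geometric_points W2) m) map_ec_point"

definition mu1 ::
    "'k::field weierstrass \<Rightarrow> 'k weierstrass \<Rightarrow> nat \<Rightarrow> 'k torsion_map \<Rightarrow>
     'k alg_closure ec_point \<Rightarrow> ('k, 'k alg_closure ec_point) cochain set" where
  "mu1 W1 W2 m \<phi> P =
     H1_map (torsion (geometric_points W2) m) map_ec_point \<phi> (kummer W1 m P)"

definition mu2 ::
    "'k::field weierstrass \<Rightarrow> nat \<Rightarrow>
     'k alg_closure ec_point \<Rightarrow> ('k, 'k alg_closure ec_point) cochain set" where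
  "mu2 W2 m Q = kummer W2 m Q"

text \<open>The library predicate \<open>exact_seq\<close> requires all groups to have the same element type.\<close>

definition exact_at_middle ::
    "'a monoid \<Rightarrow> ('a \<Rightarrow> 'b) \<Rightarrow> 'b monoid \<Rightarrow> ('b \<Rightarrow> 'c) \<Rightarrow> 'c monoid \<Rightarrow> bool" where
  "exact_at_middle G f H g K \<longleftrightarrow>
     group_hom G H f \<and> group_hom H K g \<and> kernel H K g = f ` carrier G"

end

theory Submission
  imports Defs "HOL-Analysis.Product_Topology"
begin

text \<open>
  A class in $A(\bar K)$ represented by $(P, Q)$ is Galois invariant iff for every \<open>\<sigma>\<close> the difference
  $\sigma P - P$ is \<open>m\<close>-torsion and $\sigma Q - Q = - \phi(\sigma P - P)$. Since $p_*$ and $q_*$ send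
  this class to $mP$ and $mQ$, whose Kummer classes are those of the cocycles $\sigma P - P$ and
  $\sigma Q - Q$, part (a) is an equality of cocycles. If $\phi(\sigma P - P) = \sigma t - t$ with
  $t = \phi(T)$, then $(P - T, Q + t)$ is an invariant representative of the same class; this is (b).
  If $\phi(\sigma P - P) + (\sigma Q - Q) = \sigma t - t$, then $(P, Q - t)$ represents an invariant
  class; this is (c).

  Three facts about the geometric points enter. The chord and tangent law is a group law: associativity
  comes from an explicit formula for the slopes of the two lines that compute $(A + B) + C$ and
  $A + (B + C)$. The group is divisible: $x(nP)$ is a rational function of $x(P)$ with leading term
  $x / n^2$ at infinity, so multiplication by \<open>n\<close> hits all but finitely many points, and a subgroup
  with finite complement in an infinite group is everything. The invariant points are rational:
  a conjugation $x \mapsto w$ of algebraic numbers extends to an automorphism of $\bar K$ by Zorn's lemma.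
\<close>

section \<open>The group law\<close>

text \<open>The cohomological part is carried out for two arbitrary Galois modules on which the
  \<open>m\<close>-th power map is surjective; curves enter only through the final interpretation.
  Surjectivity makes the Kummer maps total: \<open>connecting\<close> picks a preimage with
  \<open>SOME\<close>, and every computation replaces it by a convenient one. The usual route to
  surjectivity through division polynomials needs their coprimality. The leading term of x(nP) is
  enough instead: it grows linearly, hence is a nonconstant function of x, and its recursion uses
  only the duplication and chord formulas and the fact that n - 1, n and n + 1 are nonzero in the
  field. The finitely many values lost on the way do no harm because the image is a subgroup.
  Characteristic 0 keeps these constants nonzero and also gives the separability behind the fixed
  field theorem. That theorem is needed because E(K) is defined by coordinates in K, whereas the
  exact sequences are about Galois invariants.\<close>

fun ec_neg :: "'a::field weierstrass \<Rightarrow> 'a ec_point \<Rightarrow> 'a ec_point" where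
  "ec_neg W Infinity = Infinity"
| "ec_neg W (Affine x y) = Affine x (- y - wa1 W * x - wa3 W)"

text \<open>The line $y = l x + n$ meets the curve exactly in the points with abscissae
  \<open>x1\<close>, \<open>x2\<close>, \<open>x3\<close>, counted with multiplicity: compare the coefficients of the cubic
  in \<open>x\<close> obtained by substituting the line with those of $(x - x_1)(x - x_2)(x - x_3)$. Tangents need
  no separate treatment in this form.\<close>

definition cuts :: "'a::field weierstrass \<Rightarrow> 'a \<Rightarrow> 'a \<Rightarrow> 'a \<Rightarrow> 'a \<Rightarrow> 'a \<Rightarrow> bool" where
  "cuts W l n x1 x2 x3 \<longleftrightarrow>
     l^2 + wa1 W * l - wa2 W = x1 + x2 + x3 \<and>
     wa4 W - 2 * l * n - wa1 W * n - wa3 W * l = x1 * x2 + x1 * x3 + x2 * x3 \<and>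
     n^2 + wa3 W * n - wa6 W = x1 * x2 * x3"

text \<open>Only nonvertical lines occur, since a vertical line contains \<open>Infinity\<close>;
  the pairs P, -P are split off in the proofs of the group laws. The relation rests on
  \<open>cuts\<close> and not on three incidences, so that repeated points carry their
  multiplicity.\<close>

inductive collinear :: "'a::field weierstrass \<Rightarrow> 'a ec_point \<Rightarrow> 'a ec_point \<Rightarrow> 'a ec_point \<Rightarrow> bool"
  for W where
  "cuts W l n x1 x2 x3 \<Longrightarrow>
     collinear W (Affine x1 (l * x1 + n)) (Affine x2 (l * x2 + n)) (Affine x3 (l * x3 + n))"

lemma collinear_rotate: "collinear W P Q R \<Longrightarrow> collinear W Q R P"
  by (induction rule: collinear.induct) (rule collinear.intros, simp add: cuts_def algebra_simps)

lemma collinear_swap: "collinear W P Q R \<Longrightarrow> collinear W Q P R"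
  by (induction rule: collinear.induct) (rule collinear.intros, simp add: cuts_def algebra_simps)

text \<open>By \<open>cuts\<close>, the curve equation restricted to the line is
  \<open>(x - x1)(x - x2)(x - x3) = 0\<close>, which holds at \<open>x = x1\<close>.\<close>

lemma collinear_on_curve: "collinear W P Q R \<Longrightarrow> on_curve W P"
proof (induction rule: collinear.induct)
  case (1 l n x1 x2 x3)
  then show ?case unfolding cuts_def on_curve.simps
    by Groebner_Basis.algebra
qed

text \<open>Negation is an affine map of the plane preserving abscissae: it carries the line with
  slope \<open>l\<close> and intercept \<open>n\<close> to the one with slope
  \<open>- l - wa1 W\<close> and intercept \<open>- n - wa3 W\<close>.\<close>

lemma collinear_neg:
  assumes "collinear W P Q R"
  shows "collinear W (ec_neg W P) (ec_neg W Q) (ec_neg W R)"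
  using assms
proof (induction rule: collinear.induct)
  case (1 l n x1 x2 x3)
  have *: "ec_neg W (Affine x (l * x + n)) = Affine x ((- l - wa1 W) * x + (- n - wa3 W))" for x
    by (simp add: algebra_simps)
  have "cuts W (- l - wa1 W) (- n - wa3 W) x1 x2 x3"
    using 1 unfolding cuts_def by (auto simp: algebra_simps power2_eq_square)
  then show ?case unfolding * by (rule collinear.intros)
qed

lemma ec_neg_neg [simp]: "ec_neg W (ec_neg W P) = P"
  by (cases P) auto

lemma on_curve_neg [simp]: "on_curve W (ec_neg W P) \<longleftrightarrow> on_curve W P"
proof -
  have "on_curve W P \<Longrightarrow> on_curve W (ec_neg W P)" for P
    by (cases P) (auto simp: algebra_simps power2_eq_square)
  from this[of P] this[of "ec_neg W P"] show ?thesis by auto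
qed

text \<open>If both partial derivatives vanished at a point of the curve, the three equations could
  be solved for \<open>wa3\<close>, \<open>wa4\<close> and \<open>wa6\<close>; the discriminant then
  vanishes identically in the remaining quantities.\<close>

lemma elliptic_nonsingular:
  assumes "elliptic_curve W" "on_curve W (Affine x y)"
    "2 * y + wa1 W * x + wa3 W = 0"
  shows "3 * x^2 + 2 * wa2 W * x + wa4 W - wa1 W * y \<noteq> 0"
proof
  assume *: "3 * x^2 + 2 * wa2 W * x + wa4 W - wa1 W * y = 0"
  have a4: "wa4 W = wa1 W * y - 3 * x^2 - 2 * wa2 W * x" using * by Groebner_Basis.algebra
  have a3: "wa3 W = - 2 * y - wa1 W * x" using assms(3) by Groebner_Basis.algebra
  have a6: "wa6 W = y^2 + wa1 W * x * y + wa3 W * y - (x^3 + wa2 W * x^2 + wa4 W * x)"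
    using assms(2) by simp
  have "discriminant W = 0"
    unfolding discriminant_def Let_def a6 a4 a3 by Groebner_Basis.algebra
  then show False using assms(1) by (simp add: elliptic_curve_def)
qed

lemma ec_add_eq_Infinity_iff:
  assumes "on_curve W P" "on_curve W Q"
  shows "ec_add W P Q = Infinity \<longleftrightarrow> Q = ec_neg W P"
proof (cases P; cases Q)
  fix x1 y1 x2 y2 assume "P = Affine x1 y1" "Q = Affine x2 y2"
  then show ?thesis by (auto simp: Let_def algebra_simps) (metis add.commute add_eq_0_iff2)
qed auto

text \<open>For fixed x the curve equation is a monic quadratic in y with sum of roots
  \<open>- wa1 W * x - wa3 W\<close>, and negation exchanges its two roots.\<close>

lemma on_curve_same_x:
  assumes "on_curve W (Affine x y)" "on_curve W (Affine x y')"
  shows "y' = y \<or> Affine x y' = ec_neg W (Affine x y)"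
proof -
  have "(y' - y) * (y' + y + wa1 W * x + wa3 W) = 0"
    using assms by simp Groebner_Basis.algebra
  then have "y' = y \<or> y' = - y - wa1 W * x - wa3 W"
    by Groebner_Basis.algebra
  then show ?thesis by simp
qed

lemma ec_add_slope:
  assumes "\<not> (x1 = x2 \<and> y1 + y2 + wa1 W * x2 + wa3 W = 0)"
    and "l = (if x1 = x2
              then (3 * x1^2 + 2 * wa2 W * x1 + wa4 W - wa1 W * y1) /
                   (2 * y1 + wa1 W * x1 + wa3 W)
              else (y2 - y1) / (x2 - x1))"
    and "x3 = l^2 + wa1 W * l - wa2 W - x1 - x2"
  shows "ec_add W (Affine x1 y1) (Affine x2 y2) =
           Affine x3 (- (y1 + l * (x3 - x1)) - wa1 W * x3 - wa3 W)"
  by (simp only: ec_add.simps assms if_False Let_def)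

text \<open>The slope in the definition of \<open>ec_add\<close> is recovered from
  \<open>cuts\<close>: by incidence for a chord, by the double root for a tangent. Nonsingularity
  keeps the denominator of the tangent slope nonzero.\<close>

lemma collinear_ec_add:
  assumes "elliptic_curve W" "collinear W P Q R"
  shows "ec_add W P Q = ec_neg W R"
  using assms(2)
proof cases
  case (1 l n x1 x2 x3)
  note P = collinear_on_curve[OF assms(2), unfolded 1]
  show ?thesis
  proof (cases "x1 = x2")
    case True
    have c: "cuts W l n x1 x1 x3" using 1 True by simp
    let ?y = "l * x1 + n"
    \<comment> \<open>The derivative of the cubic vanishes at its double root
      \<open>x1\<close>.\<close>
    have l: "l * (2 * ?y + wa1 W * x1 + wa3 W) = 3 * x1^2 + 2 * wa2 W * x1 + wa4 W - wa1 W * ?y"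
      using c unfolding cuts_def by Groebner_Basis.algebra
    have nz: "2 * ?y + wa1 W * x1 + wa3 W \<noteq> 0"
      using elliptic_nonsingular[OF assms(1) P] l by auto
    then have "l = (3 * x1^2 + 2 * wa2 W * x1 + wa4 W - wa1 W * ?y) / (2 * ?y + wa1 W * x1 + wa3 W)"
      using l by (simp add: field_simps)
    moreover have "?y + ?y + wa1 W * x1 + wa3 W \<noteq> 0" using nz by (simp add: algebra_simps)
    moreover have "x3 = l^2 + wa1 W * l - wa2 W - x1 - x1" using c unfolding cuts_def by Groebner_Basis.algebra
    ultimately have "ec_add W (Affine x1 ?y) (Affine x1 ?y) = 
        Affine x3 (- (?y + l * (x3 - x1)) - wa1 W * x3 - wa3 W)"
      by (intro ec_add_slope) auto
    then show ?thesis using 1 True by (simp add: algebra_simps)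
  next
    case False
    have "l * x2 - l * x1 = l * (x2 - x1)" by (simp add: algebra_simps)
    then have "l = (l * x2 + n - (l * x1 + n)) / (x2 - x1)" using False by simp
    moreover have "x3 = l^2 + wa1 W * l - wa2 W - x1 - x2" using 1(4) unfolding cuts_def by Groebner_Basis.algebra
    ultimately have "ec_add W (Affine x1 (l * x1 + n)) (Affine x2 (l * x2 + n)) = 
        Affine x3 (- (l * x1 + n + l * (x3 - x1)) - wa1 W * x3 - wa3 W)"
      using False by (intro ec_add_slope) auto
    then show ?thesis using 1 by (simp add: algebra_simps)
  qed
qed

lemma ex_collinear:
  assumes "on_curve W P" "on_curve W Q" "P \<noteq> Infinity" "Q \<noteq> Infinity" "Q \<noteq> ec_neg W P"
  shows "\<exists>R. collinear W P Q R"
proof -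
  obtain x1 y1 x2 y2 where P: "P = Affine x1 y1" and Q: "Q = Affine x2 y2"
    using assms(3,4) by (metis ec_point.exhaust)
  show ?thesis
  proof (cases "x1 = x2")
    case True
    then have y: "y2 = y1" using on_curve_same_x[of W x1 y1 y2] assms P Q by auto
    have nz: "2 * y1 + wa1 W * x1 + wa3 W \<noteq> 0"
    proof
      assume "2 * y1 + wa1 W * x1 + wa3 W = 0"
      then have "y1 = - y1 - wa1 W * x1 - wa3 W" by Groebner_Basis.algebra
      then show False using assms(5) P Q y True by simp
    qed
    define l where "l = (3 * x1^2 + 2 * wa2 W * x1 + wa4 W - wa1 W * y1) / (2 * y1 + wa1 W * x1 + wa3 W)"
    have l: "l * (2 * y1 + wa1 W * x1 + wa3 W) = 3 * x1^2 + 2 * wa2 W * x1 + wa4 W - wa1 W * y1"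
      using nz by (simp add: l_def)
    define n where "n = y1 - l * x1"
    define x3 where "x3 = l^2 + wa1 W * l - wa2 W - x1 - x1"
    have y1: "y1 = l * x1 + n" by (simp add: n_def)
    have "y1^2 + wa1 W * x1 * y1 + wa3 W * y1 = x1^3 + wa2 W * x1^2 + wa4 W * x1 + wa6 W"
      using assms P by simp
    then have "cuts W l n x1 x1 x3"
      unfolding cuts_def using l unfolding x3_def n_def by Groebner_Basis.algebra
    from collinear.intros[OF this] show ?thesis
      using P Q True y y1 by auto
  next
    case False
    define l where "l = (y2 - y1) / (x2 - x1)"
    have l: "l * (x2 - x1) = y2 - y1" using False by (simp add: l_def)
    define n where "n = y1 - l * x1"
    define x3 where "x3 = l^2 + wa1 W * l - wa2 W - x1 - x2"
    have y1: "y1 = l * x1 + n" by (simp add: n_def)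
    have y2: "y2 = l * x2 + n" using l unfolding n_def by Groebner_Basis.algebra
    have e1: "y1^2 + wa1 W * x1 * y1 + wa3 W * y1 = x1^3 + wa2 W * x1^2 + wa4 W * x1 + wa6 W"
      and e2: "y2^2 + wa1 W * x2 * y2 + wa3 W * y2 = x2^3 + wa2 W * x2^2 + wa4 W * x2 + wa6 W"
      using assms P Q by auto
    \<comment> \<open>By the choice of \<open>x3\<close>, the cubic minus
      \<open>(x - x1)(x - x2)(x - x3)\<close> has degree at most 1. It vanishes at \<open>x1\<close>
      and \<open>x2\<close>; the difference of these two values is \<open>x1 - x2\<close> times its
      linear coefficient.\<close>
    have "(x1 - x2) * (wa4 W - 2 * l * n - wa1 W * n - wa3 W * l - (x1 * x2 + x1 * x3 + x2 * x3)) = 0"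
      using e1 e2 unfolding y1 y2 x3_def by Groebner_Basis.algebra
    then have c2: "wa4 W - 2 * l * n - wa1 W * n - wa3 W * l = x1 * x2 + x1 * x3 + x2 * x3"
      using False by simp
    have c1: "l^2 + wa1 W * l - wa2 W = x1 + x2 + x3" by (simp add: x3_def)
    have "n^2 + wa3 W * n - wa6 W = x1 * x2 * x3"
      using e1 c1 c2 unfolding y1 by Groebner_Basis.algebra
    then have "cuts W l n x1 x2 x3" using c1 c2 by (simp add: cuts_def)
    from collinear.intros[OF this] show ?thesis using P Q y1 y2 by auto
  qed
qed

text \<open>Let \<open>l\<close> and \<open>k\<close> be the slopes of the lines through \<open>A\<close>, \<open>B\<close>, \<open>D\<close> and
  \<open>B\<close>, \<open>C\<close>, \<open>F\<close>, and $M = (x_C - x_A) / (k - l)$. Then the lines through $-D$, \<open>C\<close> and through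
  \<open>A\<close>, $-F$ have slopes $M - l - a_1$ and $M - k - a_1$, and both pass through the same third point.\<close>

lemma collinear_assoc:
  assumes "elliptic_curve W" "collinear W A B D" "collinear W B C F" "C \<noteq> D" "A \<noteq> F"
  shows "\<exists>G. collinear W (ec_neg W D) C G \<and> collinear W A (ec_neg W F) G"
proof -
  obtain l n xa xb xd where 1: "A = Affine xa (l * xa + n)" "B = Affine xb (l * xb + n)"
    "D = Affine xd (l * xd + n)" "cuts W l n xa xb xd"
    using assms(2) by (cases rule: collinear.cases) (rule that)
  obtain k r xb' xc xf where two: "B = Affine xb' (k * xb' + r)" "C = Affine xc (k * xc + r)"
    "F = Affine xf (k * xf + r)" "cuts W k r xb' xc xf"
    using assms(3) by (cases rule: collinear.cases) (rule that)
  have [simp]: "xb' = xb" and r: "r = (l - k) * xb + n"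
    using 1 two by (auto simp: algebra_simps)
  note 2 = two[simplified]
  show ?thesis
  proof (cases "k = l")
    case True
    \<comment> \<open>Parallel lines through B coincide, so the abscissae of A, D and of C, F agree
      as multisets. As A is not F, this forces A = C and D = F, and the two required lines are one
      and the same.\<close>
    then have [simp]: "r = n" using r by simp
    have sums: "xa + xd = xc + xf" "xa * (xb + xd) + xb * xd = xb * (xc + xf) + xc * xf"
      using 1(4) 2(4) True unfolding cuts_def by (auto simp: algebra_simps)
    then have "(xa - xc) * (xa - xf) = 0"
      by Groebner_Basis.algebra
    then have "xa = xc" using assms(5) 1 2 True by auto
    then have "A = C" "D = F" using sums 1 2 True by auto
    moreover have "on_curve W (ec_neg W D)" "on_curve W C"
      using collinear_on_curve collinear_rotate assms(2,3) by (metis on_curve_neg)+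
    then obtain G where "collinear W (ec_neg W D) C G"
      using ex_collinear[of W "ec_neg W D" C] 1 2 assms(4) by auto
    ultimately show ?thesis using collinear_swap by blast
  next
    case False
    define M where "M = (xc - xa) / (k - l)"
    have M: "M * (k - l) = xc - xa" using False by (simp add: M_def)
    define s where "s = M - l - wa1 W"
    define t where "t = M - k - wa1 W"
    \<comment> \<open>The intercepts are chosen so that the lines pass through C and A; that they
      also contain -D and -F is the content of \<open>D\<close> and \<open>F\<close> below.\<close>
    define n1 where "n1 = k * xc + r - s * xc"
    define n2 where "n2 = l * xa + n - t * xa"
    define xg where "xg = s^2 + wa1 W * s - wa2 W - xc - xd"
    have c1: "l^2 + wa1 W * l - wa2 W = xa + xb + xd"
      "wa4 W - 2 * l * n - wa1 W * n - wa3 W * l = xa * xb + xa * xd + xb * xd"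
      "n^2 + wa3 W * n - wa6 W = xa * xb * xd"
      and c2: "k^2 + wa1 W * k - wa2 W = xb + xc + xf"
      "wa4 W - 2 * k * r - wa1 W * r - wa3 W * k = xb * xc + xb * xf + xc * xf"
      "r^2 + wa3 W * r - wa6 W = xb * xc * xf"
      using 1(4) 2(4) by (auto simp: cuts_def)
    \<comment> \<open>M is known only through \<open>M * (k - l) = xc - xa\<close>, so the
      identities involving it are multiplied by \<open>k - l\<close> where necessary and the factor
      is cancelled afterwards.\<close>
    have "(k - l) * (s * xd + n1 - (- (l * xd + n) - wa1 W * xd - wa3 W)) = 0"
      using c1 c2 M unfolding n1_def s_def r by Groebner_Basis.algebra
    then have D: "s * xd + n1 = - (l * xd + n) - wa1 W * xd - wa3 W" using False by simp
    have "(k - l) * (t * xf + n2 - (- (k * xf + r) - wa1 W * xf - wa3 W)) = 0"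
      using c1 c2 M unfolding n2_def t_def r by Groebner_Basis.algebra
    then have F: "t * xf + n2 = - (k * xf + r) - wa1 W * xf - wa3 W" using False by simp
    have x: "xg = t^2 + wa1 W * t - wa2 W - xa - xf"
      using c1(1) c2(1) M unfolding xg_def s_def t_def by Groebner_Basis.algebra
    have "(k - l) * (s * xg + n1 - (t * xg + n2)) = 0"
      using c1 c2 M unfolding xg_def n1_def n2_def s_def t_def r by Groebner_Basis.algebra
    then have G: "s * xg + n1 = t * xg + n2" using False by simp
    have "(k - l) * (wa4 W - 2 * s * n1 - wa1 W * n1 - wa3 W * s - (xd * xc + xd * xg + xc * xg)) = 0"
      using c1 c2 M unfolding xg_def n1_def s_def r by Groebner_Basis.algebra
    then have C: "wa4 W - 2 * s * n1 - wa1 W * n1 - wa3 W * s = xd * xc + xd * xg + xc * xg"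
      using False by simp
    have "(k - l) * (wa4 W - 2 * t * n2 - wa1 W * n2 - wa3 W * t - (xa * xf + xa * xg + xf * xg)) = 0"
      using c1 c2 M unfolding x n2_def t_def r by Groebner_Basis.algebra
    then have A: "wa4 W - 2 * t * n2 - wa1 W * n2 - wa3 W * t = xa * xf + xa * xg + xf * xg"
      using False by simp
    have C': "s^2 + wa1 W * s - wa2 W = xd + xc + xg" by (simp add: xg_def)
    have A': "t^2 + wa1 W * t - wa2 W = xa + xf + xg" by (simp add: x)
    \<comment> \<open>The constant coefficient follows from the other two because C lies on the line
      and on the curve.\<close>
    have "n1^2 + wa3 W * n1 - wa6 W = xd * xc * xg"
      using C C' c2 unfolding n1_def by Groebner_Basis.algebra
    then have "cuts W s n1 xd xc xg" using C C' by (simp add: cuts_def)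
    then have G1: "collinear W (Affine xd (s * xd + n1)) (Affine xc (s * xc + n1)) (Affine xg (s * xg + n1))"
      by (rule collinear.intros)
    have "n2^2 + wa3 W * n2 - wa6 W = xa * xf * xg"
      using A A' c1 unfolding n2_def by Groebner_Basis.algebra
    then have "cuts W t n2 xa xf xg" using A A' by (simp add: cuts_def)
    then have "collinear W (Affine xa (t * xa + n2)) (Affine xf (t * xf + n2)) (Affine xg (t * xg + n2))"
      by (rule collinear.intros)
    moreover have "t * xa + n2 = l * xa + n" "s * xc + n1 = k * xc + r"
      by (simp_all add: n1_def n2_def)
    ultimately show ?thesis using G1 1 2 D F G by auto
  qed
qed

section \<open>Group axioms for the chord and tangent law\<close>

lemma ec_add_Infinity_right [simp]: "ec_add W P Infinity = P"
  by (cases P) auto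

text \<open>The line through P, Q, R, negated and reordered, joins -P, -R, -Q, so the sum of -P and
  -R is Q. This cancellation settles associativity when an inner sum is
  \<open>Infinity\<close>.\<close>

lemma ec_add_neg_cancel:
  assumes "elliptic_curve W" "on_curve W P" "on_curve W Q"
  shows "ec_add W (ec_neg W P) (ec_add W P Q) = Q"
proof (cases "P = Infinity \<or> Q = Infinity \<or> Q = ec_neg W P")
  case True
  then show ?thesis using assms ec_add_eq_Infinity_iff[of W P Q]
     ec_add_eq_Infinity_iff[of W "ec_neg W P" P] by auto
next
  case False
  then obtain R where R: "collinear W P Q R" using ex_collinear assms by blast
  then have "ec_add W P Q = ec_neg W R" using collinear_ec_add assms by blast
  moreover have "collinear W (ec_neg W P) (ec_neg W R) (ec_neg W Q)"
    using collinear_neg[OF R] collinear_swap collinear_rotate by blast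
  then have "ec_add W (ec_neg W P) (ec_neg W R) = Q" using collinear_ec_add assms by fastforce
  ultimately show ?thesis by simp
qed

lemma ec_add_on_curve:
  assumes "elliptic_curve W" "on_curve W P" "on_curve W Q"
  shows "on_curve W (ec_add W P Q)"
proof (cases "P = Infinity \<or> Q = Infinity \<or> Q = ec_neg W P")
  case True
  then show ?thesis using assms ec_add_eq_Infinity_iff[of W P Q] by auto
next
  case False
  then obtain R where R: "collinear W P Q R" using ex_collinear assms by blast
  then show ?thesis using collinear_ec_add[OF assms(1) R] collinear_on_curve collinear_rotate
    by (metis on_curve_neg)
qed

lemma ec_add_commute:
  assumes "elliptic_curve W" "on_curve W P" "on_curve W Q"
  shows "ec_add W P Q = ec_add W Q P"
proof (cases "P = Infinity \<or> Q = Infinity \<or> Q = ec_neg W P")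
  case True
  then show ?thesis using assms ec_add_eq_Infinity_iff[of W P Q] ec_add_eq_Infinity_iff[of W Q P] by auto
next
  case False
  then obtain R where R: "collinear W P Q R" using ex_collinear assms by blast
  then show ?thesis using collinear_ec_add collinear_swap assms by metis
qed

lemma ec_add_assoc:
  assumes "elliptic_curve W" "on_curve W A" "on_curve W B" "on_curve W C"
  shows "ec_add W (ec_add W A B) C = ec_add W A (ec_add W B C)"
proof (cases "A = Infinity \<or> B = Infinity \<or> C = Infinity \<or> B = ec_neg W A \<or> C = ec_neg W B")
  case True
  note comm = ec_add_commute[OF assms(1)]
  consider "A = Infinity \<or> B = Infinity \<or> C = Infinity" | "B = ec_neg W A" | "C = ec_neg W B"
    using True by blast
  then show ?thesis
  proof cases
    case 2
    then have "ec_add W A B = Infinity" using assms ec_add_eq_Infinity_iff by metis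
    then show ?thesis using ec_add_neg_cancel[of W B C] 2 assms by simp
  next
    case 3
    then have "ec_add W B C = Infinity" using assms ec_add_eq_Infinity_iff by metis
    then show ?thesis using ec_add_neg_cancel[of W B A] 3 assms
      by (simp add: comm ec_add_on_curve)
  qed auto
next
  case False
  obtain D where D: "collinear W A B D" using ex_collinear assms False by blast
  obtain F where F: "collinear W B C F" using ex_collinear assms False by blast
  note add = collinear_ec_add[OF assms(1)]
  have AB: "ec_add W A B = ec_neg W D" and BC: "ec_add W B C = ec_neg W F" using add D F by auto
  have curve: "on_curve W D" "on_curve W F" using D F collinear_on_curve collinear_rotate by blast+
  \<comment> \<open>The first two cases are those excluded by \<open>collinear_assoc\<close>: A, B,
    C then lie on one line, A + B = -C and B + C = -A, and both sides are \<open>Infinity\<close>.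
    In the third case both sides are the negative of the common point G.\<close>
  consider "C = D" | "A = F" | "C \<noteq> D" "A \<noteq> F" by blast
  then show ?thesis
  proof cases
    case 1
    then have "ec_add W B C = ec_neg W A" using add D collinear_rotate by blast
    then show ?thesis using AB 1 assms ec_add_eq_Infinity_iff[of W A "ec_neg W A"]
      ec_add_eq_Infinity_iff[of W "ec_neg W C" C] by simp
  next
    case 2
    then have "ec_add W A B = ec_neg W C" using add F collinear_rotate by blast
    then show ?thesis using BC 2 assms ec_add_eq_Infinity_iff[of W A "ec_neg W A"]
      ec_add_eq_Infinity_iff[of W "ec_neg W C" C] by simp
  next
    case 3
    then obtain G where "collinear W (ec_neg W D) C G" "collinear W A (ec_neg W F) G"
      using collinear_assoc[OF assms(1) D F] by blast
    then show ?thesis using AB BC add by simp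
  qed
qed

lemma ec_group_comm_group:
  assumes "elliptic_curve W"
  shows "comm_group (ec_group W)"
proof (rule comm_groupI)
  fix P assume "P \<in> carrier (ec_group W)"
  then have "ec_neg W P \<in> carrier (ec_group W) \<and> ec_neg W P \<otimes>\<^bsub>ec_group W\<^esub> P = \<one>\<^bsub>ec_group W\<^esub>"
    using ec_add_eq_Infinity_iff[of W "ec_neg W P" P] by (simp add: ec_group_def)
  then show "\<exists>y\<in>carrier (ec_group W). y \<otimes>\<^bsub>ec_group W\<^esub> P = \<one>\<^bsub>ec_group W\<^esub>" by blast
qed (auto simp: ec_group_def ec_add_on_curve[OF assms] ec_add_assoc[OF assms]
  intro: ec_add_commute[OF assms])


section \<open>Divisibility\<close>

text \<open>\<open>F\<close> agrees off a finite set with a rational function of the form $c x^d + O(x^{d-1})$ at infinity;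
  $c = 0$ is allowed.\<close>

definition rat_asymp :: "('a::field \<Rightarrow> 'a) \<Rightarrow> 'a \<Rightarrow> nat \<Rightarrow> bool" where
  "rat_asymp F c d \<longleftrightarrow> (\<exists>p q. q \<noteq> 0 \<and> Polynomial.degree p \<le> Polynomial.degree q + d \<and>
     poly.coeff p (Polynomial.degree q + d) = c * poly.coeff q (Polynomial.degree q) \<and>
     (\<forall>\<^sub>\<infinity>x. F x = poly p x / poly q x))"

text \<open>Bounds replace degrees because the coefficients tracked may be 0: if a bound is not
  attained, both sides vanish.\<close>

lemma coeff_mult_degree_le:
  fixes p q :: "'a::idom poly"
  assumes "Polynomial.degree p \<le> a" "Polynomial.degree q \<le> b"
  shows "poly.coeff (p * q) (a + b) = poly.coeff p a * poly.coeff q b"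
proof (cases "Polynomial.degree p = a \<and> Polynomial.degree q = b")
  case True
  then show ?thesis using coeff_mult_degree_sum by blast
next
  case False
  then have "Polynomial.degree p + Polynomial.degree q < a + b" using assms by linarith
  then have "poly.coeff (p * q) (a + b) = 0"
    using degree_mult_le[of p q] by (intro coeff_eq_0) linarith
  moreover have "poly.coeff p a = 0 \<or> poly.coeff q b = 0"
    using False assms by (metis coeff_eq_0 le_neq_implies_less)
  ultimately show ?thesis by auto
qed

lemma MOST_poly_nonzero: "p \<noteq> 0 \<Longrightarrow> \<forall>\<^sub>\<infinity>x. poly p x \<noteq> (0::'a::idom)"
  using poly_roots_finite[of p] by (simp add: MOST_iff_finiteNeg)

lemma rat_asymp_poly:
  "Polynomial.degree p \<le> d \<Longrightarrow> rat_asymp (poly p) (poly.coeff p d) d"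
  unfolding rat_asymp_def by (intro exI[of _ p] exI[of _ 1]) auto

lemma rat_asymp_add:
  assumes "rat_asymp F a d" "rat_asymp G b d"
  shows "rat_asymp (\<lambda>x. F x + G x) (a + b) d"
proof -
  obtain p q where 1: "q \<noteq> 0" "Polynomial.degree p \<le> Polynomial.degree q + d"
     "poly.coeff p (Polynomial.degree q + d) = a * poly.coeff q (Polynomial.degree q)"
     "\<forall>\<^sub>\<infinity>x. F x = poly p x / poly q x" using assms(1) unfolding rat_asymp_def by blast
  obtain r s where 2: "s \<noteq> 0" "Polynomial.degree r \<le> Polynomial.degree s + d"
     "poly.coeff r (Polynomial.degree s + d) = b * poly.coeff s (Polynomial.degree s)"
     "\<forall>\<^sub>\<infinity>x. G x = poly r x / poly s x" using assms(2) unfolding rat_asymp_def by blast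
  let ?q = "q * s" and ?p = "p * s + r * q"
  have deg: "Polynomial.degree ?q = Polynomial.degree q + Polynomial.degree s"
    using 1 2 by (simp add: degree_mult_eq)
  have "Polynomial.degree (p * s) \<le> Polynomial.degree ?q + d"
       "Polynomial.degree (r * q) \<le> Polynomial.degree ?q + d"
    using 1 2 deg degree_mult_le[of p s] degree_mult_le[of r q] by linarith+
  then have "Polynomial.degree ?p \<le> Polynomial.degree ?q + d"
    by (rule degree_add_le)
  moreover have "poly.coeff ?p (Polynomial.degree ?q + d) = (a + b) * poly.coeff ?q (Polynomial.degree ?q)"
    using coeff_mult_degree_le[OF 1(2) order.refl[of "Polynomial.degree s"]]
      coeff_mult_degree_le[OF 2(2) order.refl[of "Polynomial.degree q"]]
    using 1(3) 2(3) unfolding deg by (simp add: coeff_mult_degree_sum algebra_simps)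
  \<comment> \<open>Adding fractions fails at the zeros of \<open>q\<close> and \<open>s\<close>, so
    these finitely many points are discarded.\<close>
  moreover have "\<forall>\<^sub>\<infinity>x. F x + G x = poly ?p x / poly ?q x"
    using 1(4) 2(4) MOST_poly_nonzero[OF 1(1)] MOST_poly_nonzero[OF 2(1)]
    by eventually_elim (simp add: field_simps)
  moreover have "?q \<noteq> 0" using 1 2 by simp
  ultimately show ?thesis unfolding rat_asymp_def by blast
qed

lemma rat_asymp_mult:
  assumes "rat_asymp F a d" "rat_asymp G b e"
  shows "rat_asymp (\<lambda>x. F x * G x) (a * b) (d + e)"
proof -
  obtain p q where 1: "q \<noteq> 0" "Polynomial.degree p \<le> Polynomial.degree q + d"
     "poly.coeff p (Polynomial.degree q + d) = a * poly.coeff q (Polynomial.degree q)"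
     "\<forall>\<^sub>\<infinity>x. F x = poly p x / poly q x" using assms(1) unfolding rat_asymp_def by blast
  obtain r s where 2: "s \<noteq> 0" "Polynomial.degree r \<le> Polynomial.degree s + e"
     "poly.coeff r (Polynomial.degree s + e) = b * poly.coeff s (Polynomial.degree s)"
     "\<forall>\<^sub>\<infinity>x. G x = poly r x / poly s x" using assms(2) unfolding rat_asymp_def by blast
  let ?q = "q * s" and ?p = "p * r"
  have deg: "Polynomial.degree ?q + (d + e) =
      (Polynomial.degree q + d) + (Polynomial.degree s + e)"
    using 1 2 by (simp add: degree_mult_eq)
  have "Polynomial.degree ?p \<le> Polynomial.degree ?q + (d + e)"
    using 1 2 deg degree_mult_le[of p r] by linarith
  moreover have "poly.coeff ?p (Polynomial.degree ?q + (d + e)) = (a * b) * poly.coeff ?q (Polynomial.degree ?q)"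
    unfolding deg coeff_mult_degree_le[OF 1(2) 2(2)] using 1 2
    by (simp add: degree_mult_eq coeff_mult_degree_sum algebra_simps)
  moreover have "\<forall>\<^sub>\<infinity>x. F x * G x = poly ?p x / poly ?q x"
    using 1(4) 2(4) by eventually_elim simp
  moreover have "?q \<noteq> 0" using 1 2 by simp
  ultimately show ?thesis unfolding rat_asymp_def by blast
qed

text \<open>Since \<open>b\<close> is nonzero, the numerator of \<open>G\<close> attains its degree
  bound and can serve as part of the new denominator with known degree.\<close>

lemma rat_asymp_divide:
  assumes "rat_asymp F a (d + e)" "rat_asymp G b e" "b \<noteq> 0"
  shows "rat_asymp (\<lambda>x. F x / G x) (a / b) d"
proof -
  obtain p q where 1: "q \<noteq> 0" "Polynomial.degree p \<le> Polynomial.degree q + (d + e)"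
     "poly.coeff p (Polynomial.degree q + (d + e)) = a * poly.coeff q (Polynomial.degree q)"
     "\<forall>\<^sub>\<infinity>x. F x = poly p x / poly q x" using assms(1) unfolding rat_asymp_def by blast
  obtain r s where 2: "s \<noteq> 0" "Polynomial.degree r \<le> Polynomial.degree s + e"
     "poly.coeff r (Polynomial.degree s + e) = b * poly.coeff s (Polynomial.degree s)"
     "\<forall>\<^sub>\<infinity>x. G x = poly r x / poly s x" using assms(2) unfolding rat_asymp_def by blast
  have nz: "poly.coeff r (Polynomial.degree s + e) \<noteq> 0" using 2 assms(3) by simp
  then have r: "r \<noteq> 0" "Polynomial.degree r = Polynomial.degree s + e"
    using 2(2) le_degree[of r "Polynomial.degree s + e"] by auto
  let ?q = "q * r" and ?p = "p * s"
  have deg: "Polynomial.degree ?q + d =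
      (Polynomial.degree q + (d + e)) + Polynomial.degree s"
    using 1 r by (simp add: degree_mult_eq)
  have "Polynomial.degree ?p \<le> Polynomial.degree ?q + d"
    using 1 deg degree_mult_le[of p s] by linarith
  moreover have "poly.coeff ?p (Polynomial.degree ?q + d) = (a / b) * poly.coeff ?q (Polynomial.degree ?q)"
    unfolding deg coeff_mult_degree_le[OF 1(2) order.refl[of "Polynomial.degree s"]]
    using 1 2 r assms(3)
    by (simp add: degree_mult_eq coeff_mult_degree_le)
  moreover have "\<forall>\<^sub>\<infinity>x. F x / G x = poly ?p x / poly ?q x"
    using 1(4) 2(4) by eventually_elim simp
  moreover have "?q \<noteq> 0" using 1 r by simp
  ultimately show ?thesis unfolding rat_asymp_def by blast
qed

lemma rat_asymp_polyI:
  assumes "\<And>x. F x = poly p x" "Polynomial.degree p \<le> d" "poly.coeff p d = c"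
  shows "rat_asymp F c d"
proof -
  have "F = poly p" using assms(1) by (rule ext)
  then show ?thesis using rat_asymp_poly[OF assms(2)] assms(3) by simp
qed

lemma rat_asymp_const: "rat_asymp (\<lambda>x. c) c 0"
  by (rule rat_asymp_polyI[of _ "[:c:]"]) auto

text \<open>A constant counted in degree 1, where its leading coefficient is 0; in this form it can
  be subtracted from functions of linear growth.\<close>

lemma rat_asymp_const_1: "rat_asymp (\<lambda>x. c) 0 1"
  by (rule rat_asymp_polyI[of _ "[:c:]"]) auto

lemma rat_asymp_id: "rat_asymp (\<lambda>x. x) 1 1"
  by (rule rat_asymp_polyI[of _ "[:0, 1:]"]) auto

lemma rat_asymp_diff:
  assumes "rat_asymp F a d" "rat_asymp G b d"
  shows "rat_asymp (\<lambda>x. F x - G x) (a - b) d"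
  using rat_asymp_add[OF assms(1), of "\<lambda>x. - 1 * G x" "- 1 * b"]
    rat_asymp_mult[OF rat_asymp_const[of "-1"] assms(2)] by simp

lemma rat_asymp_nonzero:
  assumes "rat_asymp F c d" "c \<noteq> 0"
  shows "\<forall>\<^sub>\<infinity>x. F x \<noteq> 0"
proof -
  obtain p q where 1: "q \<noteq> 0" "Polynomial.degree p \<le> Polynomial.degree q + d"
     "poly.coeff p (Polynomial.degree q + d) = c * poly.coeff q (Polynomial.degree q)"
     "\<forall>\<^sub>\<infinity>x. F x = poly p x / poly q x" using assms(1) unfolding rat_asymp_def by blast
  then have "p \<noteq> 0" using assms by auto
  from MOST_poly_nonzero[OF this] MOST_poly_nonzero[OF 1(1)] 1(4)
  show ?thesis by eventually_elim simp
qed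

text \<open>Cancelling a common linear factor lowers the degree of \<open>q\<close> and preserves
  both the degree bound and the relation between leading coefficients, so induction ends at a
  fraction without common roots.\<close>

lemma rat_asymp_coprime:
  assumes "rat_asymp F c d"
  obtains p q where "q \<noteq> 0" "Polynomial.degree p \<le> Polynomial.degree q + d"
     "poly.coeff p (Polynomial.degree q + d) = c * poly.coeff q (Polynomial.degree q)"
     "\<forall>\<^sub>\<infinity>x. F x = poly p x / poly q x" "\<And>x. poly q x = 0 \<Longrightarrow> poly p x \<noteq> 0"
proof -
  define P where "P = (\<lambda>p q. q \<noteq> 0 \<and> Polynomial.degree p \<le> Polynomial.degree q + d \<and>
     poly.coeff p (Polynomial.degree q + d) = c * poly.coeff q (Polynomial.degree q) \<and>
     (\<forall>\<^sub>\<infinity>x. F x = poly p x / poly q x))"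
  have "P p q \<Longrightarrow> \<exists>p q. P p q \<and> (\<forall>x. poly q x = 0 \<longrightarrow> poly p x \<noteq> 0)" for p q
  proof (induction "Polynomial.degree q" arbitrary: p q rule: less_induct)
    case less
    note prems = less.prems[unfolded P_def]
    show ?case
    proof (cases "\<exists>x. poly q x = 0 \<and> poly p x = 0")
      case True
      then obtain a where "poly q a = 0" "poly p a = 0" by blast
      then obtain q' p' where q: "q = [:-a, 1:] * q'" and p: "p = [:-a, 1:] * p'"
        by (meson poly_eq_0_iff_dvd dvdE)
      have lin: "[:-a, 1:] \<noteq> 0" by simp
      have q0: "q' \<noteq> 0" using prems q by auto
      then have dq: "Polynomial.degree q = Suc (Polynomial.degree q')"
        unfolding q by (subst degree_mult_eq) auto
      have dp: "Polynomial.degree p' \<le> Polynomial.degree q' + d"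
      proof (cases "p' = 0")
        case False
        then have "Polynomial.degree p = Suc (Polynomial.degree p')"
          unfolding p by (subst degree_mult_eq) auto
        then show ?thesis using prems dq by simp
      qed simp
      have "poly.coeff p (1 + (Polynomial.degree q' + d)) = poly.coeff p' (Polynomial.degree q' + d)"
        unfolding p by (subst coeff_mult_degree_le[OF _ dp]) auto
      moreover have "poly.coeff q (1 + Polynomial.degree q') = poly.coeff q' (Polynomial.degree q')"
        unfolding q by (subst coeff_mult_degree_le) auto
      ultimately have "poly.coeff p' (Polynomial.degree q' + d) = c * poly.coeff q' (Polynomial.degree q')"
        using prems dq by simp
      moreover have "\<forall>\<^sub>\<infinity>x. F x = poly p x / poly q x" using prems by blast
      then have "\<forall>\<^sub>\<infinity>x. F x = poly p' x / poly q' x"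
        using MOST_poly_nonzero[of "[:-a, 1:]", OF lin]
        by eventually_elim (simp only: p q poly_mult mult_divide_mult_cancel_left simp_thms)
      ultimately have "P p' q'" unfolding P_def using q0 dp by blast
      then show ?thesis using less.hyps[of q' p'] dq by simp
    next
      case False
      then show ?thesis using less.prems by blast
    qed
  qed
  moreover obtain p q where "P p q" using assms unfolding rat_asymp_def P_def by blast
  ultimately obtain p q where "P p q \<and> (\<forall>x. poly q x = 0 \<longrightarrow> poly p x \<noteq> 0)" by blast
  then show ?thesis using that unfolding P_def by blast
qed

text \<open>Off a finite set of values \<open>t\<close>, a root of $p - t q$ avoids the finitely many exceptional points,
  and coprimality ensures that \<open>q\<close> does not vanish there.\<close>

lemma rat_asymp_surj:
  fixes F :: "'a::alg_closed_field \<Rightarrow> 'a"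
  assumes "rat_asymp F c 1" "c \<noteq> 0" "\<forall>\<^sub>\<infinity>x. G x"
  shows "\<forall>\<^sub>\<infinity>t. \<exists>x. G x \<and> F x = t"
proof -
  obtain p q where 1: "q \<noteq> 0" "Polynomial.degree p \<le> Polynomial.degree q + 1"
     "poly.coeff p (Polynomial.degree q + 1) = c * poly.coeff q (Polynomial.degree q)"
     "\<forall>\<^sub>\<infinity>x. F x = poly p x / poly q x" "\<And>x. poly q x = 0 \<Longrightarrow> poly p x \<noteq> 0"
    by (rule rat_asymp_coprime[OF assms(1)]) blast
  define B where "B = {x. \<not> (G x \<and> F x = poly p x / poly q x)}"
  have "finite B" using eventually_conj[OF assms(3) 1(4)] by (simp add: B_def MOST_iff_finiteNeg)
  then have fin: "finite ((\<lambda>x. poly p x / poly q x) ` B)" by simp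
  have "\<exists>x. G x \<and> F x = t" if t: "t \<notin> (\<lambda>x. poly p x / poly q x) ` B" for t
  proof -
    let ?r = "p - Polynomial.smult t q"
    \<comment> \<open>Linear growth puts the top coefficient of \<open>p\<close> one degree above
      \<open>q\<close>, so subtracting \<open>t q\<close> cannot cancel it, whatever
      \<open>t\<close> is.\<close>
    have "poly.coeff ?r (Polynomial.degree q + 1) \<noteq> 0" using 1 assms(2) by (simp add: coeff_eq_0)
    then have "Polynomial.degree ?r > 0" using le_degree by fastforce
    then obtain x where x: "poly ?r x = 0" using alg_closed_imp_poly_has_root by blast
    then have "poly q x \<noteq> 0" using 1(5)[of x] by auto
    then have "t = poly p x / poly q x" using x by (simp add: field_simps)
    then show ?thesis using t by (auto simp: B_def)
  qed
  then have "{t. \<not> (\<exists>x. G x \<and> F x = t)} \<subseteq> (\<lambda>x. poly p x / poly q x) ` B" by blast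
  with fin show ?thesis unfolding MOST_iff_finiteNeg by (rule rev_finite_subset)
qed

text \<open>In the coordinate $\eta = 2 y + a_1 x + a_3$ negation is $\eta \mapsto - \eta$, so that $\eta(nP) / \eta(P)$
  is a function of $x(P)$ alone.\<close>

definition eta :: "'a::field weierstrass \<Rightarrow> 'a \<Rightarrow> 'a \<Rightarrow> 'a" where
  "eta W x y = 2 * y + wa1 W * x + wa3 W"

text \<open>The classical cubic \<open>4 x^3 + b2 x^2 + 2 b4 x + b6\<close> that completing the
  square in y produces.\<close>

definition eta_poly :: "'a::field weierstrass \<Rightarrow> 'a poly" where
  "eta_poly W = [:wa3 W ^ 2 + 4 * wa6 W, 2 * (2 * wa4 W + wa1 W * wa3 W), wa1 W ^ 2 + 4 * wa2 W, 4:]"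

lemma eta_square:
  "on_curve W (Affine x y) \<Longrightarrow> eta W x y ^ 2 = poly (eta_poly W) x"
  unfolding on_curve.simps eta_def eta_poly_def by simp Groebner_Basis.algebra

text \<open>In the coordinates x and \<open>eta\<close> the slope becomes
  \<open>k = 2 l + wa1 W\<close>, and \<open>l^2 + wa1 W * l - wa2 W\<close> becomes
  \<open>(k^2 - b2) / 4\<close> with \<open>b2 = wa1 W ^ 2 + 4 * wa2 W\<close>.\<close>

lemma ec_add_chord:
  fixes W :: "'a::field_char_0 weierstrass"
  assumes "x1 \<noteq> x2" "k = (eta W x2 y2 - eta W x1 y1) / (x2 - x1)"
    "x3 = k^2 / 4 - (wa1 W ^ 2 + 4 * wa2 W) / 4 - x1 - x2"
  shows "\<exists>y3. ec_add W (Affine x1 y1) (Affine x2 y2) = Affine x3 y3 \<and>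
           eta W x3 y3 = - (eta W x1 y1 + k * (x3 - x1))"
proof -
  define l where "l = (y2 - y1) / (x2 - x1)"
  have "k * (x2 - x1) = eta W x2 y2 - eta W x1 y1" using assms(1,2) by simp
  then have "k * (x2 - x1) = 2 * (y2 - y1) + wa1 W * (x2 - x1)"
    unfolding eta_def by Groebner_Basis.algebra
  moreover have "l * (x2 - x1) = y2 - y1" using assms(1) by (simp add: l_def)
  ultimately have "(x2 - x1) * (k - (2 * l + wa1 W)) = 0" by Groebner_Basis.algebra
  then have k: "k = 2 * l + wa1 W" using assms(1) by simp
  have x3: "x3 = l^2 + wa1 W * l - wa2 W - x1 - x2"
    unfolding assms(3) k by (simp add: field_simps power2_eq_square)
  have "ec_add W (Affine x1 y1) (Affine x2 y2) = Affine x3 (- (y1 + l * (x3 - x1)) - wa1 W * x3 - wa3 W)"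
    using assms(1) by (intro ec_add_slope x3) (auto simp: l_def)
  moreover have "eta W x3 (- (y1 + l * (x3 - x1)) - wa1 W * x3 - wa3 W) =
      - (eta W x1 y1 + k * (x3 - x1))"
    unfolding eta_def k by (simp add: algebra_simps)
  ultimately show ?thesis by blast
qed

text \<open>Differentiating \<open>eta^2 = eta_poly\<close> gives the slope \<open>k\<close>; it
  equals \<open>2 l + wa1 W\<close> as for a chord.\<close>

lemma ec_add_tangent:
  fixes W :: "'a::field_char_0 weierstrass"
  assumes "on_curve W (Affine x1 y1)" "eta W x1 y1 \<noteq> 0"
    "k = poly (pderiv (eta_poly W)) x1 / (2 * eta W x1 y1)"
    "x3 = k^2 / 4 - (wa1 W ^ 2 + 4 * wa2 W) / 4 - x1 - x1"
  shows "\<exists>y3. ec_add W (Affine x1 y1) (Affine x1 y1) = Affine x3 y3 \<and>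
           eta W x3 y3 = - (eta W x1 y1 + k * (x3 - x1))"
proof -
  define l where "l = (3 * x1^2 + 2 * wa2 W * x1 + wa4 W - wa1 W * y1) / (2 * y1 + wa1 W * x1 + wa3 W)"
  have nz: "2 * y1 + wa1 W * x1 + wa3 W \<noteq> 0" using assms(2) by (simp add: eta_def)
  have "k * (2 * eta W x1 y1) = poly (pderiv (eta_poly W)) x1"
    using assms(2,3) by simp
  also have "\<dots> = 12 * x1^2 + 2 * (wa1 W ^ 2 + 4 * wa2 W) * x1 + 2 * (2 * wa4 W + wa1 W * wa3 W)"
    by (simp add: eta_poly_def pderiv_pCons algebra_simps power2_eq_square)
  finally have k1: "k * (2 * (2 * y1 + wa1 W * x1 + wa3 W)) = \<dots>" by (simp only: eta_def)
  have "l * (2 * y1 + wa1 W * x1 + wa3 W) = 3 * x1^2 + 2 * wa2 W * x1 + wa4 W - wa1 W * y1"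
    using nz by (simp add: l_def)
  with k1 have "2 * ((2 * y1 + wa1 W * x1 + wa3 W) * (k - (2 * l + wa1 W))) = 0"
    by Groebner_Basis.algebra
  then have "(2 * y1 + wa1 W * x1 + wa3 W) * (k - (2 * l + wa1 W)) = 0"
    by (metis mult_eq_0_iff zero_neq_numeral)
  then have k: "k = 2 * l + wa1 W" using nz by simp
  have x3: "x3 = l^2 + wa1 W * l - wa2 W - x1 - x1"
    unfolding assms(4) k by (simp add: field_simps power2_eq_square)
  have "ec_add W (Affine x1 y1) (Affine x1 y1) = Affine x3 (- (y1 + l * (x3 - x1)) - wa1 W * x3 - wa3 W)"
    using nz by (intro ec_add_slope x3) (auto simp: l_def algebra_simps)
  moreover have "eta W x3 (- (y1 + l * (x3 - x1)) - wa1 W * x3 - wa3 W) =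
      - (eta W x1 y1 + k * (x3 - x1))"
    unfolding eta_def k by (simp add: algebra_simps)
  ultimately show ?thesis by blast
qed

text \<open>The leading terms $x / n^2$ and $1 / n^3$ are those of the cuspidal curve $\eta^2 = 4 x^3$, whose
  smooth points are the additive group via $\eta / 2 = t^{-3}$, $x = t^{-2}$.\<close>

definition mult_asymp :: "'a::field_char_0 weierstrass \<Rightarrow> nat \<Rightarrow> ('a \<Rightarrow> 'a) \<Rightarrow> ('a \<Rightarrow> 'a) \<Rightarrow> bool" where
  "mult_asymp W n xn U \<longleftrightarrow>
     rat_asymp xn (1 / of_nat n ^ 2) 1 \<and> rat_asymp U (1 / of_nat n ^ 3) 0 \<and>
     (\<forall>\<^sub>\<infinity>x. \<forall>y. on_curve W (Affine x y) \<longrightarrow>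
        (\<exists>y'. Affine x y [^]\<^bsub>ec_group W\<^esub> n = Affine (xn x) y' \<and>
              eta W (xn x) y' = eta W x y * U x))"

lemma mem_carrier_ec_group: "P \<in> carrier (ec_group W) \<longleftrightarrow> on_curve W P"
  by (simp add: ec_group_def)

lemma pow_ec_group_Suc:
  "P [^]\<^bsub>ec_group W\<^esub> Suc n = ec_add W (P [^]\<^bsub>ec_group W\<^esub> n) P"
  by (simp add: nat_pow_def) (simp add: ec_group_def)

lemma pow_ec_group_1: "P [^]\<^bsub>ec_group W\<^esub> (1::nat) = P"
  by (simp add: nat_pow_def) (simp add: ec_group_def)

lemma mult_asymp_1: "mult_asymp W 1 (\<lambda>x. x) (\<lambda>x. 1)"
  unfolding mult_asymp_def pow_ec_group_1
  using rat_asymp_id rat_asymp_const[of 1] by simp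

lemma rat_asymp_eta_poly: "rat_asymp (poly (eta_poly W)) 4 3"
  by (rule rat_asymp_polyI[OF refl]) (auto simp: eta_poly_def numeral_3_eq_3)

lemma rat_asymp_pderiv_eta_poly: "rat_asymp (poly (pderiv (eta_poly W))) 12 2"
  by (rule rat_asymp_polyI[OF refl]) (auto simp: eta_poly_def pderiv_pCons numeral_2_eq_2)

lemma mult_asymp_2:
  fixes W :: "'a::field_char_0 weierstrass"
  shows "\<exists>xn U. mult_asymp W 2 xn U"
proof -
  let ?D = "poly (eta_poly W)" and ?D' = "poly (pderiv (eta_poly W))"
  define b where "b = (wa1 W ^ 2 + 4 * wa2 W) / 4"
  \<comment> \<open>With \<open>k = D' / (2 eta)\<close> and \<open>eta^2 = D\<close> one has
    \<open>k^2 / 4 = D'^2 / (16 D)\<close> and \<open>k / eta = D' / (2 D)\<close>, so the tangent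
    formula becomes a function of x. The leading terms are 144/64 - 2 = 1/4 and -1 + 9/8 =
    1/8.\<close>
  define xn where "xn = (\<lambda>x. ?D' x * ?D' x / (16 * ?D x) - b - x - x)"
  define U where "U = (\<lambda>x. - 1 - ?D' x * (xn x - x) / (2 * ?D x))"
  have "rat_asymp (\<lambda>x. 16 * ?D x) (16 * 4) (0 + 3)"
    by (intro rat_asymp_mult rat_asymp_const rat_asymp_eta_poly)
  then have q: "rat_asymp (\<lambda>x. 16 * ?D x) 64 3" by simp
  have "rat_asymp (\<lambda>x. ?D' x * ?D' x) (12 * 12) (2 + 2)"
    by (intro rat_asymp_mult rat_asymp_pderiv_eta_poly)
  then have "rat_asymp (\<lambda>x. ?D' x * ?D' x) 144 (1 + 3)" by simp
  then have "rat_asymp (\<lambda>x. ?D' x * ?D' x / (16 * ?D x)) (144 / 64) 1"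
    using q by (rule rat_asymp_divide) simp
  then have "rat_asymp xn (144 / 64 - 0 - 1 - 1) 1" unfolding xn_def
    by (intro rat_asymp_diff rat_asymp_id rat_asymp_const_1)
  then have xn: "rat_asymp xn (1 / 4) 1" by simp
  have "rat_asymp (\<lambda>x. ?D' x * (xn x - x)) (12 * (1 / 4 - 1)) (2 + 1)"
    by (intro rat_asymp_mult rat_asymp_diff xn rat_asymp_id rat_asymp_pderiv_eta_poly)
  then have n: "rat_asymp (\<lambda>x. ?D' x * (xn x - x)) (-9) (0 + 3)" by simp
  have "rat_asymp (\<lambda>x. 2 * ?D x) (2 * 4) (0 + 3)"
    by (intro rat_asymp_mult rat_asymp_const rat_asymp_eta_poly)
  then have "rat_asymp (\<lambda>x. 2 * ?D x) 8 3" by simp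
  with n have "rat_asymp (\<lambda>x. ?D' x * (xn x - x) / (2 * ?D x)) (-9 / 8) 0"
    by (rule rat_asymp_divide) simp
  then have "rat_asymp U (- 1 - - 9 / 8) 0" unfolding U_def
    by (intro rat_asymp_diff rat_asymp_const)
  then have U: "rat_asymp U (1 / 8) 0" by simp
  have "\<forall>\<^sub>\<infinity>x. ?D x \<noteq> 0" by (rule rat_asymp_nonzero[OF rat_asymp_eta_poly]) simp
  then have "\<forall>\<^sub>\<infinity>x. \<forall>y. on_curve W (Affine x y) \<longrightarrow>
        (\<exists>y'. Affine x y [^]\<^bsub>ec_group W\<^esub> (2::nat) = Affine (xn x) y' \<and>
              eta W (xn x) y' = eta W x y * U x)"
  proof eventually_elim
    case (elim x)
    show ?case
    proof (intro allI impI)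
      fix y assume P: "on_curve W (Affine x y)"
      note sq = eta_square[OF P]
      have nz: "eta W x y \<noteq> 0" using sq elim by auto
      define k where "k = ?D' x / (2 * eta W x y)"
      have "xn x = k^2 / 4 - (wa1 W ^ 2 + 4 * wa2 W) / 4 - x - x"
        unfolding xn_def b_def k_def sq[symmetric] by (simp add: power2_eq_square)
      from ec_add_tangent[OF P nz k_def this] obtain y' where
        y': "ec_add W (Affine x y) (Affine x y) = Affine (xn x) y'"
        "eta W (xn x) y' = - (eta W x y + k * (xn x - x))" by blast
      have "k * (xn x - x) = eta W x y * (?D' x * (xn x - x) / (2 * ?D x))"
        unfolding k_def sq[symmetric] using nz by (simp add: power2_eq_square)
      then have "eta W (xn x) y' = eta W x y * U x"
        unfolding y' U_def by (simp add: algebra_simps)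
      moreover have "Affine x y [^]\<^bsub>ec_group W\<^esub> (2::nat) = Affine (xn x) y'"
        using y'(1) pow_ec_group_Suc[where P = "Affine x y" and n = 1, unfolded pow_ec_group_1]
        by (simp add: numeral_2_eq_2)
      ultimately show "\<exists>y'. Affine x y [^]\<^bsub>ec_group W\<^esub> (2::nat) = Affine (xn x) y' \<and>
              eta W (xn x) y' = eta W x y * U x" by blast
    qed
  qed
  with xn U show ?thesis unfolding mult_asymp_def by (intro exI[of _ xn] exI[of _ U]) simp
qed

text \<open>The abscissae of nP and P have leading coefficients \<open>1 / n^2\<close> and 1. For
  \<open>n \<ge> 2\<close> these differ, so off a finite set nP + P is given by the chord formula;
  passing from 1 to 2 needs the tangent and is treated separately.\<close>

lemma mult_asymp_Suc:
  fixes W :: "'a::field_char_0 weierstrass"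
  assumes "mult_asymp W n xn U" "n \<ge> 2"
  shows "\<exists>xn U. mult_asymp W (Suc n) xn U"
proof -
  let ?D = "poly (eta_poly W)"
  define b where "b = (wa1 W ^ 2 + 4 * wa2 W) / 4"
  define N :: 'a where "N = of_nat n"
  have N: "N \<noteq> 0" "N + 1 \<noteq> 0" "N - 1 \<noteq> 0"
  proof -
    show "N \<noteq> 0" using assms(2) by (simp add: N_def)
    have "N + 1 = of_nat (n + 1)" by (simp add: N_def)
    then show "N + 1 \<noteq> 0" by (metis of_nat_eq_0_iff add_is_0 one_neq_zero)
    have "N - 1 = of_nat (n - 1)" using assms(2) by (simp add: N_def of_nat_diff)
    then show "N - 1 \<noteq> 0" using assms(2) by simp
  qed
  have xn: "rat_asymp xn (1 / N^2) 1" and U: "rat_asymp U (1 / N^3) 0"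
    and mult: "\<forall>\<^sub>\<infinity>x. \<forall>y. on_curve W (Affine x y) \<longrightarrow>
        (\<exists>y'. Affine x y [^]\<^bsub>ec_group W\<^esub> n = Affine (xn x) y' \<and>
              eta W (xn x) y' = eta W x y * U x)"
    using assms(1) unfolding mult_asymp_def N_def by auto
  \<comment> \<open>These come from the chord through nP and P, whose slope is
    \<open>k = eta * (1 - U) / (x - xn)\<close>, with \<open>eta^2\<close> replaced by
    \<open>D\<close>.\<close>
  define xn' where "xn' = (\<lambda>x. ?D x * ((1 - U x) * (1 - U x)) / (4 * ((x - xn x) * (x - xn x))) - b - xn x - x)"
  define U' where "U' = (\<lambda>x. (1 - U x) * (x - xn' x) / (x - xn x) - 1)"
  define u where "u = 1 - 1 / N^3"
  define v where "v = 1 - 1 / N^2"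
  have "v = (N - 1) * (N + 1) / N^2" using N by (simp add: v_def field_simps power2_eq_square)
  then have v: "v \<noteq> 0" using N by simp
  have uv: "u / v = (N^2 + N + 1) / (N * (N + 1))"
  proof -
    have "u * (N * (N + 1)) = (N^2 + N + 1) * v" unfolding u_def v_def
      using N by (simp add: field_simps power2_eq_square power3_eq_cube)
    then show ?thesis using N v by (simp add: frac_eq_eq)
  qed
  have dx: "rat_asymp (\<lambda>x. x - xn x) v 1" unfolding v_def
    by (intro rat_asymp_diff xn rat_asymp_id)
  have du: "rat_asymp (\<lambda>x. 1 - U x) u 0" unfolding u_def
    by (intro rat_asymp_diff U rat_asymp_const)
  have "rat_asymp (\<lambda>x. 4 * ((x - xn x) * (x - xn x))) (4 * (v * v)) (0 + (1 + 1))"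
    by (intro rat_asymp_mult dx rat_asymp_const)
  then have q: "rat_asymp (\<lambda>x. 4 * ((x - xn x) * (x - xn x))) (4 * (v * v)) 2"
    by (simp add: numeral_2_eq_2)
  have "rat_asymp (\<lambda>x. ?D x * ((1 - U x) * (1 - U x))) (4 * (u * u)) (3 + (0 + 0))"
    by (intro rat_asymp_mult du rat_asymp_eta_poly)
  then have "rat_asymp (\<lambda>x. ?D x * ((1 - U x) * (1 - U x))) (4 * (u * u)) (1 + 2)"
    by (simp add: numeral_3_eq_3)
  then have "rat_asymp (\<lambda>x. ?D x * ((1 - U x) * (1 - U x)) / (4 * ((x - xn x) * (x - xn x))))
       (4 * (u * u) / (4 * (v * v))) 1"
    using q by (rule rat_asymp_divide) (simp add: v)
  then have "rat_asymp xn' (4 * (u * u) / (4 * (v * v)) - 0 - 1 / N^2 - 1) 1" unfolding xn'_def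
    by (intro rat_asymp_diff rat_asymp_id rat_asymp_const_1 xn)
  moreover have "4 * (u * u) / (4 * (v * v)) - 0 - 1 / N^2 - 1 = (u / v)^2 - 1 / N^2 - 1"
    by (simp add: power2_eq_square)
  \<comment> \<open>As \<open>u / v = 1 + 1 / N - 1 / (N + 1)\<close>, the mixed terms of its square
    cancel and leave \<open>1 + 1 / N^2 + 1 / (N + 1)^2\<close>.\<close>
  moreover have "\<dots> = 1 / (N + 1)^2" unfolding uv using N
    by (simp add: divide_simps) Groebner_Basis.algebra
  ultimately have xn': "rat_asymp xn' (1 / (N + 1)^2) 1" by simp
  have "rat_asymp (\<lambda>x. (1 - U x) * (x - xn' x)) (u * (1 - 1 / (N + 1)^2)) (0 + 1)"
    by (intro rat_asymp_mult rat_asymp_diff du rat_asymp_id xn')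
  then have "rat_asymp (\<lambda>x. (1 - U x) * (x - xn' x) / (x - xn x)) (u * (1 - 1 / (N + 1)^2) / v) 0"
    using dx v by (rule rat_asymp_divide)
  then have "rat_asymp U' (u * (1 - 1 / (N + 1)^2) / v - 1) 0"
    unfolding U'_def by (intro rat_asymp_diff rat_asymp_const)
  moreover have "u * (1 - 1 / (N + 1)^2) / v - 1 = u / v * (1 - 1 / (N + 1)^2) - 1" by simp
  moreover have "u / v * (1 - 1 / (N + 1)^2) - 1 = 1 / (N + 1)^3"
  proof -
    have "1 - 1 / (N + 1)^2 = ((N + 1)^2 - 1) / (N + 1)^2"
      using N by (simp add: diff_divide_distrib)
    also have "(N + 1)^2 - 1 = N * (N + 2)"
      by (simp add: algebra_simps power2_eq_square)
    finally have "1 - 1 / (N + 1)^2 = N * (N + 2) / (N + 1)^2" .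
    then have "u / v * (1 - 1 / (N + 1)^2) = (N^2 + N + 1) * (N + 2) / (N + 1)^3"
      unfolding uv using N by (simp add: power2_eq_square power3_eq_cube)
    also have "(N^2 + N + 1) * (N + 2) = (N + 1)^3 + 1"
      by (simp add: algebra_simps power2_eq_square power3_eq_cube)
    also have "((N + 1)^3 + 1) / (N + 1)^3 = 1 + 1 / (N + 1)^3"
      using N by (simp add: add_divide_distrib)
    finally show ?thesis by simp
  qed
  ultimately have U': "rat_asymp U' (1 / (N + 1)^3) 0" by (simp only:)
  have "\<forall>\<^sub>\<infinity>x. x - xn x \<noteq> 0" using dx v by (rule rat_asymp_nonzero)
  with mult have "\<forall>\<^sub>\<infinity>x. \<forall>y. on_curve W (Affine x y) \<longrightarrow>
        (\<exists>y'. Affine x y [^]\<^bsub>ec_group W\<^esub> Suc n = Affine (xn' x) y' \<and>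
              eta W (xn' x) y' = eta W x y * U' x)"
  proof eventually_elim
    case (elim x)
    show ?case
    proof (intro allI impI)
      fix y assume P: "on_curve W (Affine x y)"
      note sq = eta_square[OF P]
      obtain y1 where y1: "Affine x y [^]\<^bsub>ec_group W\<^esub> n = Affine (xn x) y1"
        "eta W (xn x) y1 = eta W x y * U x" using elim(1) P by blast
      define k where "k = (eta W x y - eta W (xn x) y1) / (x - xn x)"
      have k: "k = eta W x y * ((1 - U x) / (x - xn x))"
        unfolding k_def y1 by (simp add: algebra_simps)
      have "xn' x = k^2 / 4 - (wa1 W ^ 2 + 4 * wa2 W) / 4 - xn x - x"
        unfolding xn'_def b_def k sq[symmetric] by (simp add: power2_eq_square ac_simps)
      with elim(2) obtain y' where
        y': "ec_add W (Affine (xn x) y1) (Affine x y) = Affine (xn' x) y'"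
        "eta W (xn' x) y' = - (eta W (xn x) y1 + k * (xn' x - xn x))"
        using ec_add_chord[of "xn x" x k W y y1 "xn' x"] k_def by auto
      have "eta W (xn x) y1 = eta W x y - k * (x - xn x)" using elim(2) by (simp add: k_def)
      then have "eta W (xn' x) y' = k * (x - xn' x) - eta W x y"
        unfolding y' by (simp add: algebra_simps)
      also have "\<dots> = eta W x y * U' x"
        unfolding k U'_def by (simp add: algebra_simps)
      finally show "\<exists>y'. Affine x y [^]\<^bsub>ec_group W\<^esub> Suc n = Affine (xn' x) y' \<and>
              eta W (xn' x) y' = eta W x y * U' x"
        using y'(1) y1(1) pow_ec_group_Suc[where P = "Affine x y" and W = W and n = n, unfolded y1(1)] by (simp only:) blast
    qed
  qed
  with xn' U' show ?thesis unfolding mult_asymp_def N_def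
    by (intro exI[of _ xn'] exI[of _ U']) (simp add: add.commute)
qed

lemma ex_mult_asymp:
  fixes W :: "'a::field_char_0 weierstrass"
  shows "n \<ge> 1 \<Longrightarrow> \<exists>xn U. mult_asymp W n xn U"
proof (induction n rule: dec_induct)
  case base
  then show ?case using mult_asymp_1 by blast
next
  case (step n)
  then show ?case using mult_asymp_2[of W] mult_asymp_Suc[of W n]
    by (cases "n = 1") (auto simp: numeral_2_eq_2)
qed

section \<open>From leading terms to surjectivity of multiplication\<close>

lemma finite_on_curve_fibre:
  fixes W :: "'a::field weierstrass"
  shows "finite {y. on_curve W (Affine x y)}"
proof -
  let ?p = "[:- (x^3 + wa2 W * x^2 + wa4 W * x + wa6 W), wa1 W * x + wa3 W, 1:]"
  have "{y. on_curve W (Affine x y)} \<subseteq> {y. poly ?p y = 0}"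
    by (auto simp: algebra_simps power2_eq_square)
  then show ?thesis using poly_roots_finite[of ?p] by (auto intro: finite_subset)
qed

lemma ex_on_curve:
  fixes W :: "'a::alg_closed_field weierstrass"
  shows "\<exists>y. on_curve W (Affine x y)"
proof -
  let ?p = "[:- (x^3 + wa2 W * x^2 + wa4 W * x + wa6 W), wa1 W * x + wa3 W, 1:]"
  obtain y where "poly ?p y = 0" using alg_closed_imp_poly_has_root[of ?p] by auto
  then show ?thesis by (intro exI[of _ y]) (simp add: algebra_simps power2_eq_square)
qed

text \<open>A coset of \<open>H\<close> other than \<open>H\<close> lies in the finite complement,
  so \<open>H\<close> is finite and with it the whole group.\<close>

lemma (in group) subgroup_cofinite_eq_carrier:
  assumes "subgroup H G" "finite (carrier G - H)" "infinite (carrier G)"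
  shows "H = carrier G"
proof (rule ccontr)
  assume "H \<noteq> carrier G"
  then obtain g where g: "g \<in> carrier G" "g \<notin> H" using subgroup.subset[OF assms(1)] by blast
  have HG: "H \<subseteq> carrier G" using subgroup.subset[OF assms(1)] .
  have "(\<lambda>h. g \<otimes> h) ` H \<subseteq> carrier G - H"
  proof clarify
    fix h assume h: "h \<in> H"
    have "g \<otimes> h \<notin> H"
    proof
      assume "g \<otimes> h \<in> H"
      then have "g \<otimes> h \<otimes> inv h \<in> H" using h assms(1) by (meson subgroup_def)
      then show False using g h HG by (simp add: m_assoc subsetD)
    qed
    then show "g \<otimes> h \<in> carrier G - H" using g h HG by blast
  qed
  moreover have "inj_on (\<lambda>h. g \<otimes> h) H" using g HG by (intro inj_onI) (metis l_cancel subsetD)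
  ultimately have "finite H" using assms(2) by (metis finite_imageD finite_subset)
  then have "finite (carrier G)" using assms(2) HG by (metis finite_Diff2)
  then show False using assms(3) by simp
qed

theorem ec_group_divisible:
  fixes W :: "'a::{alg_closed_field, field_char_0} weierstrass" and m :: nat
  assumes "elliptic_curve W" "m \<ge> 1" "Q \<in> carrier (ec_group W)"
  shows "\<exists>P\<in>carrier (ec_group W). P [^]\<^bsub>ec_group W\<^esub> m = Q"
proof -
  let ?G = "ec_group W"
  interpret comm_group ?G using ec_group_comm_group[OF assms(1)] .
  let ?H = "(\<lambda>P. P [^]\<^bsub>?G\<^esub> m) ` carrier ?G"
  have hom: "group_hom ?G ?G (\<lambda>P. P [^]\<^bsub>?G\<^esub> m)"
    by (unfold_locales) (auto simp: hom_def nat_pow_distrib)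
  have sub: "subgroup ?H ?G" using group_hom.img_is_subgroup[OF hom] .
  obtain xn U where XU: "mult_asymp W m xn U" using ex_mult_asymp assms(2) by blast
  let ?good = "\<lambda>x. \<forall>y. on_curve W (Affine x y) \<longrightarrow>
        (\<exists>y'. Affine x y [^]\<^bsub>ec_group W\<^esub> m = Affine (xn x) y' \<and>
              eta W (xn x) y' = eta W x y * U x)"
  have "rat_asymp xn (1 / of_nat m ^ 2) 1" "1 / of_nat m ^ 2 \<noteq> (0::'a)" "\<forall>\<^sub>\<infinity>x. ?good x"
    using XU assms(2) unfolding mult_asymp_def by auto
  then have fin: "finite {t. \<not> (\<exists>x. ?good x \<and> xn x = t)}" (is "finite ?B")
    using rat_asymp_surj by (simp only: MOST_iff_finiteNeg)
  have in_H: "Affine t y \<in> ?H" if t: "t \<notin> ?B" and y: "on_curve W (Affine t y)" for t y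
  proof -
    obtain x where x: "?good x" "xn x = t" using t by blast
    obtain z where z: "on_curve W (Affine x z)" using ex_on_curve by blast
    then obtain y' where y': "Affine x z [^]\<^bsub>?G\<^esub> m = Affine t y'" using x by blast
    have P: "Affine x z \<in> carrier ?G" using z by (simp add: ec_group_def)
    then have 1: "Affine t y' \<in> ?H" using y' by (metis image_eqI)
    then have "Affine t y' \<in> carrier ?G" using subgroup.subset[OF sub] by (rule subsetD[rotated])
    then have c: "on_curve W (Affine t y')" by (simp only: mem_carrier_ec_group)
    \<comment> \<open>Only the abscissa of the multiple is controlled; the other point above
      \<open>t\<close> is its inverse, which also lies in the subgroup \<open>?H\<close>.\<close>
    have "Affine t y = Affine t y' \<or> Affine t y = ec_neg W (Affine t y')"
      using on_curve_same_x[OF c y] by auto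
    moreover have "ec_neg W (Affine t y') = inv\<^bsub>?G\<^esub> (Affine t y')"
    proof (rule inv_equality[symmetric])
      show "ec_neg W (Affine t y') \<otimes>\<^bsub>?G\<^esub> Affine t y' = \<one>\<^bsub>?G\<^esub>"
        using ec_add_eq_Infinity_iff[of W "ec_neg W (Affine t y')" "Affine t y'"] c
        unfolding on_curve_neg ec_neg_neg by (simp add: ec_group_def)
    qed (use c in \<open>simp_all only: mem_carrier_ec_group on_curve_neg\<close>)
    ultimately show ?thesis using 1 subgroup.m_inv_closed[OF sub 1] by auto
  qed
  have "carrier ?G - ?H \<subseteq> (\<Union>t\<in>?B. Affine t ` {y. on_curve W (Affine t y)})"
  proof
    fix P assume P: "P \<in> carrier ?G - ?H"
    show "P \<in> (\<Union>t\<in>?B. Affine t ` {y. on_curve W (Affine t y)})"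
    proof (cases P)
      case Infinity
      then have "P = \<one>\<^bsub>?G\<^esub>" by (simp add: ec_group_def)
      then show ?thesis using P subgroup.one_closed[OF sub] by auto
    next
      case (Affine t y)
      then have "on_curve W (Affine t y)" using P by (simp add: ec_group_def)
      then show ?thesis using in_H[of t y] P Affine by blast
    qed
  qed
  moreover have "finite (\<Union>t\<in>?B. Affine t ` {y. on_curve W (Affine t y)})"
    using fin finite_on_curve_fibre by (intro finite_UN_I finite_imageI)
  ultimately have "finite (carrier ?G - ?H)" by (rule finite_subset)
  moreover have "infinite (carrier ?G)"
  proof
    assume "finite (carrier ?G)"
    \<comment> \<open>The abscissae of points fill the whole field, which is infinite in
      characteristic 0; the value 0 at \<open>Infinity\<close> is arbitrary.\<close>
    then have "finite ((\<lambda>P. case P of Affine x y \<Rightarrow> x | Infinity \<Rightarrow> 0) ` carrier ?G)" by simp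
    moreover have "(UNIV :: 'a set) \<subseteq> (\<lambda>P. case P of Affine x y \<Rightarrow> x | Infinity \<Rightarrow> 0) ` carrier ?G"
    proof
      fix x :: 'a
      obtain y where "on_curve W (Affine x y)" using ex_on_curve by blast
      then have "Affine x y \<in> carrier ?G" by (simp add: ec_group_def)
      then show "x \<in> (\<lambda>P. case P of Affine x y \<Rightarrow> x | Infinity \<Rightarrow> 0) ` carrier ?G"
        by (rule rev_image_eqI) simp
    qed
    ultimately show False using infinite_UNIV_char_0 finite_subset by blast
  qed
  ultimately have "?H = carrier ?G" using subgroup_cofinite_eq_carrier[OF sub] by blast
  then show ?thesis using assms(3) by (metis imageE)
qed


section \<open>The fixed field of the absolute Galois group\<close>

text \<open>The graph of an isomorphism over \<open>K\<close> between two intermediate fields. Closure under \<open>inverse\<close>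
  makes the projection to the first factor a field, and then the last clause also gives injectivity.\<close>

definition partial_automorphism :: "('k::field alg_closure \<times> 'k alg_closure) set \<Rightarrow> bool" where
  "partial_automorphism R \<longleftrightarrow>
     (\<forall>a. (to_ac a, to_ac a) \<in> R) \<and>
     (\<forall>u v u' v'. (u, v) \<in> R \<longrightarrow> (u', v') \<in> R \<longrightarrow> (u + u', v + v') \<in> R \<and> (u * u', v * v') \<in> R) \<and>
     (\<forall>u v. (u, v) \<in> R \<longrightarrow> (inverse u, inverse v) \<in> R) \<and>
     (\<forall>v. (0, v) \<in> R \<longrightarrow> v = 0)"

text \<open>When \<open>R\<close> is the graph of an isomorphism, \<open>q\<close> is the conjugate
  of \<open>p\<close> under it. The relational form avoids choosing values outside the intermediate
  field.\<close>

definition coeffs_related :: "('a::zero \<times> 'a) set \<Rightarrow> 'a poly \<Rightarrow> 'a poly \<Rightarrow> bool" where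
  "coeffs_related R p q \<longleftrightarrow> (\<forall>i. (poly.coeff p i, poly.coeff q i) \<in> R)"

context
  fixes R :: "('k::field alg_closure \<times> 'k alg_closure) set"
  assumes R: "partial_automorphism R"
begin

lemma related_to_ac: "(to_ac a, to_ac a) \<in> R"
  using R unfolding partial_automorphism_def by blast

lemma related_0: "(0, 0) \<in> R" and related_1: "(1, 1) \<in> R"
  using related_to_ac[of 0] related_to_ac[of 1] by simp_all

lemma related_add: "(u, v) \<in> R \<Longrightarrow> (u', v') \<in> R \<Longrightarrow> (u + u', v + v') \<in> R"
  and related_mult: "(u, v) \<in> R \<Longrightarrow> (u', v') \<in> R \<Longrightarrow> (u * u', v * v') \<in> R"
  using R unfolding partial_automorphism_def by blast+

lemma related_inverse: "(u, v) \<in> R \<Longrightarrow> (inverse u, inverse v) \<in> R"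
  using R unfolding partial_automorphism_def by blast

lemma related_diff: "(u, v) \<in> R \<Longrightarrow> (u', v') \<in> R \<Longrightarrow> (u - u', v - v') \<in> R"
  using related_add[of u v "to_ac (-1) * u'" "to_ac (-1) * v'"]
    related_mult[OF related_to_ac[of "-1"], of u' v'] by simp

lemma related_divide: "(u, v) \<in> R \<Longrightarrow> (u', v') \<in> R \<Longrightarrow> (u / u', v / v') \<in> R"
  using related_mult related_inverse by (simp add: field_class.field_divide_inverse)

lemma related_zeroD: "(0, v) \<in> R \<Longrightarrow> v = 0"
  using R unfolding partial_automorphism_def by blast

lemma related_unique: "(u, v) \<in> R \<Longrightarrow> (u, v') \<in> R \<Longrightarrow> v = v'"
  using related_diff[of u v u v'] related_zeroD[of "v - v'"] by simp

lemma related_zeroD': "(u, 0) \<in> R \<Longrightarrow> u = 0"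
proof (rule ccontr)
  assume u: "(u, 0) \<in> R" "u \<noteq> 0"
  then have "(u * inverse u, 0 * inverse 0) \<in> R" by (intro related_mult related_inverse)
  then have "(1, 0) \<in> R" using u by simp
  then show False using related_unique related_1 by fastforce
qed

lemma related_sum: "(\<And>i. i \<in> A \<Longrightarrow> (f i, g i) \<in> R) \<Longrightarrow> (sum f A, sum g A) \<in> R"
  by (induction A rule: infinite_finite_induct) (auto intro: related_0 related_add)

lemma coeffs_related_const: "(u, v) \<in> R \<Longrightarrow> coeffs_related R [:u:] [:v:]"
  unfolding coeffs_related_def by (auto simp: coeff_pCons related_0 split: nat.splits)

lemma coeffs_related_monom: "(u, v) \<in> R \<Longrightarrow> coeffs_related R (Polynomial.monom u n) (Polynomial.monom v n)"
  unfolding coeffs_related_def by (auto simp: related_0)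

lemma coeffs_related_add:
  "coeffs_related R p q \<Longrightarrow> coeffs_related R p' q' \<Longrightarrow> coeffs_related R (p + p') (q + q')"
  unfolding coeffs_related_def by (auto intro: related_add)

lemma coeffs_related_diff:
  "coeffs_related R p q \<Longrightarrow> coeffs_related R p' q' \<Longrightarrow> coeffs_related R (p - p') (q - q')"
  unfolding coeffs_related_def by (auto intro: related_diff)

lemma coeffs_related_mult:
  "coeffs_related R p q \<Longrightarrow> coeffs_related R p' q' \<Longrightarrow> coeffs_related R (p * p') (q * q')"
  unfolding coeffs_related_def coeff_mult by (auto intro!: related_sum related_mult)

lemma coeffs_related_0: "coeffs_related R 0 q \<Longrightarrow> q = 0"
  unfolding coeffs_related_def by (auto intro!: poly_eqI related_zeroD)

lemma coeffs_related_map_poly: "coeffs_related R (map_poly to_ac f) (map_poly to_ac f)"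
  unfolding coeffs_related_def by (simp add: coeff_map_poly related_to_ac)

lemma coeffs_related_degree: "coeffs_related R p q \<Longrightarrow> Polynomial.degree q = Polynomial.degree p"
proof (rule antisym)
  assume *: "coeffs_related R p q"
  show "Polynomial.degree q \<le> Polynomial.degree p"
    by (rule degree_le) (use * in \<open>metis coeffs_related_def coeff_eq_0 related_zeroD\<close>)
  show "Polynomial.degree p \<le> Polynomial.degree q"
    by (rule degree_le) (use * in \<open>metis coeffs_related_def coeff_eq_0 related_zeroD'\<close>)
qed

end

section \<open>Extension of partial automorphisms to the algebraic closure\<close>

lemma poly_map_poly_to_ac_pCons:
  "poly (map_poly to_ac (pCons c h)) u = to_ac c + u * poly (map_poly to_ac h) u"
  by (simp add: map_poly_pCons)

text \<open>Dividing an annihilating polynomial by the powers of the variable it contains leaves a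
  nonzero constant term \<open>c\<close>. Then \<open>- h(x) / c\<close> is the inverse of
  \<open>x\<close>, a polynomial expression in \<open>x\<close> over K.\<close>

lemma alg_closure_algebraic_nonzero:
  fixes x :: "'k::field alg_closure"
  assumes "x \<noteq> 0"
  obtains c h where "c \<noteq> 0" "to_ac c + x * poly (map_poly to_ac h) x = 0"
proof -
  have "\<exists>c h. c \<noteq> 0 \<and> to_ac c + x * poly (map_poly to_ac h) x = 0"
    if "p \<noteq> 0" "poly (map_poly to_ac p) x = 0" for p :: "'k poly"
    using that
  proof (induction p)
    case (pCons c h)
    show ?case
    proof (cases "c = 0")
      case True
      then show ?thesis using pCons assms by (auto simp: poly_map_poly_to_ac_pCons)
    next
      case False
      then show ?thesis using pCons.prems by (auto simp: poly_map_poly_to_ac_pCons)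
    qed
  qed simp
  then show ?thesis using that alg_closure_algebraic[of x] by metis
qed

text \<open>The new graph consists of the pairs \<open>(p(z), q(w))\<close>, and \<open>zw\<close>
  is what makes it single valued. Closure under inverses comes from algebraicity: the polynomial
  over K that inverts \<open>u\<close> also inverts \<open>v\<close>, since the graph respects
  evaluation of polynomials over K.\<close>

lemma partial_automorphism_adjoin:
  fixes R :: "('k::field alg_closure \<times> 'k alg_closure) set"
  assumes R: "partial_automorphism R"
    and zw: "\<And>p q. coeffs_related R p q \<Longrightarrow> poly p z = 0 \<Longrightarrow> poly q w = 0"
  shows "\<exists>R'. partial_automorphism R' \<and> R \<subseteq> R' \<and> (z, w) \<in> R'"
proof -
  define R' where "R' = {(poly p z, poly q w) | p q. coeffs_related R p q}"
  have I: "coeffs_related R p q \<Longrightarrow> (poly p z, poly q w) \<in> R'" for p q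
    unfolding R'_def by blast
  have sub: "R \<subseteq> R'"
  proof clarify
    fix u v assume "(u, v) \<in> R"
    from I[OF coeffs_related_const[OF R this]] show "(u, v) \<in> R'" by simp
  qed
  have "coeffs_related R [:0, 1:] [:0, 1:]"
    unfolding coeffs_related_def
    by (auto simp: coeff_pCons related_0[OF R] related_1[OF R] split: nat.splits)
  from I[OF this] have zw': "(z, w) \<in> R'" by simp
  have add: "(u + u', v + v') \<in> R'" and mult: "(u * u', v * v') \<in> R'"
    if "(u, v) \<in> R'" "(u', v') \<in> R'" for u v u' v'
    using that I[OF coeffs_related_add[OF R]] I[OF coeffs_related_mult[OF R]]
    unfolding R'_def by (fastforce simp: R'_def)+
  have ac: "(to_ac a, to_ac a) \<in> R'" for a using sub related_to_ac[OF R] by blast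
  have zero: "v = 0" if "(0, v) \<in> R'" for v
    using that zw unfolding R'_def by auto
  have poly: "(poly (map_poly to_ac h) u, poly (map_poly to_ac h) v) \<in> R'" if "(u, v) \<in> R'" for u v h
    using that
  proof (induction h)
    case 0
    then show ?case using ac[of 0] by simp
  next
    case (pCons c h)
    then show ?case using ac add mult by (simp add: poly_map_poly_to_ac_pCons)
  qed
  have inv: "(inverse u, inverse v) \<in> R'" if uv: "(u, v) \<in> R'" for u v
  proof (cases "u = 0")
    case True
    then show ?thesis using zero[of v] uv ac[of 0] by auto
  next
    case False
    then obtain c h where c: "c \<noteq> 0" and u: "to_ac c + u * poly (map_poly to_ac h) u = 0"
      using alg_closure_algebraic_nonzero by blast
    have "(to_ac c + u * poly (map_poly to_ac h) u, to_ac c + v * poly (map_poly to_ac h) v) \<in> R'"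
      using uv ac add mult poly by blast
    then have v: "to_ac c + v * poly (map_poly to_ac h) v = 0" using zero u by simp
    have inverse: "inverse x = to_ac (- inverse c) * poly (map_poly to_ac h) x"
      if "to_ac c + x * poly (map_poly to_ac h) x = 0" for x
    proof -
      have "x * (to_ac (- inverse c) * poly (map_poly to_ac h) x) = - (x * poly (map_poly to_ac h) x) / to_ac c"
        by (simp add: field_class.field_divide_inverse)
      also have "- (x * poly (map_poly to_ac h) x) = to_ac c" using that by (metis neg_eq_iff_add_eq_0 add.commute minus_minus)
      finally have "x * (to_ac (- inverse c) * poly (map_poly to_ac h) x) = 1" using c by simp
      then show ?thesis by (rule inverse_unique)
    qed
    show ?thesis unfolding inverse[OF u] inverse[OF v] using ac mult poly uv by blast
  qed
  have "partial_automorphism R'"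
    unfolding partial_automorphism_def using ac add mult inv zero by blast
  then show ?thesis using sub zw' by blast
qed

text \<open>Up to a scalar, \<open>p\<close> is the minimal polynomial of \<open>z\<close> over the
  first projection of \<open>R\<close>. Division by \<open>p\<close>, carried out in parallel on
  \<open>s\<close> and its conjugate \<open>t\<close>, shows that \<open>t\<close> vanishes at every
  root \<open>w\<close> of \<open>q\<close> whenever \<open>s\<close> vanishes at
  \<open>z\<close>.\<close>

lemma partial_automorphism_extend_root:
  fixes R :: "('k::field alg_closure \<times> 'k alg_closure) set"
  assumes R: "partial_automorphism R"
    and pq: "coeffs_related R p q" "p \<noteq> 0"
    and min: "\<And>s t. coeffs_related R s t \<Longrightarrow> s \<noteq> 0 \<Longrightarrow> poly s z = 0 \<Longrightarrow> Polynomial.degree p \<le> Polynomial.degree s"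
    and root: "poly p z = 0" "poly q w = 0"
  shows "\<exists>R'. partial_automorphism R' \<and> R \<subseteq> R' \<and> (z, w) \<in> R'"
proof (rule partial_automorphism_adjoin[OF R])
  fix s t assume "coeffs_related R s t" "poly s z = 0"
  then show "poly t w = 0"
  proof (induction "Polynomial.degree s" arbitrary: s t rule: less_induct)
    case less
    show ?case
    proof (cases "s = 0")
      case True
      then show ?thesis using coeffs_related_0[OF R, of t] less.prems by auto
    next
      case False
      then have le: "Polynomial.degree p \<le> Polynomial.degree s" using min less.prems by blast
      have pos: "Polynomial.degree p > 0"
      proof (rule ccontr)
        assume "\<not> ?thesis"
        then obtain a where "p = [:a:]" by (metis degree_eq_zeroE gr0I)
        then show False using root pq by auto
      qed
      define k where "k = Polynomial.degree s - Polynomial.degree p"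
      \<comment> \<open>Both quotients use the degrees of \<open>s\<close> and \<open>p\<close>, so
        that coefficients of equal index are paired and \<open>(c, d)\<close> lies in
        \<open>R\<close>.\<close>
      define c where "c = poly.coeff s (Polynomial.degree s) / poly.coeff p (Polynomial.degree p)"
      define d where "d = poly.coeff t (Polynomial.degree s) / poly.coeff q (Polynomial.degree p)"
      have "(c, d) \<in> R" unfolding c_def d_def
        using less.prems(1) pq(1) by (intro related_divide[OF R]) (auto simp: coeffs_related_def)
      then have rel: "coeffs_related R (s - Polynomial.monom c k * p) (t - Polynomial.monom d k * q)"
        using less.prems(1) pq(1)
        by (intro coeffs_related_diff[OF R] coeffs_related_mult[OF R] coeffs_related_monom[OF R])
      have "Polynomial.degree (Polynomial.monom c k * p) \<le> k + Polynomial.degree p"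
        using degree_mult_le[of "Polynomial.monom c k" p] degree_monom_le[of c k] by linarith
      then have "Polynomial.degree (s - Polynomial.monom c k * p) \<le> Polynomial.degree s"
        using le by (intro degree_diff_le) (auto simp: k_def)
      moreover have "poly.coeff (s - Polynomial.monom c k * p) (Polynomial.degree s) = 0"
        using le pq(2) by (simp add: coeff_monom_mult k_def c_def)
      ultimately have "Polynomial.degree (s - Polynomial.monom c k * p) < Polynomial.degree s"
        using pos le by (metis le_neq_implies_less leading_coeff_0_iff degree_0 gr_implies_not0 le_0_eq)
      moreover have "poly (s - Polynomial.monom c k * p) z = 0" using less.prems root by simp
      ultimately have "poly (t - Polynomial.monom d k * q) w = 0"
        using less.hyps rel by blast
      then show ?thesis using root by simp
    qed
  qed
qed

text \<open>A polynomial of least degree for \<open>z\<close> and its conjugate have the same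
  positive degree, so the conjugate has a root in the algebraic closure, and any such root is a
  possible image of \<open>z\<close>.\<close>

lemma partial_automorphism_extend:
  fixes R :: "('k::field alg_closure \<times> 'k alg_closure) set"
  assumes R: "partial_automorphism R"
  shows "\<exists>R' w. partial_automorphism R' \<and> R \<subseteq> R' \<and> (z, w) \<in> R'"
proof -
  let ?P = "\<lambda>n. \<exists>p q. coeffs_related R p q \<and> p \<noteq> 0 \<and> poly p z = 0 \<and> Polynomial.degree p = n"
  obtain f where f: "f \<noteq> 0" "poly (map_poly to_ac f) z = 0" using alg_closure_algebraic[of z] by blast
  have "map_poly to_ac f \<noteq> 0" using f(1) by (simp add: map_poly_eq_0_iff)
  then have "?P (Polynomial.degree (map_poly to_ac f))"
    using coeffs_related_map_poly[OF R] f(2) by blast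
  then have L: "?P (LEAST n. ?P n)" by (rule LeastI)
  then obtain p q where pq: "coeffs_related R p q" "p \<noteq> 0" "poly p z = 0"
    "Polynomial.degree p = (LEAST n. ?P n)" by blast
  have min: "Polynomial.degree p \<le> Polynomial.degree s"
    if "coeffs_related R s t" "s \<noteq> 0" "poly s z = 0" for s t
    unfolding pq(4) by (rule Least_le) (use that in blast)
  have "Polynomial.degree p > 0"
  proof (rule ccontr)
    assume "\<not> ?thesis"
    then obtain a where "p = [:a:]" by (metis degree_eq_zeroE gr0I)
    then show False using pq by auto
  qed
  then have "Polynomial.degree q > 0" using coeffs_related_degree[OF R pq(1)] by simp
  then obtain w where w: "poly q w = 0" using alg_closed_imp_poly_has_root by blast
  show ?thesis
    using partial_automorphism_extend_root[OF R pq(1,2) _ pq(3) w] min by blast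
qed

text \<open>An injective endomorphism over K maps the finite root set of a polynomial over K into
  itself, hence onto itself, and every element lies in such a set.\<close>

lemma algebraic_endomorphism_surj:
  fixes \<sigma> :: "'k::field alg_closure \<Rightarrow> 'k alg_closure"
  assumes "inj \<sigma>" "\<And>x y. \<sigma> (x + y) = \<sigma> x + \<sigma> y" "\<And>x y. \<sigma> (x * y) = \<sigma> x * \<sigma> y"
    "\<And>a. \<sigma> (to_ac a) = to_ac a"
  shows "surj \<sigma>"
  unfolding surj_def
proof
  fix y :: "'k alg_closure"
  obtain f where f: "f \<noteq> 0" "poly (map_poly to_ac f) y = 0" using alg_closure_algebraic[of y] by blast
  let ?Z = "{x. poly (map_poly to_ac f) x = 0}"
  have "map_poly to_ac f \<noteq> 0" using f(1) by (simp add: map_poly_eq_0_iff)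
  then have fin: "finite ?Z" by (rule poly_roots_finite)
  have "\<sigma> (poly (map_poly to_ac h) x) = poly (map_poly to_ac h) (\<sigma> x)" for x h
  proof (induction h)
    case 0
    then show ?case using assms(4)[of 0] by simp
  next
    case (pCons c h)
    then show ?case using assms by (simp add: poly_map_poly_to_ac_pCons)
  qed
  then have "\<sigma> ` ?Z \<subseteq> ?Z" using assms(4)[of 0] by (metis (mono_tags) image_subsetI mem_Collect_eq to_ac_0)
  moreover have "inj_on \<sigma> ?Z" using assms(1) by (rule inj_on_subset) simp
  ultimately have "\<sigma> ` ?Z = ?Z" using fin by (simp add: endo_inj_surj)
  then show "\<exists>x. y = \<sigma> x" using f(2) by blast
qed

text \<open>A maximal graph has full domain, since otherwise it could be extended by one more
  element. Maximality says nothing about the range; surjectivity comes from algebraicity.\<close>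

lemma partial_automorphism_extend_galois:
  fixes R :: "('k::field alg_closure \<times> 'k alg_closure) set"
  assumes R: "partial_automorphism R"
  shows "\<exists>\<sigma>\<in>absolute_galois. \<forall>u v. (u, v) \<in> R \<longrightarrow> \<sigma> u = v"
proof -
  let ?A = "{S. partial_automorphism S \<and> R \<subseteq> S}"
  have "\<exists>M\<in>?A. \<forall>S\<in>?A. M \<subseteq> S \<longrightarrow> S = M"
  proof (rule subset_Zorn_nonempty)
    show "?A \<noteq> {}" using R by blast
    fix C assume C: "C \<noteq> {}" "subset.chain ?A C"
    then have CA: "C \<subseteq> ?A" and tot: "\<And>S T. S \<in> C \<Longrightarrow> T \<in> C \<Longrightarrow> S \<subseteq> T \<or> T \<subseteq> S"
      unfolding subset_chain_def by blast+
    have pa: "partial_automorphism S" if "S \<in> C" for S using CA that by blast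
    have two: "\<exists>S\<in>C. a \<in> S \<and> b \<in> S" if "a \<in> \<Union>C" "b \<in> \<Union>C" for a b
      using that tot by blast
    have "partial_automorphism (\<Union>C)"
      unfolding partial_automorphism_def
    proof (intro conjI allI impI)
      fix a show "(to_ac a, to_ac a) \<in> \<Union>C" using C(1) pa related_to_ac by blast
    next
      fix u v u' v' assume "(u, v) \<in> \<Union>C" "(u', v') \<in> \<Union>C"
      then obtain S where S: "S \<in> C" "(u, v) \<in> S" "(u', v') \<in> S" using two by blast
      show "(u + u', v + v') \<in> \<Union>C" using S related_add[OF pa[OF S(1)]] by blast
      show "(u * u', v * v') \<in> \<Union>C" using S related_mult[OF pa[OF S(1)]] by blast
    next
      fix u v assume "(u, v) \<in> \<Union>C"
      then show "(inverse u, inverse v) \<in> \<Union>C" using pa related_inverse by blast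
    next
      fix v assume "(0, v) \<in> \<Union>C"
      then show "v = 0" using pa related_zeroD by blast
    qed
    then show "\<Union>C \<in> ?A" using C(1) CA by blast
  qed
  then obtain M where "M \<in> ?A" and max: "\<forall>S\<in>?A. M \<subseteq> S \<longrightarrow> S = M" by (rule bexE)
  then have M: "partial_automorphism M" "R \<subseteq> M" by simp_all
  have total: "\<exists>w. (z, w) \<in> M" for z
  proof -
    obtain S w where S: "partial_automorphism S" "M \<subseteq> S" "(z, w) \<in> S"
      using partial_automorphism_extend[OF M(1), of z] by blast
    then have "S = M" using max M(2) by simp
    then show ?thesis using S(3) by blast
  qed
  define \<sigma> where "\<sigma> z = (SOME w. (z, w) \<in> M)" for z
  have graph: "(z, \<sigma> z) \<in> M" for z unfolding \<sigma>_def using total by (rule someI_ex)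
  have eq: "\<sigma> u = v" if "(u, v) \<in> M" for u v using related_unique[OF M(1) graph that] .
  have add: "\<sigma> (x + y) = \<sigma> x + \<sigma> y" and mult: "\<sigma> (x * y) = \<sigma> x * \<sigma> y" for x y
    using eq[OF related_add[OF M(1) graph graph]] eq[OF related_mult[OF M(1) graph graph]] by blast+
  have ac: "\<sigma> (to_ac a) = to_ac a" for a using eq related_to_ac[OF M(1)] by blast
  have "inj \<sigma>"
  proof (rule injI)
    fix x y assume "\<sigma> x = \<sigma> y"
    then have "(x - y, 0) \<in> M" using related_diff[OF M(1) graph[of x] graph[of y]] by simp
    then show "x = y" using related_zeroD'[OF M(1), of "x - y"] by simp
  qed
  then have "bij \<sigma>" using algebraic_endomorphism_surj[OF _ add mult ac] by (simp add: bij_def)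
  then have "\<sigma> \<in> absolute_galois" unfolding absolute_galois_def using add mult ac by blast
  then show ?thesis using eq M(2) by blast
qed

section \<open>Conjugates over the base field\<close>

lemma partial_automorphism_base:
  "partial_automorphism (range (\<lambda>a. (to_ac a, to_ac a)))"
  unfolding partial_automorphism_def
  by (auto simp flip: to_ac_add to_ac_mult to_ac_inverse)

lemma coeffs_related_base:
  "coeffs_related (range (\<lambda>a. (to_ac a, to_ac a))) p q \<longleftrightarrow> q = p \<and> (\<exists>f. p = map_poly to_ac f)"
proof
  assume *: "coeffs_related (range (\<lambda>a. (to_ac a, to_ac a))) p q"
  then have "q = p" by (intro poly_eqI) (auto simp: coeffs_related_def image_iff, metis)
  moreover have "p = map_poly to_ac (map_poly of_ac p)"
  proof (rule poly_eqI)
    fix i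
    have "(poly.coeff p i, poly.coeff q i) \<in> range (\<lambda>a. (to_ac a, to_ac a))"
      using * by (simp add: coeffs_related_def)
    then have "poly.coeff p i \<in> range to_ac" by blast
    then show "poly.coeff p i = poly.coeff (map_poly to_ac (map_poly of_ac p)) i"
      by (simp add: coeff_map_poly to_ac_of_ac)
  qed
  ultimately show "q = p \<and> (\<exists>f. p = map_poly to_ac f)" by blast
qed (auto simp: coeffs_related_def coeff_map_poly)

text \<open>A polynomial of least degree over K for an element outside K has degree at least 2. In
  characteristic 0 its derivative is nonzero of smaller degree, so the element is a simple root; a
  second root \<open>w\<close> exists, and sending \<open>x\<close> to \<open>w\<close> extends to
  an automorphism.\<close>

theorem galois_fixed_field:
  fixes x :: "'k::field_char_0 alg_closure"
  assumes fixed: "\<And>\<sigma>. \<sigma> \<in> absolute_galois \<Longrightarrow> \<sigma> x = x"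
  shows "x \<in> range to_ac"
proof (rule ccontr)
  assume x: "x \<notin> range to_ac"
  let ?R = "range (\<lambda>a. (to_ac a, to_ac a)) :: ('k alg_closure \<times> 'k alg_closure) set"
  let ?P = "\<lambda>n. \<exists>f. f \<noteq> 0 \<and> poly (map_poly to_ac f) x = 0 \<and> Polynomial.degree f = n"
  have "\<exists>n. ?P n" using alg_closure_algebraic[of x] by metis
  then have "?P (LEAST n. ?P n)" by (rule LeastI_ex)
  then obtain f where f: "f \<noteq> 0" "poly (map_poly to_ac f) x = 0" "Polynomial.degree f = (LEAST n. ?P n)"
    by blast
  have min: "Polynomial.degree f \<le> Polynomial.degree g"
    if "g \<noteq> 0" "poly (map_poly to_ac g) x = 0" for g
    unfolding f(3) by (rule Least_le) (use that in blast)
  have deg: "Polynomial.degree f \<ge> 2"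
  proof (rule ccontr)
    assume "\<not> ?thesis"
    then have "Polynomial.degree f \<le> 1" by simp
    then obtain a b where ab: "f = [:a, b:]" by (metis degree1_coeffs degree_eq_zeroE le_neq_implies_less less_one pCons_0_0 degree_0)
    then have e: "to_ac a + x * to_ac b = 0" using f by (simp add: map_poly_pCons)
    have "b \<noteq> 0" using e f ab by auto
    moreover from e have "x * to_ac b = - to_ac a" by (simp add: eq_neg_iff_add_eq_0 add.commute)
    ultimately have "x = to_ac (- a / b)"
      by (simp only: to_ac_divide to_ac_minus) (metis nonzero_mult_div_cancel_right to_ac_eq_0_iff)
    then show False using x by blast
  qed
  let ?p = "map_poly to_ac f"
  have dp: "Polynomial.degree ?p = Polynomial.degree f" by (simp add: degree_map_poly)
  have pderiv: "pderiv ?p = map_poly to_ac (pderiv f)"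
    by (rule poly_eqI) (simp add: coeff_pderiv coeff_map_poly)
  have "Polynomial.degree (pderiv f) < Polynomial.degree f" using deg by (simp add: degree_pderiv)
  moreover have "pderiv f \<noteq> 0" using deg by (simp add: pderiv_eq_0_iff)
  ultimately have simple: "poly (pderiv ?p) x \<noteq> 0" using min pderiv by fastforce
  obtain g where g: "?p = [:-x, 1:] * g" using f(2) by (metis poly_eq_0_iff_dvd dvdE)
  have "g \<noteq> 0" using g f(1) by (auto simp: map_poly_eq_0_iff)
  then have "Polynomial.degree ?p = Suc (Polynomial.degree g)" unfolding g by (subst degree_mult_eq) auto
  then have "Polynomial.degree g > 0" using deg dp by simp
  then obtain w where w: "poly g w = 0" using alg_closed_imp_poly_has_root by blast
  have "w \<noteq> x"
  proof
    assume "w = x"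
    then have "poly (pderiv ?p) x = 0" using w unfolding g pderiv_mult by (simp add: pderiv_pCons)
    then show False using simple by simp
  qed
  have "poly ?p w = 0" using w unfolding g by simp
  moreover have "Polynomial.degree ?p \<le> Polynomial.degree s"
    if "coeffs_related ?R s t" "s \<noteq> 0" "poly s x = 0" for s t
    using that min by (auto simp: coeffs_related_base degree_map_poly map_poly_eq_0_iff)
  moreover have "?p \<noteq> 0" using f(1) by (simp add: map_poly_eq_0_iff)
  moreover have "coeffs_related ?R ?p ?p" by (auto simp: coeffs_related_base)
  ultimately obtain R' where R': "partial_automorphism R'" "(x, w) \<in> R'"
    using partial_automorphism_extend_root[OF partial_automorphism_base, of ?p ?p x w] f(2) by blast
  then obtain \<sigma> where "\<sigma> \<in> absolute_galois" "\<sigma> x = w"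
    using partial_automorphism_extend_galois[OF R'(1)] by blast
  then show False using fixed \<open>w \<noteq> x\<close> by blast
qed


section \<open>Galois cohomology\<close>

lemma absolute_galois_id: "id \<in> absolute_galois"
  by (simp add: absolute_galois_def)

lemma absolute_galois_comp:
  "\<sigma> \<in> absolute_galois \<Longrightarrow> \<tau> \<in> absolute_galois \<Longrightarrow> \<sigma> \<circ> \<tau> \<in> absolute_galois"
  unfolding absolute_galois_def by (auto intro: bij_comp)

lemma absolute_galois_inv:
  fixes \<sigma> :: "'k::field alg_closure \<Rightarrow> 'k alg_closure"
  assumes "\<sigma> \<in> absolute_galois"
  shows "Hilbert_Choice.inv \<sigma> \<in> absolute_galois"
proof -
  have s: "bij \<sigma>" "\<And>x y. \<sigma> (x + y) = \<sigma> x + \<sigma> y" "\<And>x y. \<sigma> (x * y) = \<sigma> x * \<sigma> y"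
    "\<And>a. \<sigma> (to_ac a) = to_ac a" using assms unfolding absolute_galois_def by blast+
  have i: "\<sigma> (Hilbert_Choice.inv \<sigma> x) = x" for x using s(1) by (simp add: bij_is_surj surj_f_inv_f)
  have j: "Hilbert_Choice.inv \<sigma> (\<sigma> x) = x" for x using s(1) by (simp add: bij_is_inj)
  have "Hilbert_Choice.inv \<sigma> (x + y) = Hilbert_Choice.inv \<sigma> x + Hilbert_Choice.inv \<sigma> y"
    "Hilbert_Choice.inv \<sigma> (x * y) = Hilbert_Choice.inv \<sigma> x * Hilbert_Choice.inv \<sigma> y" for x y
    using j[of "Hilbert_Choice.inv \<sigma> x + Hilbert_Choice.inv \<sigma> y"]
      j[of "Hilbert_Choice.inv \<sigma> x * Hilbert_Choice.inv \<sigma> y"] by (simp_all add: s i)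
  moreover have "Hilbert_Choice.inv \<sigma> (to_ac a) = to_ac a" for a using j[of "to_ac a"] s(4) by simp
  ultimately show ?thesis using bij_imp_bij_inv[OF s(1)] by (simp add: absolute_galois_def)
qed

lemma openin_krull_basic:
  "\<sigma> \<in> absolute_galois \<Longrightarrow> finite S \<Longrightarrow>
     openin krull_topology {\<tau> \<in> absolute_galois. \<forall>x\<in>S. \<tau> x = \<sigma> x}"
  unfolding krull_topology_def
  by (rule topology_generated_by_Basis, rule CollectI, rule exI[of _ \<sigma>], rule exI[of _ S]) simp

lemma topspace_krull: "topspace krull_topology = absolute_galois"
proof
  show "topspace krull_topology \<subseteq> absolute_galois"
    unfolding krull_topology_def topology_generated_by_topspace by blast
  show "absolute_galois \<subseteq> topspace krull_topology"
    using openin_subset[OF openin_krull_basic[OF absolute_galois_id, of "{}"]] by simp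
qed

text \<open>Continuity into a discrete space is local constancy, and it can be tested on the basic
  cosets.\<close>

lemma continuous_map_krullI:
  assumes "\<And>\<sigma>. \<sigma> \<in> absolute_galois \<Longrightarrow> c \<sigma> \<in> A"
    and "\<And>\<sigma>. \<sigma> \<in> absolute_galois \<Longrightarrow>
           \<exists>S. finite S \<and> (\<forall>\<tau>\<in>absolute_galois. (\<forall>x\<in>S. \<tau> x = \<sigma> x) \<longrightarrow> c \<tau> = c \<sigma>)"
  shows "continuous_map krull_topology (discrete_topology A) c"
  unfolding continuous_map_def topspace_krull
proof (intro conjI allI impI)
  show "c \<in> absolute_galois \<rightarrow> topspace (discrete_topology A)" using assms(1) by simp
  fix U assume "openin (discrete_topology A) U"
  show "openin krull_topology {\<sigma> \<in> absolute_galois. c \<sigma> \<in> U}"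
  proof (rule openin_subopen[THEN iffD2], rule ballI)
    fix \<sigma> assume "\<sigma> \<in> {\<sigma> \<in> absolute_galois. c \<sigma> \<in> U}"
    then have s: "\<sigma> \<in> absolute_galois" "c \<sigma> \<in> U" by auto
    obtain S where S: "finite S"
      "\<forall>\<tau>\<in>absolute_galois. (\<forall>x\<in>S. \<tau> x = \<sigma> x) \<longrightarrow> c \<tau> = c \<sigma>"
      using assms(2)[OF s(1)] by (elim exE conjE)
    let ?V = "{\<tau> \<in> absolute_galois. \<forall>x\<in>S. \<tau> x = \<sigma> x}"
    have "?V \<subseteq> {\<sigma> \<in> absolute_galois. c \<sigma> \<in> U}"
    proof
      fix \<tau> assume t: "\<tau> \<in> ?V"
      with S(2) have "c \<tau> = c \<sigma>" by blast
      then show "\<tau> \<in> {\<sigma> \<in> absolute_galois. c \<sigma> \<in> U}" using t s(2) by simp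
    qed
    then show "\<exists>T. openin krull_topology T \<and> \<sigma> \<in> T \<and> T \<subseteq> {\<sigma> \<in> absolute_galois. c \<sigma> \<in> U}"
      using openin_krull_basic[OF s(1) S(1)] s(1) by blast
  qed
qed

text \<open>The last assumption is continuity for the discrete topology on \<open>M\<close>: every
  stabilizer contains the group fixing some finite set and is therefore open.\<close>

locale galois_module = comm_group M for M :: "'a monoid" (structure) +
  fixes act :: "('k::field, 'a) galois_action"
  assumes act_closed [simp]: "\<sigma> \<in> absolute_galois \<Longrightarrow> x \<in> carrier M \<Longrightarrow> act \<sigma> x \<in> carrier M"
    and act_mult: "\<sigma> \<in> absolute_galois \<Longrightarrow> x \<in> carrier M \<Longrightarrow> y \<in> carrier M \<Longrightarrow>
                     act \<sigma> (x \<otimes> y) = act \<sigma> x \<otimes> act \<sigma> y"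
    and act_id: "x \<in> carrier M \<Longrightarrow> act id x = x"
    and act_comp: "\<sigma> \<in> absolute_galois \<Longrightarrow> \<tau> \<in> absolute_galois \<Longrightarrow> x \<in> carrier M \<Longrightarrow>
                     act (\<sigma> \<circ> \<tau>) x = act \<sigma> (act \<tau> x)"
    and act_continuous: "x \<in> carrier M \<Longrightarrow>
           \<exists>S. finite S \<and> (\<forall>\<sigma>\<in>absolute_galois. (\<forall>s\<in>S. \<sigma> s = s) \<longrightarrow> act \<sigma> x = x)"
begin

abbreviation coboundary :: "'a \<Rightarrow> ('k, 'a) cochain" where
  "coboundary b \<equiv> (\<lambda>\<sigma>\<in>absolute_galois. act \<sigma> b \<otimes> inv b)"

lemma act_group_hom: "\<sigma> \<in> absolute_galois \<Longrightarrow> group_hom M M (act \<sigma>)"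
  by unfold_locales (auto simp: hom_def act_mult)

lemma act_one [simp]: "\<sigma> \<in> absolute_galois \<Longrightarrow> act \<sigma> \<one> = \<one>"
  using group_hom.hom_one[OF act_group_hom] .

lemma act_inv: "\<sigma> \<in> absolute_galois \<Longrightarrow> x \<in> carrier M \<Longrightarrow> act \<sigma> (inv x) = inv (act \<sigma> x)"
  using group_hom.hom_inv[OF act_group_hom] .

lemma act_pow: "\<sigma> \<in> absolute_galois \<Longrightarrow> x \<in> carrier M \<Longrightarrow> act \<sigma> (x [^] (n::nat)) = act \<sigma> x [^] n"
  using group_hom.hom_nat_pow[OF act_group_hom] .

text \<open>If \<tau> agrees with \<sigma> on \<open>S\<close>, the inverse of \<sigma> composed
  with \<tau> fixes \<open>S\<close>, which moves the question to the stabilizer of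
  \<open>x\<close>.\<close>

lemma act_locally_constant:
  assumes x: "x \<in> carrier M" and s: "\<sigma> \<in> absolute_galois"
  shows "\<exists>S. finite S \<and> (\<forall>\<tau>\<in>absolute_galois. (\<forall>s\<in>S. \<tau> s = \<sigma> s) \<longrightarrow> act \<tau> x = act \<sigma> x)"
proof -
  obtain S where S: "finite S" "\<And>\<tau>. \<tau> \<in> absolute_galois \<Longrightarrow> (\<forall>s\<in>S. \<tau> s = s) \<Longrightarrow> act \<tau> x = x"
    using act_continuous[OF x] by blast
  have bij: "bij \<sigma>" using s by (simp add: absolute_galois_def)
  have "act \<tau> x = act \<sigma> x" if t: "\<tau> \<in> absolute_galois" "\<forall>s\<in>S. \<tau> s = \<sigma> s" for \<tau>
  proof -
    let ?i = "Hilbert_Choice.inv \<sigma>"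
    have i: "?i \<in> absolute_galois" using absolute_galois_inv[OF s] .
    have "\<forall>s\<in>S. (?i \<circ> \<tau>) s = s" using t(2) bij by (simp add: bij_is_inj)
    then have "act (?i \<circ> \<tau>) x = x" using S(2) absolute_galois_comp[OF i t(1)] by blast
    moreover have "\<sigma> \<circ> (?i \<circ> \<tau>) = \<tau>" using bij by (simp add: fun_eq_iff bij_is_surj surj_f_inv_f)
    ultimately show ?thesis using act_comp[OF s absolute_galois_comp[OF i t(1)] x] by simp
  qed
  then show ?thesis using S(1) by blast
qed

lemma coboundary_continuous:
  assumes "b \<in> carrier M" "\<And>\<sigma>. \<sigma> \<in> absolute_galois \<Longrightarrow> act \<sigma> b \<otimes> inv b \<in> A"
  shows "continuous_map krull_topology (discrete_topology A) (coboundary b)"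
proof (rule continuous_map_krullI)
  fix \<sigma> assume s: "\<sigma> \<in> (absolute_galois :: ('k alg_closure \<Rightarrow> _) set)"
  show "coboundary b \<sigma> \<in> A" using assms(2) s by simp
  show "\<exists>S. finite S \<and> (\<forall>\<tau>\<in>absolute_galois. (\<forall>x\<in>S. \<tau> x = \<sigma> x) \<longrightarrow>
          coboundary b \<tau> = coboundary b \<sigma>)"
  proof -
    obtain S where S: "finite S" "\<forall>\<tau>\<in>absolute_galois. (\<forall>x\<in>S. \<tau> x = \<sigma> x) \<longrightarrow> act \<tau> b = act \<sigma> b"
      using act_locally_constant[OF assms(1) s] by (elim exE conjE)
    show ?thesis
    proof (intro exI[of _ S] conjI S(1) ballI impI)
      fix \<tau> assume t: "\<tau> \<in> (absolute_galois :: ('k alg_closure \<Rightarrow> _) set)" "\<forall>x\<in>S. \<tau> x = \<sigma> x"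
      then have "act \<tau> b = act \<sigma> b" using S(2) by blast
      then show "coboundary b \<tau> = coboundary b \<sigma>" using t(1) s by simp
    qed
  qed
qed

lemma coboundary_cocycle_identity:
  assumes "b \<in> carrier M" "\<sigma> \<in> absolute_galois" "\<tau> \<in> absolute_galois"
  shows "coboundary b (\<sigma> \<circ> \<tau>) = coboundary b \<sigma> \<otimes> act \<sigma> (coboundary b \<tau>)"
proof -
  have "act \<sigma> b \<otimes> inv b \<otimes> act \<sigma> (act \<tau> b \<otimes> inv b) =
        (act \<sigma> b \<otimes> inv (act \<sigma> b)) \<otimes> (act \<sigma> (act \<tau> b) \<otimes> inv b)"
    using assms by (simp add: act_mult act_inv m_ac) (metis act_closed inv_closed m_assoc r_inv l_one)
  also have "\<dots> = act \<sigma> (act \<tau> b) \<otimes> inv b" using assms by simp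
  finally show ?thesis using assms by (simp add: absolute_galois_comp act_comp)
qed

lemma coboundary_mult:
  assumes "a \<in> carrier M" "b \<in> carrier M" "\<sigma> \<in> absolute_galois"
  shows "coboundary (a \<otimes> b) \<sigma> = coboundary a \<sigma> \<otimes> coboundary b \<sigma>"
  using assms by (simp add: act_mult inv_mult m_ac)

lemma coboundary_inv:
  assumes "a \<in> carrier M" "\<sigma> \<in> absolute_galois"
  shows "coboundary (inv a) \<sigma> = inv (coboundary a \<sigma>)"
  using assms by (simp add: act_inv inv_mult m_ac)

section \<open>Cocycles modulo coboundaries\<close>

lemma cocycleI:
  assumes "c \<in> extensional absolute_galois" "\<And>\<sigma>. \<sigma> \<in> absolute_galois \<Longrightarrow> c \<sigma> \<in> carrier M"
    "continuous_map krull_topology (discrete_topology (carrier M)) c"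
    "\<And>\<sigma> \<tau>. \<sigma> \<in> absolute_galois \<Longrightarrow> \<tau> \<in> absolute_galois \<Longrightarrow> c (\<sigma> \<circ> \<tau>) = c \<sigma> \<otimes> act \<sigma> (c \<tau>)"
  shows "c \<in> cocycles M act"
  unfolding cocycles_def PiE_def using assms by auto

lemma cocycleD:
  assumes "c \<in> cocycles M act"
  shows "c \<in> extensional absolute_galois" "\<sigma> \<in> absolute_galois \<Longrightarrow> c \<sigma> \<in> carrier M"
    "continuous_map krull_topology (discrete_topology (carrier M)) c"
    "\<sigma> \<in> absolute_galois \<Longrightarrow> \<tau> \<in> absolute_galois \<Longrightarrow> c (\<sigma> \<circ> \<tau>) = c \<sigma> \<otimes> act \<sigma> (c \<tau>)"
  using assms unfolding cocycles_def PiE_def by auto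

lemma cocycle_eqI:
  "c \<in> cocycles M act \<Longrightarrow> d \<in> cocycles M act \<Longrightarrow>
     (\<And>\<sigma>. \<sigma> \<in> absolute_galois \<Longrightarrow> c \<sigma> = d \<sigma>) \<Longrightarrow> c = d"
  by (rule extensionalityI[OF cocycleD(1) cocycleD(1)])

lemma coboundary_cocycle: "b \<in> carrier M \<Longrightarrow> coboundary b \<in> cocycles M act"
  by (intro cocycleI coboundary_continuous coboundary_cocycle_identity) simp_all

lemma cocycle_mult:
  assumes c: "c \<in> cocycles M act" and d: "d \<in> cocycles M act"
  shows "(\<lambda>\<sigma>\<in>absolute_galois. c \<sigma> \<otimes> d \<sigma>) \<in> cocycles M act"
proof (rule cocycleI)
  let ?A = "discrete_topology (carrier M)"
  have "continuous_map krull_topology (prod_topology ?A ?A) (\<lambda>\<sigma>. (c \<sigma>, d \<sigma>))"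
    using cocycleD(3)[OF c] cocycleD(3)[OF d] by (rule continuous_map_pairedI)
  \<comment> \<open>The product of two discrete spaces is discrete, so multiplication is continuous
    on it.\<close>
  moreover have "continuous_map (prod_topology ?A ?A) ?A (\<lambda>(x, y). x \<otimes> y)"
    unfolding prod_topology_discrete_topology[symmetric] by (auto simp: continuous_map_from_discrete_topology)
  ultimately have "continuous_map krull_topology ?A ((\<lambda>(x, y). x \<otimes> y) \<circ> (\<lambda>\<sigma>. (c \<sigma>, d \<sigma>)))"
    by (rule continuous_map_compose)
  then show "continuous_map krull_topology ?A (\<lambda>\<sigma>\<in>absolute_galois. c \<sigma> \<otimes> d \<sigma>)"
    by (rule continuous_map_eq) (simp add: topspace_krull)
  fix \<sigma> \<tau> assume "\<sigma> \<in> (absolute_galois :: ('k alg_closure \<Rightarrow> _) set)" "\<tau> \<in> (absolute_galois :: ('k alg_closure \<Rightarrow> _) set)"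
  then show "(\<lambda>\<sigma>\<in>absolute_galois. c \<sigma> \<otimes> d \<sigma>) (\<sigma> \<circ> \<tau>) =
      (\<lambda>\<sigma>\<in>absolute_galois. c \<sigma> \<otimes> d \<sigma>) \<sigma> \<otimes> act \<sigma> ((\<lambda>\<sigma>\<in>absolute_galois. c \<sigma> \<otimes> d \<sigma>) \<tau>)"
    using cocycleD[OF c] cocycleD[OF d] by (simp add: absolute_galois_comp act_mult m_ac)
qed (use cocycleD[OF c] cocycleD[OF d] in simp_all)

lemma cocycle_inv:
  assumes c: "c \<in> cocycles M act"
  shows "(\<lambda>\<sigma>\<in>absolute_galois. inv (c \<sigma>)) \<in> cocycles M act"
proof (rule cocycleI)
  let ?A = "discrete_topology (carrier M)"
  have "continuous_map ?A ?A (\<lambda>x. inv x)" by (auto simp: continuous_map_from_discrete_topology)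
  with cocycleD(3)[OF c] have "continuous_map krull_topology ?A ((\<lambda>x. inv x) \<circ> c)"
    by (rule continuous_map_compose)
  then show "continuous_map krull_topology ?A (\<lambda>\<sigma>\<in>absolute_galois. inv (c \<sigma>))"
    by (rule continuous_map_eq) (simp add: topspace_krull)
  fix \<sigma> \<tau> assume "\<sigma> \<in> (absolute_galois :: ('k alg_closure \<Rightarrow> _) set)" "\<tau> \<in> (absolute_galois :: ('k alg_closure \<Rightarrow> _) set)"
  then show "(\<lambda>\<sigma>\<in>absolute_galois. inv (c \<sigma>)) (\<sigma> \<circ> \<tau>) =
      (\<lambda>\<sigma>\<in>absolute_galois. inv (c \<sigma>)) \<sigma> \<otimes> act \<sigma> ((\<lambda>\<sigma>\<in>absolute_galois. inv (c \<sigma>)) \<tau>)"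
    using cocycleD[OF c] by (simp add: absolute_galois_comp act_inv inv_mult)
qed (use cocycleD[OF c] in simp_all)

lemma cocycle_one: "(\<lambda>\<sigma>\<in>absolute_galois. \<one>) \<in> cocycles M act"
proof -
  have "coboundary \<one> = (\<lambda>\<sigma>\<in>absolute_galois. \<one>)" by (auto simp: fun_eq_iff restrict_def)
  then show ?thesis using coboundary_cocycle[OF one_closed] by simp
qed

lemma cocycle_group_sel [simp]:
  "carrier (cocycle_group M act) = cocycles M act"
  "c \<otimes>\<^bsub>cocycle_group M act\<^esub> d = (\<lambda>\<sigma>\<in>absolute_galois. c \<sigma> \<otimes> d \<sigma>)"
  "\<one>\<^bsub>cocycle_group M act\<^esub> = (\<lambda>\<sigma>\<in>absolute_galois. \<one>)"
  by (simp_all add: cocycle_group_def)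

lemma comm_group_cocycle_group: "comm_group (cocycle_group M act)"
proof (rule comm_groupI)
  fix c assume c: "c \<in> carrier (cocycle_group M act)"
  then have "(\<lambda>\<sigma>\<in>absolute_galois. inv (c \<sigma>)) \<otimes>\<^bsub>cocycle_group M act\<^esub> c = \<one>\<^bsub>cocycle_group M act\<^esub>"
    using cocycleD(2)[of c] by (auto simp: fun_eq_iff restrict_def)
  then show "\<exists>d\<in>carrier (cocycle_group M act). d \<otimes>\<^bsub>cocycle_group M act\<^esub> c = \<one>\<^bsub>cocycle_group M act\<^esub>"
    using cocycle_inv[OF c[unfolded cocycle_group_sel(1)]] unfolding cocycle_group_sel(1) by (rule bexI)
  show "\<one>\<^bsub>cocycle_group M act\<^esub> \<otimes>\<^bsub>cocycle_group M act\<^esub> c = c"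
  proof (rule cocycle_eqI)
    fix \<sigma> assume "\<sigma> \<in> (absolute_galois :: ('k alg_closure \<Rightarrow> _) set)"
    then show "(\<one>\<^bsub>cocycle_group M act\<^esub> \<otimes>\<^bsub>cocycle_group M act\<^esub> c) \<sigma> = c \<sigma>"
      using cocycleD(2)[of c \<sigma>] c by simp
  qed (use c cocycle_mult[OF cocycle_one, of c] in simp_all)
  fix d assume d: "d \<in> carrier (cocycle_group M act)"
  show "c \<otimes>\<^bsub>cocycle_group M act\<^esub> d = d \<otimes>\<^bsub>cocycle_group M act\<^esub> c"
    using c d cocycleD(2)[of c] cocycleD(2)[of d] by (auto intro!: restrict_ext m_comm)
  fix e assume e: "e \<in> carrier (cocycle_group M act)"
  show "c \<otimes>\<^bsub>cocycle_group M act\<^esub> d \<otimes>\<^bsub>cocycle_group M act\<^esub> e =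
        c \<otimes>\<^bsub>cocycle_group M act\<^esub> (d \<otimes>\<^bsub>cocycle_group M act\<^esub> e)"
    using c d e cocycleD(2)[of c] cocycleD(2)[of d] cocycleD(2)[of e]
    by (auto intro!: restrict_ext m_assoc)
next
  show "\<one>\<^bsub>cocycle_group M act\<^esub> \<in> carrier (cocycle_group M act)"
    unfolding cocycle_group_sel by (rule cocycle_one)
  show "c \<otimes>\<^bsub>cocycle_group M act\<^esub> d \<in> carrier (cocycle_group M act)"
    if "c \<in> carrier (cocycle_group M act)" "d \<in> carrier (cocycle_group M act)" for c d
    using that unfolding cocycle_group_sel by (rule cocycle_mult)
qed

sublocale Z1: comm_group "cocycle_group M act"
  by (rule comm_group_cocycle_group)

lemma inv_cocycle_group:
  assumes "c \<in> cocycles M act"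
  shows "inv\<^bsub>cocycle_group M act\<^esub> c = (\<lambda>\<sigma>\<in>absolute_galois. inv (c \<sigma>))"
proof (rule Z1.inv_equality)
  show "(\<lambda>\<sigma>\<in>absolute_galois. inv (c \<sigma>)) \<otimes>\<^bsub>cocycle_group M act\<^esub> c = \<one>\<^bsub>cocycle_group M act\<^esub>"
    using cocycleD(2)[OF assms] by (auto simp: fun_eq_iff restrict_def)
qed (use assms cocycle_inv in simp_all)

lemma subgroup_coboundaries: "subgroup (coboundaries M act) (cocycle_group M act)"
proof (rule Z1.subgroupI)
  show "coboundaries M act \<subseteq> carrier (cocycle_group M act)"
    unfolding coboundaries_def using coboundary_cocycle by auto
  show "coboundaries M act \<noteq> {}" unfolding coboundaries_def by auto
  fix c assume "c \<in> coboundaries M act"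
  then obtain a where a: "a \<in> carrier M" "c = coboundary a" unfolding coboundaries_def by blast
  have "inv\<^bsub>cocycle_group M act\<^esub> c = coboundary (inv a)"
    unfolding a(2) inv_cocycle_group[OF coboundary_cocycle[OF a(1)]]
    using coboundary_inv[OF a(1)] by (auto intro!: restrict_ext)
  then show "inv\<^bsub>cocycle_group M act\<^esub> c \<in> coboundaries M act"
    unfolding coboundaries_def using a(1) by blast
  fix d assume "d \<in> coboundaries M act"
  then obtain b where b: "b \<in> carrier M" "d = coboundary b" unfolding coboundaries_def by blast
  have "c \<otimes>\<^bsub>cocycle_group M act\<^esub> d = coboundary (a \<otimes> b)"
    unfolding a(2) b(2) cocycle_group_sel
    using coboundary_mult[OF a(1) b(1)] by (auto intro!: restrict_ext)
  then show "c \<otimes>\<^bsub>cocycle_group M act\<^esub> d \<in> coboundaries M act"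
    unfolding coboundaries_def using a(1) b(1) by blast
qed

sublocale B1: normal "coboundaries M act" "cocycle_group M act"
  using Z1.subgroup_imp_normal[OF subgroup_coboundaries] .

lemma comm_group_H1: "comm_group (H1 M act)"
  unfolding H1_def using Z1.abelian_FactGroup[OF subgroup_coboundaries] .

lemma one_H1: "\<one>\<^bsub>H1 M act\<^esub> = coboundaries M act"
  by (simp add: H1_def FactGroup_def)

lemma class_in_H1 [simp]: "c \<in> cocycles M act \<Longrightarrow> cohomology_class M act c \<in> carrier (H1 M act)"
  unfolding H1_def FactGroup_def cohomology_class_def
  by (simp only: partial_object.simps) (rule Z1.rcosetsI, auto simp: B1.subset[simplified])

lemma class_mult:
  assumes "c \<in> cocycles M act" "d \<in> cocycles M act"
  shows "cohomology_class M act c \<otimes>\<^bsub>H1 M act\<^esub> cohomology_class M act d =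
     cohomology_class M act (\<lambda>\<sigma>\<in>absolute_galois. c \<sigma> \<otimes> d \<sigma>)"
  using B1.rcos_sum[of c d] assms by (simp add: H1_def FactGroup_def cohomology_class_def)

text \<open>Turns equality of cosets into an equation between values; cocycles are extensional, so
  their values on the Galois group determine them.\<close>

lemma class_eq_iff:
  assumes c: "c \<in> cocycles M act" and d: "d \<in> cocycles M act"
  shows "cohomology_class M act c = cohomology_class M act d \<longleftrightarrow>
     (\<exists>t\<in>carrier M. \<forall>\<sigma>\<in>absolute_galois. c \<sigma> = act \<sigma> t \<otimes> inv t \<otimes> d \<sigma>)"
proof -
  have "cohomology_class M act c = cohomology_class M act d \<longleftrightarrow> c \<in> cohomology_class M act d"
    unfolding cohomology_class_def
  proof
    have "c \<in> coboundaries M act #>\<^bsub>cocycle_group M act\<^esub> c"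
      using c by (intro Z1.rcos_self subgroup_coboundaries) simp
    then show "c \<in> coboundaries M act #>\<^bsub>cocycle_group M act\<^esub> d"
      if "coboundaries M act #>\<^bsub>cocycle_group M act\<^esub> c = coboundaries M act #>\<^bsub>cocycle_group M act\<^esub> d"
      using that by (simp only:)
    show "coboundaries M act #>\<^bsub>cocycle_group M act\<^esub> c = coboundaries M act #>\<^bsub>cocycle_group M act\<^esub> d"
      if "c \<in> coboundaries M act #>\<^bsub>cocycle_group M act\<^esub> d"
      using d by (intro Z1.repr_independence[OF that _ subgroup_coboundaries, symmetric]) simp
  qed
  also have "\<dots> \<longleftrightarrow> (\<exists>t\<in>carrier M. c = (\<lambda>\<sigma>\<in>absolute_galois. coboundary t \<sigma> \<otimes> d \<sigma>))"
    unfolding cohomology_class_def r_coset_def coboundaries_def by simp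
  also have "\<dots> \<longleftrightarrow> (\<exists>t\<in>carrier M. \<forall>\<sigma>\<in>absolute_galois. c \<sigma> = act \<sigma> t \<otimes> inv t \<otimes> d \<sigma>)"
  proof (rule bex_cong[OF refl])
    fix t assume t: "t \<in> carrier M"
    show "c = (\<lambda>\<sigma>\<in>absolute_galois. coboundary t \<sigma> \<otimes> d \<sigma>) \<longleftrightarrow>
      (\<forall>\<sigma>\<in>absolute_galois. c \<sigma> = act \<sigma> t \<otimes> inv t \<otimes> d \<sigma>)"
    proof
      assume eq: "\<forall>\<sigma>\<in>absolute_galois. c \<sigma> = act \<sigma> t \<otimes> inv t \<otimes> d \<sigma>"
      show "c = (\<lambda>\<sigma>\<in>absolute_galois. coboundary t \<sigma> \<otimes> d \<sigma>)"
        by (rule cocycle_eqI[OF c cocycle_mult[OF coboundary_cocycle[OF t] d]]) (simp add: eq)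
    qed simp
  qed
  finally show ?thesis .
qed

lemma class_one_iff:
  assumes c: "c \<in> cocycles M act"
  shows "cohomology_class M act c = \<one>\<^bsub>H1 M act\<^esub> \<longleftrightarrow>
     (\<exists>t\<in>carrier M. \<forall>\<sigma>\<in>absolute_galois. c \<sigma> = act \<sigma> t \<otimes> inv t)"
proof -
  have "\<one>\<^bsub>H1 M act\<^esub> = cohomology_class M act (\<lambda>\<sigma>\<in>absolute_galois. \<one>)"
    unfolding one_H1 cohomology_class_def
    using Z1.coset_mult_one[OF B1.subset] by simp
  then show ?thesis using class_eq_iff[OF c cocycle_one] by simp
qed

lemma class_inv:
  assumes c: "c \<in> cocycles M act"
  shows "inv\<^bsub>H1 M act\<^esub> cohomology_class M act c =
     cohomology_class M act (\<lambda>\<sigma>\<in>absolute_galois. inv (c \<sigma>))"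
proof -
  interpret H: comm_group "H1 M act" by (rule comm_group_H1)
  have "(\<forall>\<sigma>\<in>absolute_galois. inv c \<sigma> \<otimes> c \<sigma> = act \<sigma> \<one> \<otimes> inv \<one>)"
    using cocycleD(2)[OF c] by simp
  then have "cohomology_class M act (\<lambda>\<sigma>\<in>absolute_galois. (\<lambda>\<sigma>\<in>absolute_galois. inv (c \<sigma>)) \<sigma> \<otimes> c \<sigma>) = \<one>\<^bsub>H1 M act\<^esub>"
    unfolding class_one_iff[OF cocycle_mult[OF cocycle_inv[OF c] c]]
    by (intro bexI[OF _ one_closed]) simp
  then show ?thesis
    unfolding class_mult[OF cocycle_inv[OF c] c, symmetric]
    by (rule H.inv_equality) (simp_all add: c cocycle_inv)
qed

section \<open>Torsion submodules and Kummer cocycles\<close>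

lemma torsion_sel [simp]:
  "x \<in> carrier (torsion M m) \<longleftrightarrow> x \<in> carrier M \<and> x [^] m = \<one>"
  "x \<otimes>\<^bsub>torsion M m\<^esub> y = x \<otimes> y" "\<one>\<^bsub>torsion M m\<^esub> = \<one>"
  by (auto simp: torsion_def kernel_def)

lemma pow_group_hom: "group_hom M M (\<lambda>x. x [^] (m::nat))"
  by unfold_locales (auto simp: hom_def nat_pow_distrib)

lemma subgroup_torsion: "subgroup (carrier (torsion M m)) M"
  using group_hom.subgroup_kernel[OF pow_group_hom, of m] by (simp add: torsion_def)

lemma inv_torsion [simp]: "x \<in> carrier M \<Longrightarrow> x [^] m = \<one> \<Longrightarrow> inv\<^bsub>torsion M m\<^esub> x = inv x"
  using m_inv_consistent[OF subgroup_torsion, of x m] by (simp add: torsion_def kernel_def)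

lemma galois_module_torsion: "galois_module (torsion M m) act"
proof -
  have "comm_group (torsion M m)"
    using subgroup_imp_group[OF subgroup_torsion[of m]]
    by (intro group.group_comm_groupI) (auto simp: torsion_def kernel_def m_comm)
  then show ?thesis
    by (intro galois_module.intro galois_module_axioms.intro)
       (simp_all add: act_mult act_id act_comp act_continuous flip: act_pow)
qed

lemma kummer_cocycle_torsion:
  assumes "b \<in> carrier M" "\<sigma> \<in> absolute_galois" "act \<sigma> (b [^] m) = b [^] (m::nat)"
  shows "act \<sigma> b \<otimes> inv b \<in> carrier (torsion M m)"
  using assms by (simp add: nat_pow_distrib nat_pow_inv flip: act_pow)

text \<open>A coboundary of \<open>M\<close> with torsion values is a cocycle of the torsion
  submodule. Its class there need not be trivial, because \<open>b\<close> itself need not be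
  torsion.\<close>

lemma kummer_cocycle:
  assumes b: "b \<in> carrier M" and fixed: "\<And>\<sigma>. \<sigma> \<in> absolute_galois \<Longrightarrow> act \<sigma> (b [^] m) = b [^] (m::nat)"
  shows "coboundary b \<in> cocycles (torsion M m) act"
proof -
  interpret T: galois_module "torsion M m" act by (rule galois_module_torsion)
  show ?thesis
  proof (rule T.cocycleI)
    show "continuous_map krull_topology (discrete_topology (carrier (torsion M m))) (coboundary b)"
      using coboundary_continuous[OF b] kummer_cocycle_torsion[OF b _ fixed] by blast
    fix \<sigma> \<tau> assume "\<sigma> \<in> (absolute_galois :: ('k alg_closure \<Rightarrow> _) set)" "\<tau> \<in> (absolute_galois :: ('k alg_closure \<Rightarrow> _) set)"
    then show "coboundary b (\<sigma> \<circ> \<tau>) = coboundary b \<sigma> \<otimes>\<^bsub>torsion M m\<^esub> act \<sigma> (coboundary b \<tau>)"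
      using coboundary_cocycle_identity[OF b] by simp
  next
    fix \<sigma> assume "\<sigma> \<in> (absolute_galois :: ('k alg_closure \<Rightarrow> _) set)"
    then show "coboundary b \<sigma> \<in> carrier (torsion M m)"
      using kummer_cocycle_torsion[OF b _ fixed] by auto
  qed simp
qed

text \<open>Independence of the choice hidden in \<open>connecting\<close>: two roots of the same
  element differ by a torsion element, whose coboundary is the difference of the two
  cocycles.\<close>

lemma connecting_pow:
  assumes b: "b \<in> carrier M" and fixed: "\<And>\<sigma>. \<sigma> \<in> absolute_galois \<Longrightarrow> act \<sigma> (b [^] m) = b [^] (m::nat)"
  shows "connecting M M act (\<lambda>x. x [^] m) (b [^] m) = cohomology_class (torsion M m) act (coboundary b)"
proof -
  interpret T: galois_module "torsion M m" act by (rule galois_module_torsion)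
  define a where "a = (SOME a. a \<in> carrier M \<and> a [^] m = b [^] m)"
  have a: "a \<in> carrier M" "a [^] m = b [^] m"
    unfolding a_def using someI[of "\<lambda>a. a \<in> carrier M \<and> a [^] m = b [^] m" b] b by auto
  have t: "a \<otimes> inv b \<in> carrier (torsion M m)"
    using a b by (simp add: nat_pow_distrib nat_pow_inv)
  have "cohomology_class (torsion M m) act (coboundary a) = cohomology_class (torsion M m) act (coboundary b)"
  proof (subst T.class_eq_iff)
    show "coboundary a \<in> cocycles (torsion M m) act" "coboundary b \<in> cocycles (torsion M m) act"
      using kummer_cocycle a b fixed by simp_all
    show "\<exists>t\<in>carrier (torsion M m). \<forall>\<sigma>\<in>absolute_galois. coboundary a \<sigma> =
       act \<sigma> t \<otimes>\<^bsub>torsion M m\<^esub> inv\<^bsub>torsion M m\<^esub> t \<otimes>\<^bsub>torsion M m\<^esub> coboundary b \<sigma>"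
    proof (intro bexI[OF _ t] ballI)
      fix \<sigma> assume s: "\<sigma> \<in> (absolute_galois :: ('k alg_closure \<Rightarrow> _) set)"
      have ab: "a \<otimes> inv b \<in> carrier M" using a b by simp
      have "coboundary a \<sigma> = coboundary (a \<otimes> inv b \<otimes> b) \<sigma>" using a b by (simp add: m_assoc)
      also have "\<dots> = coboundary (a \<otimes> inv b) \<sigma> \<otimes> coboundary b \<sigma>"
        by (rule coboundary_mult[OF ab b s])
      finally show "coboundary a \<sigma> = act \<sigma> (a \<otimes> inv b) \<otimes>\<^bsub>torsion M m\<^esub> inv\<^bsub>torsion M m\<^esub> (a \<otimes> inv b)
           \<otimes>\<^bsub>torsion M m\<^esub> coboundary b \<sigma>"
        using s t by simp
    qed
  qed
  then show ?thesis unfolding connecting_def Let_def a_def[symmetric] by (simp add: torsion_def)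
qed

end

text \<open>\<open>H1_map\<close> extracts the unique element of an image, so all representatives
  must be shown to give one class: if two cocycles differ by the coboundary of \<open>t\<close>,
  their images differ by that of \<open>f t\<close>.\<close>

lemma H1_map_class:
  assumes "galois_module M act" "galois_module N act'"
    and f: "f \<in> hom M N"
    and equi: "\<And>\<sigma> x. \<sigma> \<in> absolute_galois \<Longrightarrow> x \<in> carrier M \<Longrightarrow> f (act \<sigma> x) = act' \<sigma> (f x)"
    and c: "c \<in> cocycles M act"
  shows "(\<lambda>\<sigma>\<in>absolute_galois. f (c \<sigma>)) \<in> cocycles N act'"
    and "H1_map N act' f (cohomology_class M act c) =
           cohomology_class N act' (\<lambda>\<sigma>\<in>absolute_galois. f (c \<sigma>))"
proof -
  interpret M: galois_module M act by fact
  interpret N: galois_module N act' by fact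
  interpret f: group_hom M N f by unfold_locales (rule f)
  have push: "(\<lambda>\<sigma>\<in>absolute_galois. f (c \<sigma>)) \<in> cocycles N act'" if c: "c \<in> cocycles M act" for c
  proof (rule N.cocycleI)
    have "continuous_map (discrete_topology (carrier M)) (discrete_topology (carrier N)) f"
      by (auto simp: continuous_map_from_discrete_topology)
    with M.cocycleD(3)[OF c] have "continuous_map krull_topology (discrete_topology (carrier N)) (f \<circ> c)"
      by (rule continuous_map_compose)
    then show "continuous_map krull_topology (discrete_topology (carrier N)) (\<lambda>\<sigma>\<in>absolute_galois. f (c \<sigma>))"
      by (rule continuous_map_eq) (simp add: topspace_krull)
  qed (use M.cocycleD[OF c] in \<open>simp_all add: absolute_galois_comp equi\<close>)
  show "(\<lambda>\<sigma>\<in>absolute_galois. f (c \<sigma>)) \<in> cocycles N act'" using push[OF c] .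
  let ?F = "\<lambda>c. cohomology_class N act' (\<lambda>\<sigma>\<in>absolute_galois. f (c \<sigma>))"
  have "?F d = ?F c" if d: "d \<in> cohomology_class M act c" for d
  proof -
    obtain t where t: "t \<in> carrier M" "d = (\<lambda>\<sigma>\<in>absolute_galois. M.coboundary t \<sigma> \<otimes>\<^bsub>M\<^esub> c \<sigma>)"
      using d unfolding cohomology_class_def r_coset_def coboundaries_def by auto
    have "d \<in> cocycles M act" unfolding t(2) by (rule M.cocycle_mult[OF M.coboundary_cocycle[OF t(1)] c])
    moreover have "\<forall>\<sigma>\<in>absolute_galois. f (d \<sigma>) = act' \<sigma> (f t) \<otimes>\<^bsub>N\<^esub> inv\<^bsub>N\<^esub> (f t) \<otimes>\<^bsub>N\<^esub> f (c \<sigma>)"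
      using t M.cocycleD(2)[OF c] by (simp add: equi)
    ultimately show ?thesis using N.class_eq_iff[OF push push[OF c]] t(1) by auto
  qed
  moreover have "c \<in> cohomology_class M act c"
    unfolding cohomology_class_def using M.Z1.rcos_self[OF _ M.subgroup_coboundaries] c by simp
  ultimately have "?F ` cohomology_class M act c = {?F c}" by blast
  then show "H1_map N act' f (cohomology_class M act c) = ?F c" by (simp add: H1_map_def)
qed


section \<open>Gluing two Galois modules along their torsion\<close>

lemma pow_DirProd: "(x, y) [^]\<^bsub>G \<times>\<times> H\<^esub> (n::nat) = (x [^]\<^bsub>G\<^esub> n, y [^]\<^bsub>H\<^esub> n)"
  by (induction n) (auto simp: nat_pow_def)

context galois_module
begin

lemma coboundary_eq_one_iff:
  assumes "b \<in> carrier M" "\<sigma> \<in> absolute_galois"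
  shows "act \<sigma> b \<otimes> inv b = \<one> \<longleftrightarrow> act \<sigma> b = b"
  using assms by (metis act_closed inv_closed r_cancel r_inv)

definition invariants :: "'a monoid" where
  "invariants = M\<lparr>carrier := {x \<in> carrier M. \<forall>\<sigma>\<in>absolute_galois. act \<sigma> x = x}\<rparr>"

lemma invariants_sel [simp]:
  "x \<in> carrier invariants \<longleftrightarrow> x \<in> carrier M \<and> (\<forall>\<sigma>\<in>absolute_galois. act \<sigma> x = x)"
  "x \<otimes>\<^bsub>invariants\<^esub> y = x \<otimes> y" "\<one>\<^bsub>invariants\<^esub> = \<one>"
  by (simp_all add: invariants_def)

lemma group_invariants: "group invariants"
proof -
  have "subgroup {x \<in> carrier M. \<forall>\<sigma>\<in>absolute_galois. act \<sigma> x = x} M"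
    by (rule subgroupI) (auto simp: act_mult act_inv intro!: exI[of _ \<one>])
  then show ?thesis unfolding invariants_def by (rule subgroup_imp_group)
qed

end

text \<open>All that the theorem needs from the curves. Divisibility by \<open>m\<close> defines the
  connecting maps on all invariants; \<phi> is constrained on torsion only, and
  \<open>torsion M2 m\<close> plays the role of \<Delta>.\<close>

locale kummer_pair = M1: galois_module M1 act1 + M2: galois_module M2 act2
  for M1 :: "'a monoid" and act1 :: "('k::field, 'a) galois_action"
    and M2 :: "'b monoid" and act2 :: "('k, 'b) galois_action" +
  fixes m :: nat and \<phi> :: "'a \<Rightarrow> 'b"
  assumes iso: "\<phi> \<in> iso (torsion M1 m) (torsion M2 m)"
    and equivariant: "\<sigma> \<in> absolute_galois \<Longrightarrow> T \<in> carrier (torsion M1 m) \<Longrightarrow> \<phi> (act1 \<sigma> T) = act2 \<sigma> (\<phi> T)"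
    and divisible1: "x \<in> carrier M1 \<Longrightarrow> \<exists>P\<in>carrier M1. P [^]\<^bsub>M1\<^esub> m = x"
    and divisible2: "y \<in> carrier M2 \<Longrightarrow> \<exists>Q\<in>carrier M2. Q [^]\<^bsub>M2\<^esub> m = y"
begin

sublocale T1: galois_module "torsion M1 m" act1 by (rule M1.galois_module_torsion)
sublocale T2: galois_module "torsion M2 m" act2 by (rule M2.galois_module_torsion)
sublocale phi: group_hom "torsion M1 m" "torsion M2 m" \<phi>
  using iso by unfold_locales (simp add: iso_def)
sublocale H: comm_group "H1 (torsion M2 m) act2" by (rule T2.comm_group_H1)
sublocale P: group "M1 \<times>\<times> M2" by (rule DirProd_group[OF M1.is_group M2.is_group])

lemma phi_closed [simp]:
  "T \<in> carrier M1 \<Longrightarrow> T [^]\<^bsub>M1\<^esub> m = \<one>\<^bsub>M1\<^esub> \<Longrightarrow> \<phi> T \<in> carrier M2"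
  "T \<in> carrier M1 \<Longrightarrow> T [^]\<^bsub>M1\<^esub> m = \<one>\<^bsub>M1\<^esub> \<Longrightarrow> \<phi> T [^]\<^bsub>M2\<^esub> m = \<one>\<^bsub>M2\<^esub>"
  using phi.hom_closed[of T] by simp_all

lemma phi_mult:
  "S \<in> carrier M1 \<Longrightarrow> S [^]\<^bsub>M1\<^esub> m = \<one>\<^bsub>M1\<^esub> \<Longrightarrow> T \<in> carrier M1 \<Longrightarrow> T [^]\<^bsub>M1\<^esub> m = \<one>\<^bsub>M1\<^esub> \<Longrightarrow>
     \<phi> (S \<otimes>\<^bsub>M1\<^esub> T) = \<phi> S \<otimes>\<^bsub>M2\<^esub> \<phi> T"
  using phi.hom_mult[of S T] by simp

lemma phi_one [simp]: "\<phi> \<one>\<^bsub>M1\<^esub> = \<one>\<^bsub>M2\<^esub>"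
  using phi.hom_one by simp

lemma phi_inv:
  "T \<in> carrier M1 \<Longrightarrow> T [^]\<^bsub>M1\<^esub> m = \<one>\<^bsub>M1\<^esub> \<Longrightarrow> \<phi> (inv\<^bsub>M1\<^esub> T) = inv\<^bsub>M2\<^esub> (\<phi> T)"
  using phi.hom_inv[of T] by simp

lemma phi_act:
  "\<sigma> \<in> absolute_galois \<Longrightarrow> T \<in> carrier M1 \<Longrightarrow> T [^]\<^bsub>M1\<^esub> m = \<one>\<^bsub>M1\<^esub> \<Longrightarrow> \<phi> (act1 \<sigma> T) = act2 \<sigma> (\<phi> T)"
  using equivariant by simp

lemma phi_surj:
  assumes "t \<in> carrier M2" "t [^]\<^bsub>M2\<^esub> m = \<one>\<^bsub>M2\<^esub>"
  obtains T where "T \<in> carrier M1" "T [^]\<^bsub>M1\<^esub> m = \<one>\<^bsub>M1\<^esub>" "t = \<phi> T"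
proof -
  have "t \<in> \<phi> ` carrier (torsion M1 m)" using iso assms by (simp add: iso_def bij_betw_def)
  then show ?thesis using that by auto
qed

lemma phi_inj:
  assumes "S \<in> carrier M1" "S [^]\<^bsub>M1\<^esub> m = \<one>\<^bsub>M1\<^esub>" "T \<in> carrier M1" "T [^]\<^bsub>M1\<^esub> m = \<one>\<^bsub>M1\<^esub>" "\<phi> S = \<phi> T"
  shows "S = T"
proof -
  have "inj_on \<phi> (carrier (torsion M1 m))" using iso by (simp add: iso_def bij_betw_def)
  then show ?thesis using assms by (simp add: inj_on_def)
qed

section \<open>The quotient by the antidiagonal and its invariants\<close>

definition Delta :: "('a \<times> 'b) set" where
  "Delta = (\<lambda>T. (T, inv\<^bsub>M2\<^esub> (\<phi> T))) ` carrier (torsion M1 m)"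

definition coset :: "'a \<Rightarrow> 'b \<Rightarrow> ('a \<times> 'b) set" where
  "coset P Q = Delta #>\<^bsub>M1 \<times>\<times> M2\<^esub> (P, Q)"

definition quot :: "('a \<times> 'b) set monoid" where
  "quot = (M1 \<times>\<times> M2) Mod Delta"

definition quot_invariants :: "('a \<times> 'b) set monoid" where
  "quot_invariants = quot\<lparr>carrier := {D \<in> carrier quot.
     \<forall>\<sigma>\<in>absolute_galois. map_prod (act1 \<sigma>) (act2 \<sigma>) ` D = D}\<rparr>"

definition push :: "('a \<times> 'b) set \<Rightarrow> 'a \<times> 'b" where
  "push D = the_elem ((\<lambda>R. R [^]\<^bsub>M1 \<times>\<times> M2\<^esub> m) ` D)"

definition mu_1 :: "'a \<Rightarrow> ('k, 'b) cochain set" where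
  "mu_1 x = H1_map (torsion M2 m) act2 \<phi> (connecting M1 M1 act1 (\<lambda>P. P [^]\<^bsub>M1\<^esub> m) x)"

definition mu_2 :: "'b \<Rightarrow> ('k, 'b) cochain set" where
  "mu_2 x = connecting M2 M2 act2 (\<lambda>P. P [^]\<^bsub>M2\<^esub> m) x"

lemma Delta_subgroup: "subgroup Delta (M1 \<times>\<times> M2)"
proof (rule P.subgroupI)
  show "Delta \<subseteq> carrier (M1 \<times>\<times> M2)" by (auto simp: Delta_def)
  show "Delta \<noteq> {}" using T1.one_closed by (auto simp: Delta_def)
  fix a assume "a \<in> Delta"
  then obtain S where S: "S \<in> carrier M1" "S [^]\<^bsub>M1\<^esub> m = \<one>\<^bsub>M1\<^esub>" "a = (S, inv\<^bsub>M2\<^esub> (\<phi> S))"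
    by (auto simp: Delta_def)
  have "inv\<^bsub>M1 \<times>\<times> M2\<^esub> a = (inv\<^bsub>M1\<^esub> S, inv\<^bsub>M2\<^esub> (\<phi> (inv\<^bsub>M1\<^esub> S)))"
    using S by (simp add: inv_DirProd[OF M1.is_group M2.is_group] phi_inv)
  then show "inv\<^bsub>M1 \<times>\<times> M2\<^esub> a \<in> Delta"
    using S by (auto simp: Delta_def M1.nat_pow_inv)
  fix b assume "b \<in> Delta"
  then obtain T where T: "T \<in> carrier M1" "T [^]\<^bsub>M1\<^esub> m = \<one>\<^bsub>M1\<^esub>" "b = (T, inv\<^bsub>M2\<^esub> (\<phi> T))"
    by (auto simp: Delta_def)
  have "a \<otimes>\<^bsub>M1 \<times>\<times> M2\<^esub> b = (S \<otimes>\<^bsub>M1\<^esub> T, inv\<^bsub>M2\<^esub> (\<phi> (S \<otimes>\<^bsub>M1\<^esub> T)))"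
    using S T by (simp add: phi_mult M2.inv_mult)
  then show "a \<otimes>\<^bsub>M1 \<times>\<times> M2\<^esub> b \<in> Delta"
    using S T by (auto simp: Delta_def M1.nat_pow_distrib)
qed

sublocale P: comm_group "M1 \<times>\<times> M2"
  by (rule P.group_comm_groupI) (auto simp: M1.m_comm M2.m_comm)

sublocale D: normal Delta "M1 \<times>\<times> M2"
  by (rule P.subgroup_imp_normal[OF Delta_subgroup])

lemma mem_coset_iff:
  "(P', Q') \<in> coset P Q \<longleftrightarrow>
     (\<exists>T\<in>carrier M1. T [^]\<^bsub>M1\<^esub> m = \<one>\<^bsub>M1\<^esub> \<and> P' = T \<otimes>\<^bsub>M1\<^esub> P \<and> Q' = inv\<^bsub>M2\<^esub> (\<phi> T) \<otimes>\<^bsub>M2\<^esub> Q)"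
  unfolding coset_def r_coset_def Delta_def by auto

lemma coset_eq_iff:
  assumes "P \<in> carrier M1" "Q \<in> carrier M2" "P' \<in> carrier M1" "Q' \<in> carrier M2"
  shows "coset P' Q' = coset P Q \<longleftrightarrow>
     (\<exists>T\<in>carrier M1. T [^]\<^bsub>M1\<^esub> m = \<one>\<^bsub>M1\<^esub> \<and> P' = T \<otimes>\<^bsub>M1\<^esub> P \<and> Q' = inv\<^bsub>M2\<^esub> (\<phi> T) \<otimes>\<^bsub>M2\<^esub> Q)"
proof -
  have "coset P' Q' = coset P Q \<longleftrightarrow> (P', Q') \<in> coset P Q"
  proof
    have "(P', Q') \<in> coset P' Q'" unfolding coset_def
      by (rule P.rcos_self[OF _ Delta_subgroup]) (simp add: assms)
    then show "(P', Q') \<in> coset P Q" if "coset P' Q' = coset P Q" using that by simp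
    show "coset P' Q' = coset P Q" if "(P', Q') \<in> coset P Q"
      using that unfolding coset_def
      by (rule P.repr_independence[OF _ _ Delta_subgroup, symmetric]) (simp add: assms)
  qed
  then show ?thesis unfolding mem_coset_iff .
qed

lemma carrier_quotE:
  assumes "D \<in> carrier quot"
  obtains P Q where "P \<in> carrier M1" "Q \<in> carrier M2" "D = coset P Q"
  using assms unfolding quot_def carrier_FactGroup coset_def by auto

lemma coset_in_quot [simp]: "P \<in> carrier M1 \<Longrightarrow> Q \<in> carrier M2 \<Longrightarrow> coset P Q \<in> carrier quot"
  unfolding quot_def carrier_FactGroup coset_def by auto

lemma coset_mult:
  assumes "P \<in> carrier M1" "Q \<in> carrier M2" "P' \<in> carrier M1" "Q' \<in> carrier M2"
  shows "coset P Q \<otimes>\<^bsub>quot\<^esub> coset P' Q' = coset (P \<otimes>\<^bsub>M1\<^esub> P') (Q \<otimes>\<^bsub>M2\<^esub> Q')"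
  unfolding quot_def coset_def mult_FactGroup using assms by (subst D.rcos_sum) auto

lemma coset_one: "coset \<one>\<^bsub>M1\<^esub> \<one>\<^bsub>M2\<^esub> = \<one>\<^bsub>quot\<^esub>"
  unfolding quot_def coset_def one_FactGroup using P.coset_mult_one[OF D.subset] by simp

lemma group_quot: "group quot"
  unfolding quot_def by (rule D.factorgroup_is_group)

lemma coset_inv:
  assumes "P \<in> carrier M1" "Q \<in> carrier M2"
  shows "inv\<^bsub>quot\<^esub> (coset P Q) = coset (inv\<^bsub>M1\<^esub> P) (inv\<^bsub>M2\<^esub> Q)"
proof (rule group.inv_equality[OF group_quot])
  show "coset (inv\<^bsub>M1\<^esub> P) (inv\<^bsub>M2\<^esub> Q) \<otimes>\<^bsub>quot\<^esub> coset P Q = \<one>\<^bsub>quot\<^esub>"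
    using assms by (simp add: coset_mult flip: coset_one)
qed (use assms in simp_all)

text \<open>Equivariance of \<phi> makes \<open>Delta\<close> stable under the Galois group, so the
  action descends to cosets.\<close>

lemma act_coset:
  assumes "P \<in> carrier M1" "Q \<in> carrier M2" "\<sigma> \<in> absolute_galois"
  shows "map_prod (act1 \<sigma>) (act2 \<sigma>) ` coset P Q = coset (act1 \<sigma> P) (act2 \<sigma> Q)"
proof
  show "map_prod (act1 \<sigma>) (act2 \<sigma>) ` coset P Q \<subseteq> coset (act1 \<sigma> P) (act2 \<sigma> Q)"
  proof clarify
    fix P' Q' assume "(P', Q') \<in> coset P Q"
    then obtain T where T: "T \<in> carrier M1" "T [^]\<^bsub>M1\<^esub> m = \<one>\<^bsub>M1\<^esub>"
      "P' = T \<otimes>\<^bsub>M1\<^esub> P" "Q' = inv\<^bsub>M2\<^esub> (\<phi> T) \<otimes>\<^bsub>M2\<^esub> Q" unfolding mem_coset_iff by blast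
    have "act1 \<sigma> P' = act1 \<sigma> T \<otimes>\<^bsub>M1\<^esub> act1 \<sigma> P"
      "act2 \<sigma> Q' = inv\<^bsub>M2\<^esub> (\<phi> (act1 \<sigma> T)) \<otimes>\<^bsub>M2\<^esub> act2 \<sigma> Q"
      using T assms by (simp_all add: M1.act_mult M2.act_mult M2.act_inv phi_act)
    moreover have "act1 \<sigma> T \<in> carrier M1" "act1 \<sigma> T [^]\<^bsub>M1\<^esub> m = \<one>\<^bsub>M1\<^esub>"
      using T assms by (simp_all flip: M1.act_pow)
    ultimately show "(act1 \<sigma> P', act2 \<sigma> Q') \<in> coset (act1 \<sigma> P) (act2 \<sigma> Q)"
      unfolding mem_coset_iff by blast
  qed
  show "coset (act1 \<sigma> P) (act2 \<sigma> Q) \<subseteq> map_prod (act1 \<sigma>) (act2 \<sigma>) ` coset P Q"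
  proof clarify
    fix P' Q' assume "(P', Q') \<in> coset (act1 \<sigma> P) (act2 \<sigma> Q)"
    then obtain T where T: "T \<in> carrier M1" "T [^]\<^bsub>M1\<^esub> m = \<one>\<^bsub>M1\<^esub>"
      "P' = T \<otimes>\<^bsub>M1\<^esub> act1 \<sigma> P" "Q' = inv\<^bsub>M2\<^esub> (\<phi> T) \<otimes>\<^bsub>M2\<^esub> act2 \<sigma> Q" unfolding mem_coset_iff by blast
    \<comment> \<open>The reverse inclusion needs a torsion element mapped to \<open>T\<close> by
      \<sigma>; the inverse automorphism supplies it.\<close>
    let ?i = "Hilbert_Choice.inv \<sigma>"
    have i: "?i \<in> absolute_galois" using absolute_galois_inv[OF assms(3)] .
    have "\<sigma> \<circ> ?i = id" using assms(3) by (auto simp: absolute_galois_def bij_is_surj surj_f_inv_f)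
    then have e: "act1 \<sigma> (act1 ?i T) = T"
      using M1.act_comp[OF assms(3) i T(1)] M1.act_id T(1) by simp
    define S where "S = act1 ?i T"
    have S: "S \<in> carrier M1" "S [^]\<^bsub>M1\<^esub> m = \<one>\<^bsub>M1\<^esub>" "act1 \<sigma> S = T"
      using T i e by (simp_all add: S_def flip: M1.act_pow)
    have "P' = act1 \<sigma> (S \<otimes>\<^bsub>M1\<^esub> P)" "Q' = act2 \<sigma> (inv\<^bsub>M2\<^esub> (\<phi> S) \<otimes>\<^bsub>M2\<^esub> Q)"
      using S T(3,4) assms by (simp_all add: M1.act_mult M2.act_mult M2.act_inv flip: phi_act)
    moreover have "(S \<otimes>\<^bsub>M1\<^esub> P, inv\<^bsub>M2\<^esub> (\<phi> S) \<otimes>\<^bsub>M2\<^esub> Q) \<in> coset P Q"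
      unfolding mem_coset_iff using S by blast
    ultimately show "(P', Q') \<in> map_prod (act1 \<sigma>) (act2 \<sigma>) ` coset P Q"
      by (intro image_eqI[where x = "(S \<otimes>\<^bsub>M1\<^esub> P, inv\<^bsub>M2\<^esub> (\<phi> S) \<otimes>\<^bsub>M2\<^esub> Q)"]) simp_all
  qed
qed

lemma coset_invariant_iff:
  assumes "P \<in> carrier M1" "Q \<in> carrier M2"
  shows "coset P Q \<in> carrier quot_invariants \<longleftrightarrow>
    (\<forall>\<sigma>\<in>absolute_galois. (act1 \<sigma> P \<otimes>\<^bsub>M1\<^esub> inv\<^bsub>M1\<^esub> P) [^]\<^bsub>M1\<^esub> m = \<one>\<^bsub>M1\<^esub> \<and>
       act2 \<sigma> Q \<otimes>\<^bsub>M2\<^esub> inv\<^bsub>M2\<^esub> Q = inv\<^bsub>M2\<^esub> (\<phi> (act1 \<sigma> P \<otimes>\<^bsub>M1\<^esub> inv\<^bsub>M1\<^esub> P)))"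
proof -
  have "coset P Q \<in> carrier quot_invariants \<longleftrightarrow>
     (\<forall>\<sigma>\<in>absolute_galois. coset (act1 \<sigma> P) (act2 \<sigma> Q) = coset P Q)"
    using assms by (simp add: quot_invariants_def act_coset)
  also have "\<dots> \<longleftrightarrow> (\<forall>\<sigma>\<in>absolute_galois. (act1 \<sigma> P \<otimes>\<^bsub>M1\<^esub> inv\<^bsub>M1\<^esub> P) [^]\<^bsub>M1\<^esub> m = \<one>\<^bsub>M1\<^esub> \<and>
       act2 \<sigma> Q \<otimes>\<^bsub>M2\<^esub> inv\<^bsub>M2\<^esub> Q = inv\<^bsub>M2\<^esub> (\<phi> (act1 \<sigma> P \<otimes>\<^bsub>M1\<^esub> inv\<^bsub>M1\<^esub> P)))"
  proof (rule ball_cong[OF refl])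
    fix \<sigma> assume s: "\<sigma> \<in> (absolute_galois :: ('k alg_closure \<Rightarrow> _) set)"
    let ?T = "act1 \<sigma> P \<otimes>\<^bsub>M1\<^esub> inv\<^bsub>M1\<^esub> P"
    have c: "act1 \<sigma> P \<in> carrier M1" "act2 \<sigma> Q \<in> carrier M2" using s assms by simp_all
    \<comment> \<open>The first component determines the torsion element, which must be
      \<open>?T\<close>; the existential in \<open>coset_eq_iff\<close> thus collapses to two
      conditions on \<open>?T\<close>.\<close>
    have 1: "act1 \<sigma> P = T \<otimes>\<^bsub>M1\<^esub> P \<longleftrightarrow> T = ?T" if "T \<in> carrier M1" for T
      using M1.inv_solve_right[OF that c(1) assms(1)] by auto
    have 2: "act2 \<sigma> Q = t \<otimes>\<^bsub>M2\<^esub> Q \<longleftrightarrow> act2 \<sigma> Q \<otimes>\<^bsub>M2\<^esub> inv\<^bsub>M2\<^esub> Q = t" if "t \<in> carrier M2" for t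
      using M2.inv_solve_right[OF that c(2) assms(2)] by auto
    have T: "?T \<in> carrier M1" using c assms by simp
    show "coset (act1 \<sigma> P) (act2 \<sigma> Q) = coset P Q \<longleftrightarrow> ?T [^]\<^bsub>M1\<^esub> m = \<one>\<^bsub>M1\<^esub> \<and>
       act2 \<sigma> Q \<otimes>\<^bsub>M2\<^esub> inv\<^bsub>M2\<^esub> Q = inv\<^bsub>M2\<^esub> (\<phi> ?T)"
      unfolding coset_eq_iff[OF assms c]
      using T by (auto simp only: 1 2 phi_closed M2.inv_closed)
  qed
  finally show ?thesis .
qed

lemma carrier_quot_invariantsE:
  assumes "D \<in> carrier quot_invariants"
  obtains P Q where "P \<in> carrier M1" "Q \<in> carrier M2" "D = coset P Q"
    "\<And>\<sigma>. \<sigma> \<in> absolute_galois \<Longrightarrow> (act1 \<sigma> P \<otimes>\<^bsub>M1\<^esub> inv\<^bsub>M1\<^esub> P) [^]\<^bsub>M1\<^esub> m = \<one>\<^bsub>M1\<^esub>"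
    "\<And>\<sigma>. \<sigma> \<in> absolute_galois \<Longrightarrow>
       act2 \<sigma> Q \<otimes>\<^bsub>M2\<^esub> inv\<^bsub>M2\<^esub> Q = inv\<^bsub>M2\<^esub> (\<phi> (act1 \<sigma> P \<otimes>\<^bsub>M1\<^esub> inv\<^bsub>M1\<^esub> P))"
proof -
  have "D \<in> carrier quot" using assms by (simp add: quot_invariants_def)
  then obtain P Q where PQ: "P \<in> carrier M1" "Q \<in> carrier M2" "D = coset P Q" by (rule carrier_quotE)
  then show ?thesis using assms that[OF PQ] by (simp add: coset_invariant_iff)
qed

lemma mult_quot_invariants: "D \<otimes>\<^bsub>quot_invariants\<^esub> D' = D \<otimes>\<^bsub>quot\<^esub> D'"
  by (simp add: quot_invariants_def)

lemma group_quot_invariants: "group quot_invariants"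
proof -
  have "subgroup (carrier quot_invariants) quot"
  proof (rule group.subgroupI[OF group_quot])
    show "carrier quot_invariants \<subseteq> carrier quot" by (auto simp: quot_invariants_def)
    have "coset \<one>\<^bsub>M1\<^esub> \<one>\<^bsub>M2\<^esub> \<in> carrier quot_invariants" by (simp add: coset_invariant_iff)
    then show "carrier quot_invariants \<noteq> {}" by blast
    fix D assume "D \<in> carrier quot_invariants"
    then obtain P Q where 1: "P \<in> carrier M1" "Q \<in> carrier M2" "D = coset P Q"
      "\<And>\<sigma>. \<sigma> \<in> absolute_galois \<Longrightarrow> (act1 \<sigma> P \<otimes>\<^bsub>M1\<^esub> inv\<^bsub>M1\<^esub> P) [^]\<^bsub>M1\<^esub> m = \<one>\<^bsub>M1\<^esub>"
      "\<And>\<sigma>. \<sigma> \<in> absolute_galois \<Longrightarrow>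
         act2 \<sigma> Q \<otimes>\<^bsub>M2\<^esub> inv\<^bsub>M2\<^esub> Q = inv\<^bsub>M2\<^esub> (\<phi> (act1 \<sigma> P \<otimes>\<^bsub>M1\<^esub> inv\<^bsub>M1\<^esub> P))"
      by (rule carrier_quot_invariantsE) blast
    show "inv\<^bsub>quot\<^esub> D \<in> carrier quot_invariants"
      unfolding 1(3) coset_inv[OF 1(1,2)] coset_invariant_iff[OF M1.inv_closed[OF 1(1)] M2.inv_closed[OF 1(2)]]
    proof (intro ballI)
      fix \<sigma> assume s: "\<sigma> \<in> (absolute_galois :: ('k alg_closure \<Rightarrow> _) set)"
      show "(act1 \<sigma> (inv\<^bsub>M1\<^esub> P) \<otimes>\<^bsub>M1\<^esub> inv\<^bsub>M1\<^esub> (inv\<^bsub>M1\<^esub> P)) [^]\<^bsub>M1\<^esub> m = \<one>\<^bsub>M1\<^esub> \<and>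
        act2 \<sigma> (inv\<^bsub>M2\<^esub> Q) \<otimes>\<^bsub>M2\<^esub> inv\<^bsub>M2\<^esub> (inv\<^bsub>M2\<^esub> Q) =
          inv\<^bsub>M2\<^esub> (\<phi> (act1 \<sigma> (inv\<^bsub>M1\<^esub> P) \<otimes>\<^bsub>M1\<^esub> inv\<^bsub>M1\<^esub> (inv\<^bsub>M1\<^esub> P)))"
        using M1.coboundary_inv[OF 1(1) s] M2.coboundary_inv[OF 1(2) s] 1(4,5)[OF s] 1(1,2) s
        by (simp add: M1.nat_pow_inv phi_inv)
    qed
    fix D' assume "D' \<in> carrier quot_invariants"
    then obtain P' Q' where 2: "P' \<in> carrier M1" "Q' \<in> carrier M2" "D' = coset P' Q'"
      "\<And>\<sigma>. \<sigma> \<in> absolute_galois \<Longrightarrow> (act1 \<sigma> P' \<otimes>\<^bsub>M1\<^esub> inv\<^bsub>M1\<^esub> P') [^]\<^bsub>M1\<^esub> m = \<one>\<^bsub>M1\<^esub>"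
      "\<And>\<sigma>. \<sigma> \<in> absolute_galois \<Longrightarrow>
         act2 \<sigma> Q' \<otimes>\<^bsub>M2\<^esub> inv\<^bsub>M2\<^esub> Q' = inv\<^bsub>M2\<^esub> (\<phi> (act1 \<sigma> P' \<otimes>\<^bsub>M1\<^esub> inv\<^bsub>M1\<^esub> P'))"
      by (rule carrier_quot_invariantsE) blast
    show "D \<otimes>\<^bsub>quot\<^esub> D' \<in> carrier quot_invariants"
      unfolding 1(3) 2(3) coset_mult[OF 1(1,2) 2(1,2)]
        coset_invariant_iff[OF M1.m_closed[OF 1(1) 2(1)] M2.m_closed[OF 1(2) 2(2)]]
    proof (intro ballI)
      fix \<sigma> assume s: "\<sigma> \<in> (absolute_galois :: ('k alg_closure \<Rightarrow> _) set)"
      show "(act1 \<sigma> (P \<otimes>\<^bsub>M1\<^esub> P') \<otimes>\<^bsub>M1\<^esub> inv\<^bsub>M1\<^esub> (P \<otimes>\<^bsub>M1\<^esub> P')) [^]\<^bsub>M1\<^esub> m = \<one>\<^bsub>M1\<^esub> \<and>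
        act2 \<sigma> (Q \<otimes>\<^bsub>M2\<^esub> Q') \<otimes>\<^bsub>M2\<^esub> inv\<^bsub>M2\<^esub> (Q \<otimes>\<^bsub>M2\<^esub> Q') =
          inv\<^bsub>M2\<^esub> (\<phi> (act1 \<sigma> (P \<otimes>\<^bsub>M1\<^esub> P') \<otimes>\<^bsub>M1\<^esub> inv\<^bsub>M1\<^esub> (P \<otimes>\<^bsub>M1\<^esub> P')))"
        using M1.coboundary_mult[OF 1(1) 2(1) s] M2.coboundary_mult[OF 1(2) 2(2) s]
          1(4,5)[OF s] 2(4,5)[OF s] 1(1,2) 2(1,2) s
        by (simp add: M1.nat_pow_distrib phi_mult M2.inv_mult)
    qed
  qed
  from group.subgroup_imp_group[OF group_quot this] show ?thesis
    by (simp add: quot_invariants_def)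
qed

text \<open>The \<open>m\<close>-th power kills \<open>Delta\<close>, so it is constant on a coset
  and \<open>the_elem\<close> is justified.\<close>

lemma push_coset:
  assumes "P \<in> carrier M1" "Q \<in> carrier M2"
  shows "push (coset P Q) = (P [^]\<^bsub>M1\<^esub> m, Q [^]\<^bsub>M2\<^esub> m)"
proof -
  have "(P', Q') [^]\<^bsub>M1 \<times>\<times> M2\<^esub> m = (P [^]\<^bsub>M1\<^esub> m, Q [^]\<^bsub>M2\<^esub> m)" if "(P', Q') \<in> coset P Q" for P' Q'
    using that assms unfolding mem_coset_iff
    by (auto simp: pow_DirProd M1.nat_pow_distrib M2.nat_pow_distrib M2.nat_pow_inv)
  moreover have "(P, Q) \<in> coset P Q" unfolding coset_def
    by (rule P.rcos_self[OF _ Delta_subgroup]) (simp add: assms)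
  ultimately have "(\<lambda>R. R [^]\<^bsub>M1 \<times>\<times> M2\<^esub> m) ` coset P Q = {(P [^]\<^bsub>M1\<^esub> m, Q [^]\<^bsub>M2\<^esub> m)}" by force
  then show ?thesis by (simp add: push_def)
qed

section \<open>Kummer maps on invariants\<close>

lemma pow_fixed_iff1:
  assumes "P \<in> carrier M1" "\<sigma> \<in> absolute_galois"
  shows "(act1 \<sigma> P \<otimes>\<^bsub>M1\<^esub> inv\<^bsub>M1\<^esub> P) [^]\<^bsub>M1\<^esub> m = \<one>\<^bsub>M1\<^esub> \<longleftrightarrow> act1 \<sigma> (P [^]\<^bsub>M1\<^esub> m) = P [^]\<^bsub>M1\<^esub> m"
  using assms M1.inv_solve_right[of "\<one>\<^bsub>M1\<^esub>" "act1 \<sigma> (P [^]\<^bsub>M1\<^esub> m)" "P [^]\<^bsub>M1\<^esub> m"]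
  by (auto simp add: M1.nat_pow_distrib M1.nat_pow_inv M1.act_pow)

lemma pow_fixed_iff2:
  assumes "P \<in> carrier M2" "\<sigma> \<in> absolute_galois"
  shows "(act2 \<sigma> P \<otimes>\<^bsub>M2\<^esub> inv\<^bsub>M2\<^esub> P) [^]\<^bsub>M2\<^esub> m = \<one>\<^bsub>M2\<^esub> \<longleftrightarrow> act2 \<sigma> (P [^]\<^bsub>M2\<^esub> m) = P [^]\<^bsub>M2\<^esub> m"
  using assms M2.inv_solve_right[of "\<one>\<^bsub>M2\<^esub>" "act2 \<sigma> (P [^]\<^bsub>M2\<^esub> m)" "P [^]\<^bsub>M2\<^esub> m"]
  by (auto simp add: M2.nat_pow_distrib M2.nat_pow_inv M2.act_pow)

text \<open>Any \<open>m\<close>-th root \<open>P\<close> of the argument may be used to compute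
  \<open>mu_1\<close>, in particular the first component of a representative of a class in the
  quotient.\<close>

lemma mu_1_pow:
  assumes P: "P \<in> carrier M1" "P [^]\<^bsub>M1\<^esub> m \<in> carrier M1.invariants"
  shows "(\<lambda>\<sigma>\<in>absolute_galois. \<phi> (act1 \<sigma> P \<otimes>\<^bsub>M1\<^esub> inv\<^bsub>M1\<^esub> P)) \<in> cocycles (torsion M2 m) act2"
    and "mu_1 (P [^]\<^bsub>M1\<^esub> m) = cohomology_class (torsion M2 m) act2
      (\<lambda>\<sigma>\<in>absolute_galois. \<phi> (act1 \<sigma> P \<otimes>\<^bsub>M1\<^esub> inv\<^bsub>M1\<^esub> P))"
proof -
  have fixed: "act1 \<sigma> (P [^]\<^bsub>M1\<^esub> m) = P [^]\<^bsub>M1\<^esub> m" if "\<sigma> \<in> absolute_galois" for \<sigma> using P(2) that by simp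
  have eq: "(\<lambda>\<sigma>\<in>absolute_galois. \<phi> (M1.coboundary P \<sigma>)) =
      (\<lambda>\<sigma>\<in>absolute_galois. \<phi> (act1 \<sigma> P \<otimes>\<^bsub>M1\<^esub> inv\<^bsub>M1\<^esub> P))" by (rule restrict_ext) simp
  note * = H1_map_class[OF M1.galois_module_torsion M2.galois_module_torsion phi.homh equivariant
      M1.kummer_cocycle[OF P(1) fixed], unfolded eq]
  show "(\<lambda>\<sigma>\<in>absolute_galois. \<phi> (act1 \<sigma> P \<otimes>\<^bsub>M1\<^esub> inv\<^bsub>M1\<^esub> P)) \<in> cocycles (torsion M2 m) act2"
    by (rule *(1))
  have "connecting M1 M1 act1 (\<lambda>P. P [^]\<^bsub>M1\<^esub> m) (P [^]\<^bsub>M1\<^esub> m) =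
      cohomology_class (torsion M1 m) act1 (M1.coboundary P)"
    by (rule M1.connecting_pow[OF P(1) fixed])
  then show "mu_1 (P [^]\<^bsub>M1\<^esub> m) = cohomology_class (torsion M2 m) act2
      (\<lambda>\<sigma>\<in>absolute_galois. \<phi> (act1 \<sigma> P \<otimes>\<^bsub>M1\<^esub> inv\<^bsub>M1\<^esub> P))"
    unfolding mu_1_def by (simp only:) (rule *(2))
qed

lemma mu_2_pow:
  assumes Q: "Q \<in> carrier M2" "Q [^]\<^bsub>M2\<^esub> m \<in> carrier M2.invariants"
  shows "M2.coboundary Q \<in> cocycles (torsion M2 m) act2"
    and "mu_2 (Q [^]\<^bsub>M2\<^esub> m) = cohomology_class (torsion M2 m) act2 (M2.coboundary Q)"
proof -
  have fixed: "act2 \<sigma> (Q [^]\<^bsub>M2\<^esub> m) = Q [^]\<^bsub>M2\<^esub> m" if "\<sigma> \<in> absolute_galois" for \<sigma> using Q(2) that by simp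
  show "M2.coboundary Q \<in> cocycles (torsion M2 m) act2" by (rule M2.kummer_cocycle[OF Q(1) fixed])
  show "mu_2 (Q [^]\<^bsub>M2\<^esub> m) = cohomology_class (torsion M2 m) act2 (M2.coboundary Q)"
    unfolding mu_2_def by (rule M2.connecting_pow[OF Q(1) fixed])
qed

lemma invariants_mult1:
  "x \<in> carrier M1.invariants \<Longrightarrow> y \<in> carrier M1.invariants \<Longrightarrow> x \<otimes>\<^bsub>M1\<^esub> y \<in> carrier M1.invariants"
  by (simp add: M1.act_mult)

lemma invariants_mult2:
  "x \<in> carrier M2.invariants \<Longrightarrow> y \<in> carrier M2.invariants \<Longrightarrow> x \<otimes>\<^bsub>M2\<^esub> y \<in> carrier M2.invariants"
  by (simp add: M2.act_mult)

text \<open>The product of roots of \<open>x\<close> and \<open>y\<close> is a root of their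
  product, and its cocycle is the pointwise product of the two cocycles.\<close>

lemma mu_1_hom: "mu_1 \<in> hom M1.invariants (H1 (torsion M2 m) act2)"
proof (rule homI)
  fix x assume x: "x \<in> carrier M1.invariants"
  then obtain P where P: "P \<in> carrier M1" "P [^]\<^bsub>M1\<^esub> m = x" using divisible1 by auto
  note P' = mu_1_pow[OF P(1), unfolded P(2), OF x]
  show "mu_1 x \<in> carrier (H1 (torsion M2 m) act2)"
    unfolding P'(2) by (rule T2.class_in_H1[OF P'(1)])
  fix y assume y: "y \<in> carrier M1.invariants"
  then obtain Q where Q: "Q \<in> carrier M1" "Q [^]\<^bsub>M1\<^esub> m = y" using divisible1 by auto
  note Q' = mu_1_pow[OF Q(1), unfolded Q(2), OF y]
  have "(P \<otimes>\<^bsub>M1\<^esub> Q) [^]\<^bsub>M1\<^esub> m = x \<otimes>\<^bsub>M1\<^esub> y" using P Q by (simp add: M1.nat_pow_distrib)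
  note PQ' = mu_1_pow[OF M1.m_closed[OF P(1) Q(1)], unfolded this, OF invariants_mult1[OF x y]]
  have "(\<lambda>\<sigma>\<in>absolute_galois. \<phi> (act1 \<sigma> (P \<otimes>\<^bsub>M1\<^esub> Q) \<otimes>\<^bsub>M1\<^esub> inv\<^bsub>M1\<^esub> (P \<otimes>\<^bsub>M1\<^esub> Q))) =
      (\<lambda>\<sigma>\<in>absolute_galois. (\<lambda>\<sigma>\<in>absolute_galois. \<phi> (act1 \<sigma> P \<otimes>\<^bsub>M1\<^esub> inv\<^bsub>M1\<^esub> P)) \<sigma> \<otimes>\<^bsub>torsion M2 m\<^esub>
         (\<lambda>\<sigma>\<in>absolute_galois. \<phi> (act1 \<sigma> Q \<otimes>\<^bsub>M1\<^esub> inv\<^bsub>M1\<^esub> Q)) \<sigma>)"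
  proof (rule restrict_ext)
    fix \<sigma> assume s: "\<sigma> \<in> (absolute_galois :: ('k alg_closure \<Rightarrow> _) set)"
    have "(act1 \<sigma> P \<otimes>\<^bsub>M1\<^esub> inv\<^bsub>M1\<^esub> P) [^]\<^bsub>M1\<^esub> m = \<one>\<^bsub>M1\<^esub>" "(act1 \<sigma> Q \<otimes>\<^bsub>M1\<^esub> inv\<^bsub>M1\<^esub> Q) [^]\<^bsub>M1\<^esub> m = \<one>\<^bsub>M1\<^esub>"
      using x y P Q s by (simp_all add: pow_fixed_iff1)
    then show "\<phi> (act1 \<sigma> (P \<otimes>\<^bsub>M1\<^esub> Q) \<otimes>\<^bsub>M1\<^esub> inv\<^bsub>M1\<^esub> (P \<otimes>\<^bsub>M1\<^esub> Q)) =
       (\<lambda>\<sigma>\<in>absolute_galois. \<phi> (act1 \<sigma> P \<otimes>\<^bsub>M1\<^esub> inv\<^bsub>M1\<^esub> P)) \<sigma> \<otimes>\<^bsub>torsion M2 m\<^esub>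
         (\<lambda>\<sigma>\<in>absolute_galois. \<phi> (act1 \<sigma> Q \<otimes>\<^bsub>M1\<^esub> inv\<^bsub>M1\<^esub> Q)) \<sigma>"
      using M1.coboundary_mult[OF P(1) Q(1) s] P(1) Q(1) s by (simp add: phi_mult)
  qed
  then show "mu_1 (x \<otimes>\<^bsub>M1.invariants\<^esub> y) = mu_1 x \<otimes>\<^bsub>H1 (torsion M2 m) act2\<^esub> mu_1 y"
    unfolding M1.invariants_sel(2) PQ'(2) P'(2) Q'(2) T2.class_mult[OF P'(1) Q'(1)] by (rule arg_cong)
qed

lemma mu_2_hom: "mu_2 \<in> hom M2.invariants (H1 (torsion M2 m) act2)"
proof (rule homI)
  fix x assume x: "x \<in> carrier M2.invariants"
  then obtain P where P: "P \<in> carrier M2" "P [^]\<^bsub>M2\<^esub> m = x" using divisible2 by auto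
  note P' = mu_2_pow[OF P(1), unfolded P(2), OF x]
  show "mu_2 x \<in> carrier (H1 (torsion M2 m) act2)"
    unfolding P'(2) by (rule T2.class_in_H1[OF P'(1)])
  fix y assume y: "y \<in> carrier M2.invariants"
  then obtain Q where Q: "Q \<in> carrier M2" "Q [^]\<^bsub>M2\<^esub> m = y" using divisible2 by auto
  note Q' = mu_2_pow[OF Q(1), unfolded Q(2), OF y]
  have "(P \<otimes>\<^bsub>M2\<^esub> Q) [^]\<^bsub>M2\<^esub> m = x \<otimes>\<^bsub>M2\<^esub> y" using P Q by (simp add: M2.nat_pow_distrib)
  note PQ' = mu_2_pow[OF M2.m_closed[OF P(1) Q(1)], unfolded this, OF invariants_mult2[OF x y]]
  have "M2.coboundary (P \<otimes>\<^bsub>M2\<^esub> Q) =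
      (\<lambda>\<sigma>\<in>absolute_galois. M2.coboundary P \<sigma> \<otimes>\<^bsub>torsion M2 m\<^esub> M2.coboundary Q \<sigma>)"
    using M2.coboundary_mult[OF P(1) Q(1)] by (intro restrict_ext) simp
  then show "mu_2 (x \<otimes>\<^bsub>M2.invariants\<^esub> y) = mu_2 x \<otimes>\<^bsub>H1 (torsion M2 m) act2\<^esub> mu_2 y"
    unfolding M2.invariants_sel(2) PQ'(2) P'(2) Q'(2) T2.class_mult[OF P'(1) Q'(1)] by (rule arg_cong)
qed

lemma push_invariant:
  assumes "P \<in> carrier M1" "Q \<in> carrier M2" "coset P Q \<in> carrier quot_invariants"
  shows "P [^]\<^bsub>M1\<^esub> m \<in> carrier M1.invariants" "Q [^]\<^bsub>M2\<^esub> m \<in> carrier M2.invariants"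
proof -
  note inv = assms(3)[unfolded coset_invariant_iff[OF assms(1,2)]]
  show "P [^]\<^bsub>M1\<^esub> m \<in> carrier M1.invariants" using inv assms(1) by (simp add: pow_fixed_iff1)
  have "act2 \<sigma> (Q [^]\<^bsub>M2\<^esub> m) = Q [^]\<^bsub>M2\<^esub> m" if s: "\<sigma> \<in> absolute_galois" for \<sigma>
    unfolding pow_fixed_iff2[OF assms(2) s, symmetric]
    using inv s assms(1,2) by (simp add: M2.nat_pow_inv)
  then show "Q [^]\<^bsub>M2\<^esub> m \<in> carrier M2.invariants" using assms(2) by simp
qed

lemma mu_1_push_eq_inv_mu_2_push:
  assumes "D \<in> carrier quot_invariants"
  shows "mu_1 (fst (push D)) = inv\<^bsub>H1 (torsion M2 m) act2\<^esub> (mu_2 (snd (push D)))"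
proof -
  obtain P Q where 1: "P \<in> carrier M1" "Q \<in> carrier M2" "D = coset P Q"
      "\<And>\<sigma>. \<sigma> \<in> absolute_galois \<Longrightarrow> (act1 \<sigma> P \<otimes>\<^bsub>M1\<^esub> inv\<^bsub>M1\<^esub> P) [^]\<^bsub>M1\<^esub> m = \<one>\<^bsub>M1\<^esub>"
      "\<And>\<sigma>. \<sigma> \<in> absolute_galois \<Longrightarrow>
         act2 \<sigma> Q \<otimes>\<^bsub>M2\<^esub> inv\<^bsub>M2\<^esub> Q = inv\<^bsub>M2\<^esub> (\<phi> (act1 \<sigma> P \<otimes>\<^bsub>M1\<^esub> inv\<^bsub>M1\<^esub> P))"
    using assms by (rule carrier_quot_invariantsE) blast
  note fixed = push_invariant[OF 1(1,2) assms[unfolded 1(3)]]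
  have "(\<lambda>\<sigma>\<in>absolute_galois. \<phi> (act1 \<sigma> P \<otimes>\<^bsub>M1\<^esub> inv\<^bsub>M1\<^esub> P)) =
      (\<lambda>\<sigma>\<in>absolute_galois. inv\<^bsub>torsion M2 m\<^esub> (M2.coboundary Q \<sigma>))"
    using 1 by (intro restrict_ext) (simp add: M2.nat_pow_inv)
  then show ?thesis
    unfolding 1(3) push_coset[OF 1(1,2)] fst_conv snd_conv mu_1_pow(2)[OF 1(1) fixed(1)]
      mu_2_pow(2)[OF 1(2) fixed(2)] T2.class_inv[OF mu_2_pow(1)[OF 1(2) fixed(2)]]
    by (rule arg_cong)
qed

section \<open>The maps of the two sequences as homomorphisms\<close>

lemma coset_pull:
  assumes "P \<in> carrier M1" "Q \<in> carrier M2"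
  shows "coset P \<one>\<^bsub>M2\<^esub> \<otimes>\<^bsub>quot\<^esub> coset \<one>\<^bsub>M1\<^esub> Q = coset P Q"
  using assms by (simp add: coset_mult)

lemma group_invariants_prod: "group (M1.invariants \<times>\<times> M2.invariants)"
  by (rule DirProd_group[OF M1.group_invariants M2.group_invariants])

lemma pull_group_hom:
  "group_hom (M1.invariants \<times>\<times> M2.invariants) quot_invariants
     (\<lambda>(P, Q). coset P \<one>\<^bsub>M2\<^esub> \<otimes>\<^bsub>quot\<^esub> coset \<one>\<^bsub>M1\<^esub> Q)"
proof (intro group_hom.intro group_hom_axioms.intro group_invariants_prod group_quot_invariants homI)
  fix x assume "x \<in> carrier (M1.invariants \<times>\<times> M2.invariants)"
  then obtain P Q where x: "x = (P, Q)" "P \<in> carrier M1" "Q \<in> carrier M2"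
     "\<And>\<sigma>. \<sigma> \<in> absolute_galois \<Longrightarrow> act1 \<sigma> P = P" "\<And>\<sigma>. \<sigma> \<in> absolute_galois \<Longrightarrow> act2 \<sigma> Q = Q" by auto
  then show "(case x of (P, Q) \<Rightarrow> coset P \<one>\<^bsub>M2\<^esub> \<otimes>\<^bsub>quot\<^esub> coset \<one>\<^bsub>M1\<^esub> Q) \<in> carrier quot_invariants"
    by (simp add: coset_pull coset_invariant_iff)
  fix y assume "y \<in> carrier (M1.invariants \<times>\<times> M2.invariants)"
  then obtain P' Q' where y: "y = (P', Q')" "P' \<in> carrier M1" "Q' \<in> carrier M2" by auto
  show "(case x \<otimes>\<^bsub>M1.invariants \<times>\<times> M2.invariants\<^esub> y of (P, Q) \<Rightarrow> coset P \<one>\<^bsub>M2\<^esub> \<otimes>\<^bsub>quot\<^esub> coset \<one>\<^bsub>M1\<^esub> Q) =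
      (case x of (P, Q) \<Rightarrow> coset P \<one>\<^bsub>M2\<^esub> \<otimes>\<^bsub>quot\<^esub> coset \<one>\<^bsub>M1\<^esub> Q) \<otimes>\<^bsub>quot_invariants\<^esub>
      (case y of (P, Q) \<Rightarrow> coset P \<one>\<^bsub>M2\<^esub> \<otimes>\<^bsub>quot\<^esub> coset \<one>\<^bsub>M1\<^esub> Q)"
    using x(1-3) y by (simp add: coset_pull mult_quot_invariants coset_mult)
qed

lemma push_group_hom:
  "group_hom quot_invariants (M1.invariants \<times>\<times> M2.invariants) (\<lambda>D. (fst (push D), snd (push D)))"
proof (intro group_hom.intro group_hom_axioms.intro group_invariants_prod group_quot_invariants homI)
  fix D assume D: "D \<in> carrier quot_invariants"
  then obtain P Q where 1: "P \<in> carrier M1" "Q \<in> carrier M2" "D = coset P Q"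
    by (rule carrier_quot_invariantsE) blast
  show "(fst (push D), snd (push D)) \<in> carrier (M1.invariants \<times>\<times> M2.invariants)"
    using push_invariant[OF 1(1,2)] D unfolding 1(3) push_coset[OF 1(1,2)] carrier_DirProd by simp
  fix D' assume "D' \<in> carrier quot_invariants"
  then obtain P' Q' where 2: "P' \<in> carrier M1" "Q' \<in> carrier M2" "D' = coset P' Q'"
    by (rule carrier_quot_invariantsE) blast
  show "(fst (push (D \<otimes>\<^bsub>quot_invariants\<^esub> D')), snd (push (D \<otimes>\<^bsub>quot_invariants\<^esub> D'))) =
     (fst (push D), snd (push D)) \<otimes>\<^bsub>M1.invariants \<times>\<times> M2.invariants\<^esub> (fst (push D'), snd (push D'))"
    using 1(1,2) 2(1,2) unfolding 1(3) 2(3) mult_quot_invariants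
    by (simp add: coset_mult push_coset M1.nat_pow_distrib M2.nat_pow_distrib)
qed

lemma mu_1_push_group_hom:
  "group_hom quot_invariants (H1 (torsion M2 m) act2) (\<lambda>D. mu_1 (fst (push D)))"
proof (intro group_hom.intro group_hom_axioms.intro group_quot_invariants H.is_group)
  have "(\<lambda>D. fst (push D)) \<in> hom quot_invariants M1.invariants"
    using group_hom.homh[OF push_group_hom, unfolded hom_paired] by blast
  from hom_compose[OF this mu_1_hom] show "(\<lambda>D. mu_1 (fst (push D))) \<in> hom quot_invariants (H1 (torsion M2 m) act2)"
    by (simp add: comp_def)
qed

lemma mu_sum_group_hom:
  "group_hom (M1.invariants \<times>\<times> M2.invariants) (H1 (torsion M2 m) act2)
     (\<lambda>(x, y). mu_1 x \<otimes>\<^bsub>H1 (torsion M2 m) act2\<^esub> mu_2 y)"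
proof (intro group_hom.intro group_hom_axioms.intro group_invariants_prod H.is_group homI)
  note c1 = hom_in_carrier[OF mu_1_hom] and c2 = hom_in_carrier[OF mu_2_hom]
  fix p assume "p \<in> carrier (M1.invariants \<times>\<times> M2.invariants)"
  then obtain x y where p: "p = (x, y)" "x \<in> carrier M1.invariants" "y \<in> carrier M2.invariants"
    unfolding carrier_DirProd by blast
  show "(case p of (x, y) \<Rightarrow> mu_1 x \<otimes>\<^bsub>H1 (torsion M2 m) act2\<^esub> mu_2 y) \<in> carrier (H1 (torsion M2 m) act2)"
    unfolding p(1) using c1[OF p(2)] c2[OF p(3)] by simp
  fix q assume "q \<in> carrier (M1.invariants \<times>\<times> M2.invariants)"
  then obtain x' y' where q: "q = (x', y')" "x' \<in> carrier M1.invariants" "y' \<in> carrier M2.invariants"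
    unfolding carrier_DirProd by blast
  show "(case p \<otimes>\<^bsub>M1.invariants \<times>\<times> M2.invariants\<^esub> q of (x, y) \<Rightarrow> mu_1 x \<otimes>\<^bsub>H1 (torsion M2 m) act2\<^esub> mu_2 y) =
     (case p of (x, y) \<Rightarrow> mu_1 x \<otimes>\<^bsub>H1 (torsion M2 m) act2\<^esub> mu_2 y) \<otimes>\<^bsub>H1 (torsion M2 m) act2\<^esub>
     (case q of (x, y) \<Rightarrow> mu_1 x \<otimes>\<^bsub>H1 (torsion M2 m) act2\<^esub> mu_2 y)"
    unfolding p(1) q(1) mult_DirProd case_prod_conv
      hom_mult[OF mu_1_hom p(2) q(2)] hom_mult[OF mu_2_hom p(3) q(3)]
    using c1[OF p(2)] c2[OF p(3)] c1[OF q(2)] c2[OF q(3)] by (simp add: H.m_ac)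
qed

section \<open>Exactness at the quotient and at the product\<close>

theorem exact_pull:
  "exact_at_middle (M1.invariants \<times>\<times> M2.invariants)
     (\<lambda>(P, Q). coset P \<one>\<^bsub>M2\<^esub> \<otimes>\<^bsub>quot\<^esub> coset \<one>\<^bsub>M1\<^esub> Q)
     quot_invariants (\<lambda>D. mu_1 (fst (push D))) (H1 (torsion M2 m) act2)"
  unfolding exact_at_middle_def
proof (intro conjI pull_group_hom mu_1_push_group_hom equalityI subsetI)
  let ?f = "\<lambda>(P, Q). coset P \<one>\<^bsub>M2\<^esub> \<otimes>\<^bsub>quot\<^esub> coset \<one>\<^bsub>M1\<^esub> Q"
  fix D assume "D \<in> kernel quot_invariants (H1 (torsion M2 m) act2) (\<lambda>D. mu_1 (fst (push D)))"
  then have D: "D \<in> carrier quot_invariants" "mu_1 (fst (push D)) = \<one>\<^bsub>H1 (torsion M2 m) act2\<^esub>"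
    by (auto simp: kernel_def)
  obtain P Q where 1: "P \<in> carrier M1" "Q \<in> carrier M2" "D = coset P Q"
      "\<And>\<sigma>. \<sigma> \<in> absolute_galois \<Longrightarrow> (act1 \<sigma> P \<otimes>\<^bsub>M1\<^esub> inv\<^bsub>M1\<^esub> P) [^]\<^bsub>M1\<^esub> m = \<one>\<^bsub>M1\<^esub>"
      "\<And>\<sigma>. \<sigma> \<in> absolute_galois \<Longrightarrow>
         act2 \<sigma> Q \<otimes>\<^bsub>M2\<^esub> inv\<^bsub>M2\<^esub> Q = inv\<^bsub>M2\<^esub> (\<phi> (act1 \<sigma> P \<otimes>\<^bsub>M1\<^esub> inv\<^bsub>M1\<^esub> P))"
    using D(1) by (rule carrier_quot_invariantsE) blast
  note fixed = push_invariant[OF 1(1,2) D(1)[unfolded 1(3)]]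
  note mu = mu_1_pow[OF 1(1) fixed(1)]
  have "\<exists>t\<in>carrier (torsion M2 m). \<forall>\<sigma>\<in>absolute_galois.
      (\<lambda>\<sigma>\<in>absolute_galois. \<phi> (act1 \<sigma> P \<otimes>\<^bsub>M1\<^esub> inv\<^bsub>M1\<^esub> P)) \<sigma> = act2 \<sigma> t \<otimes>\<^bsub>torsion M2 m\<^esub> inv\<^bsub>torsion M2 m\<^esub> t"
    using D(2) unfolding 1(3) push_coset[OF 1(1,2)] fst_conv mu(2) T2.class_one_iff[OF mu(1)] .
  then obtain t where t: "t \<in> carrier M2" "t [^]\<^bsub>M2\<^esub> m = \<one>\<^bsub>M2\<^esub>"
    "\<And>\<sigma>. \<sigma> \<in> absolute_galois \<Longrightarrow> \<phi> (act1 \<sigma> P \<otimes>\<^bsub>M1\<^esub> inv\<^bsub>M1\<^esub> P) = act2 \<sigma> t \<otimes>\<^bsub>M2\<^esub> inv\<^bsub>M2\<^esub> t" by auto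
  obtain T where T: "T \<in> carrier M1" "T [^]\<^bsub>M1\<^esub> m = \<one>\<^bsub>M1\<^esub>" "t = \<phi> T" using phi_surj[OF t(1,2)] .
  \<comment> \<open>The coboundary relation holds in \<open>M2\<close>; injectivity of \<phi> on
    torsion carries it back to \<open>M1\<close>, where it makes P - T invariant.\<close>
  have dT: "act1 \<sigma> P \<otimes>\<^bsub>M1\<^esub> inv\<^bsub>M1\<^esub> P = act1 \<sigma> T \<otimes>\<^bsub>M1\<^esub> inv\<^bsub>M1\<^esub> T" if s: "\<sigma> \<in> absolute_galois" for \<sigma>
  proof (rule phi_inj)
    have sT: "act1 \<sigma> T \<in> carrier M1" "act1 \<sigma> T [^]\<^bsub>M1\<^esub> m = \<one>\<^bsub>M1\<^esub>" using T s by (simp_all flip: M1.act_pow)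
    have iT: "inv\<^bsub>M1\<^esub> T \<in> carrier M1" "inv\<^bsub>M1\<^esub> T [^]\<^bsub>M1\<^esub> m = \<one>\<^bsub>M1\<^esub>" using T by (simp_all add: M1.nat_pow_inv)
    show "(act1 \<sigma> T \<otimes>\<^bsub>M1\<^esub> inv\<^bsub>M1\<^esub> T) [^]\<^bsub>M1\<^esub> m = \<one>\<^bsub>M1\<^esub>" using sT iT by (simp add: M1.nat_pow_distrib)
    show "\<phi> (act1 \<sigma> P \<otimes>\<^bsub>M1\<^esub> inv\<^bsub>M1\<^esub> P) = \<phi> (act1 \<sigma> T \<otimes>\<^bsub>M1\<^esub> inv\<^bsub>M1\<^esub> T)"
      unfolding t(3)[OF s] T(3) phi_mult[OF sT iT] phi_inv[OF T(1,2)] phi_act[OF s T(1,2)] ..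
  qed (use 1 T s in simp_all)
  have P': "act1 \<sigma> (P \<otimes>\<^bsub>M1\<^esub> inv\<^bsub>M1\<^esub> T) = P \<otimes>\<^bsub>M1\<^esub> inv\<^bsub>M1\<^esub> T" if s: "\<sigma> \<in> absolute_galois" for \<sigma>
  proof -
    have "M1.coboundary (P \<otimes>\<^bsub>M1\<^esub> inv\<^bsub>M1\<^esub> T) \<sigma> = \<one>\<^bsub>M1\<^esub>"
      unfolding M1.coboundary_mult[OF 1(1) M1.inv_closed[OF T(1)] s] M1.coboundary_inv[OF T(1) s]
      using dT[OF s] s T(1) by simp
    then show ?thesis using s 1(1) T(1) by (simp add: M1.coboundary_eq_one_iff)
  qed
  have Q': "act2 \<sigma> (Q \<otimes>\<^bsub>M2\<^esub> t) = Q \<otimes>\<^bsub>M2\<^esub> t" if s: "\<sigma> \<in> absolute_galois" for \<sigma>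
  proof -
    have "M2.coboundary (Q \<otimes>\<^bsub>M2\<^esub> t) \<sigma> = \<one>\<^bsub>M2\<^esub>"
      unfolding M2.coboundary_mult[OF 1(2) t(1) s]
      using 1(5)[OF s] t(1) t(3)[OF s] s by simp
    then show ?thesis using s 1(2) t(1) by (simp add: M2.coboundary_eq_one_iff)
  qed
  \<comment> \<open>The two representatives differ by the element of \<open>Delta\<close> belonging
    to \<open>T\<close>, so \<open>T\<close> itself is the witness.\<close>
  have "coset P Q = coset (P \<otimes>\<^bsub>M1\<^esub> inv\<^bsub>M1\<^esub> T) (Q \<otimes>\<^bsub>M2\<^esub> t)"
    unfolding coset_eq_iff[OF M1.m_closed[OF 1(1) M1.inv_closed[OF T(1)]] M2.m_closed[OF 1(2) t(1)] 1(1,2)]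
  proof (intro bexI[OF _ T(1)] conjI T(2))
    show "P = T \<otimes>\<^bsub>M1\<^esub> (P \<otimes>\<^bsub>M1\<^esub> inv\<^bsub>M1\<^esub> T)" using 1(1) T(1) by (simp add: M1.m_lcomm)
    show "Q = inv\<^bsub>M2\<^esub> (\<phi> T) \<otimes>\<^bsub>M2\<^esub> (Q \<otimes>\<^bsub>M2\<^esub> t)" using 1(2) t(1) T(3) by (simp add: M2.m_lcomm)
  qed
  then have "D = ?f (P \<otimes>\<^bsub>M1\<^esub> inv\<^bsub>M1\<^esub> T, Q \<otimes>\<^bsub>M2\<^esub> t)"
    unfolding 1(3) using 1(1,2) t(1) T(1) by (simp add: coset_pull)
  moreover have "(P \<otimes>\<^bsub>M1\<^esub> inv\<^bsub>M1\<^esub> T, Q \<otimes>\<^bsub>M2\<^esub> t) \<in> carrier (M1.invariants \<times>\<times> M2.invariants)"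
    using P' Q' 1(1,2) t(1) T(1) by simp
  ultimately show "D \<in> ?f ` carrier (M1.invariants \<times>\<times> M2.invariants)" by (rule image_eqI)
next
  let ?f = "\<lambda>(P, Q). coset P \<one>\<^bsub>M2\<^esub> \<otimes>\<^bsub>quot\<^esub> coset \<one>\<^bsub>M1\<^esub> Q"
  fix D assume "D \<in> ?f ` carrier (M1.invariants \<times>\<times> M2.invariants)"
  then obtain x where x: "x \<in> carrier (M1.invariants \<times>\<times> M2.invariants)" "D = ?f x" by blast
  then have D: "D \<in> carrier quot_invariants" using group_hom.hom_closed[OF pull_group_hom] by blast
  obtain P Q where PQ: "x = (P, Q)" "P \<in> carrier M1" "Q \<in> carrier M2"
     "\<And>\<sigma>. \<sigma> \<in> absolute_galois \<Longrightarrow> act1 \<sigma> P = P" using x(1) by auto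
  have eq: "D = coset P Q" unfolding x(2) PQ(1) using PQ(2,3) by (simp add: coset_pull)
  note fixed = push_invariant[OF PQ(2,3) D[unfolded eq]]
  note mu = mu_1_pow[OF PQ(2) fixed(1)]
  \<comment> \<open>For invariant P the Kummer cocycle is constantly \<phi> of the unit, so the unit
    serves as the required torsion element.\<close>
  have "mu_1 (fst (push D)) = \<one>\<^bsub>H1 (torsion M2 m) act2\<^esub>"
    unfolding eq push_coset[OF PQ(2,3)] fst_conv mu(2) T2.class_one_iff[OF mu(1)]
    using PQ by (intro bexI[OF _ T2.one_closed]) simp
  then show "D \<in> kernel quot_invariants (H1 (torsion M2 m) act2) (\<lambda>D. mu_1 (fst (push D)))"
    using D by (simp add: kernel_def)
qed

theorem exact_push:
  "exact_at_middle quot_invariants (\<lambda>D. (fst (push D), snd (push D)))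
     (M1.invariants \<times>\<times> M2.invariants) (\<lambda>(x, y). mu_1 x \<otimes>\<^bsub>H1 (torsion M2 m) act2\<^esub> mu_2 y)
     (H1 (torsion M2 m) act2)"
  unfolding exact_at_middle_def
proof (intro conjI push_group_hom mu_sum_group_hom equalityI subsetI)
  let ?g = "\<lambda>(x, y). mu_1 x \<otimes>\<^bsub>H1 (torsion M2 m) act2\<^esub> mu_2 y"
  let ?f = "\<lambda>D. (fst (push D), snd (push D))"
  fix p assume "p \<in> kernel (M1.invariants \<times>\<times> M2.invariants) (H1 (torsion M2 m) act2) ?g"
  then obtain x y where p: "p = (x, y)" "x \<in> carrier M1.invariants" "y \<in> carrier M2.invariants"
    and one: "mu_1 x \<otimes>\<^bsub>H1 (torsion M2 m) act2\<^esub> mu_2 y = \<one>\<^bsub>H1 (torsion M2 m) act2\<^esub>"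
    unfolding kernel_def carrier_DirProd by blast
  obtain P where P: "P \<in> carrier M1" "P [^]\<^bsub>M1\<^esub> m = x" using divisible1 p(2) by auto
  obtain Q where Q: "Q \<in> carrier M2" "Q [^]\<^bsub>M2\<^esub> m = y" using divisible2 p(3) by auto
  note mu1 = mu_1_pow[OF P(1), unfolded P(2), OF p(2)]
  note mu2 = mu_2_pow[OF Q(1), unfolded Q(2), OF p(3)]
  have "\<exists>t\<in>carrier (torsion M2 m). \<forall>\<sigma>\<in>absolute_galois.
      (\<lambda>\<sigma>\<in>absolute_galois. (\<lambda>\<sigma>\<in>absolute_galois. \<phi> (act1 \<sigma> P \<otimes>\<^bsub>M1\<^esub> inv\<^bsub>M1\<^esub> P)) \<sigma> \<otimes>\<^bsub>torsion M2 m\<^esub>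
         M2.coboundary Q \<sigma>) \<sigma> = act2 \<sigma> t \<otimes>\<^bsub>torsion M2 m\<^esub> inv\<^bsub>torsion M2 m\<^esub> t"
    using one unfolding mu1(2) mu2(2) T2.class_mult[OF mu1(1) mu2(1)]
      T2.class_one_iff[OF T2.cocycle_mult[OF mu1(1) mu2(1)]] .
  then obtain t where t: "t \<in> carrier M2" "t [^]\<^bsub>M2\<^esub> m = \<one>\<^bsub>M2\<^esub>"
    "\<And>\<sigma>. \<sigma> \<in> absolute_galois \<Longrightarrow> \<phi> (act1 \<sigma> P \<otimes>\<^bsub>M1\<^esub> inv\<^bsub>M1\<^esub> P) \<otimes>\<^bsub>M2\<^esub>
        (act2 \<sigma> Q \<otimes>\<^bsub>M2\<^esub> inv\<^bsub>M2\<^esub> Q) = act2 \<sigma> t \<otimes>\<^bsub>M2\<^esub> inv\<^bsub>M2\<^esub> t" by auto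
  let ?Q = "Q \<otimes>\<^bsub>M2\<^esub> inv\<^bsub>M2\<^esub> t"
  have Q': "?Q \<in> carrier M2" using Q t by simp
  have "coset P ?Q \<in> carrier quot_invariants"
    unfolding coset_invariant_iff[OF P(1) Q']
  proof (intro ballI conjI)
    fix \<sigma> assume s: "\<sigma> \<in> (absolute_galois :: ('k alg_closure \<Rightarrow> _) set)"
    show 1: "(act1 \<sigma> P \<otimes>\<^bsub>M1\<^esub> inv\<^bsub>M1\<^esub> P) [^]\<^bsub>M1\<^esub> m = \<one>\<^bsub>M1\<^esub>"
      using p(2) P s by (simp add: pow_fixed_iff1)
    let ?a = "\<phi> (act1 \<sigma> P \<otimes>\<^bsub>M1\<^esub> inv\<^bsub>M1\<^esub> P)" and ?b = "act2 \<sigma> Q \<otimes>\<^bsub>M2\<^esub> inv\<^bsub>M2\<^esub> Q"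
    have a: "?a \<in> carrier M2" and b: "?b \<in> carrier M2" using 1 P(1) Q(1) s by simp_all
    have "act2 \<sigma> ?Q \<otimes>\<^bsub>M2\<^esub> inv\<^bsub>M2\<^esub> ?Q = M2.coboundary ?Q \<sigma>" using s by simp
    also have "\<dots> = ?b \<otimes>\<^bsub>M2\<^esub> inv\<^bsub>M2\<^esub> (act2 \<sigma> t \<otimes>\<^bsub>M2\<^esub> inv\<^bsub>M2\<^esub> t)"
      unfolding M2.coboundary_mult[OF Q(1) M2.inv_closed[OF t(1)] s] M2.coboundary_inv[OF t(1) s]
      using s by simp
    also have "\<dots> = ?b \<otimes>\<^bsub>M2\<^esub> (inv\<^bsub>M2\<^esub> ?b \<otimes>\<^bsub>M2\<^esub> inv\<^bsub>M2\<^esub> ?a)"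
      unfolding t(3)[OF s, symmetric] M2.inv_mult_group[OF a b] ..
    also have "\<dots> = inv\<^bsub>M2\<^esub> ?a"
      unfolding M2.m_assoc[OF b M2.inv_closed[OF b] M2.inv_closed[OF a], symmetric] M2.r_inv[OF b]
      using a by (rule M2.l_one[OF M2.inv_closed])
    finally show "act2 \<sigma> ?Q \<otimes>\<^bsub>M2\<^esub> inv\<^bsub>M2\<^esub> ?Q = inv\<^bsub>M2\<^esub> ?a" .
  qed
  \<comment> \<open>As \<open>t\<close> is \<open>m\<close>-torsion, the corrected point still has
    \<open>m\<close>-th power \<open>y\<close>.\<close>
  moreover have "p = ?f (coset P ?Q)"
    unfolding p(1) push_coset[OF P(1) Q'] using P Q t p(3) by (simp add: M2.nat_pow_distrib M2.nat_pow_inv)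
  ultimately show "p \<in> ?f ` carrier quot_invariants" by (rule rev_image_eqI)
next
  let ?g = "\<lambda>(x, y). mu_1 x \<otimes>\<^bsub>H1 (torsion M2 m) act2\<^esub> mu_2 y"
  let ?f = "\<lambda>D. (fst (push D), snd (push D))"
  fix p assume "p \<in> ?f ` carrier quot_invariants"
  then obtain D where D: "D \<in> carrier quot_invariants" "p = ?f D" by blast
  have p: "p \<in> carrier (M1.invariants \<times>\<times> M2.invariants)"
    unfolding D(2) by (rule group_hom.hom_closed[OF push_group_hom D(1)])
  then have "mu_2 (snd (push D)) \<in> carrier (H1 (torsion M2 m) act2)"
    using hom_in_carrier[OF mu_2_hom, of "snd (push D)"] unfolding D(2) carrier_DirProd by blast
  \<comment> \<open>Part (a) identifies \<open>mu_1\<close> of the first component with the inverse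
    of \<open>mu_2\<close> of the second, so the composite is trivial.\<close>
  then have "?g p = \<one>\<^bsub>H1 (torsion M2 m) act2\<^esub>"
    unfolding D(2) case_prod_conv mu_1_push_eq_inv_mu_2_push[OF D(1)] by (rule H.l_inv)
  then show "p \<in> kernel (M1.invariants \<times>\<times> M2.invariants) (H1 (torsion M2 m) act2) ?g"
    unfolding kernel_def using p by blast
qed

end


section \<open>Elliptic curves as Galois modules\<close>

text \<open>Covers both \<open>to_ac\<close> and the Galois automorphisms. \<open>ec_add\<close>
  branches on equalities of coordinates before dividing, so compatibility with it rests on
  injectivity, which is derived from the existence of inverses.\<close>

locale field_embedding =
  fixes f :: "'a::field \<Rightarrow> 'b::field"
  assumes one [simp]: "f 1 = 1"
    and add [simp]: "f (x + y) = f x + f y"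
    and mult [simp]: "f (x * y) = f x * f y"
begin

lemma zero [simp]: "f 0 = 0"
  using add[of 0 0] by (metis add_0 add_cancel_right_right)

lemma minus [simp]: "f (- x) = - f x"
  using add[of x "- x"] by (simp add: eq_neg_iff_add_eq_0 add.commute)

lemma diff [simp]: "f (x - y) = f x - f y"
  using add[of x "- y"] by simp

lemma power [simp]: "f (x ^ n) = f x ^ n"
  by (induction n) simp_all

lemma of_nat [simp]: "f (of_nat n) = of_nat n"
  by (induction n) simp_all

lemma numeral [simp]: "f (numeral n) = numeral n"
  using of_nat[of "numeral n"] by (simp del: of_nat)

lemma eq_zero_iff [simp]: "f x = 0 \<longleftrightarrow> x = 0"
proof
  assume "f x = 0"
  then show "x = 0" using mult[of x "inverse x"] by (cases "x = 0") auto
qed simp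

lemma eq_iff [simp]: "f x = f y \<longleftrightarrow> x = y"
  using eq_zero_iff[of "x - y"] by simp

lemma divide [simp]: "f (x / y) = f x / f y"
proof (cases "y = 0")
  case False
  then have "f (x / y) * f y = f x" by (simp flip: mult)
  then show ?thesis using False by (simp add: nonzero_eq_divide_eq)
qed simp

lemma map_weierstrass_sel [simp]:
  "wa1 (map_weierstrass f W) = f (wa1 W)" "wa2 (map_weierstrass f W) = f (wa2 W)"
  "wa3 (map_weierstrass f W) = f (wa3 W)" "wa4 (map_weierstrass f W) = f (wa4 W)"
  "wa6 (map_weierstrass f W) = f (wa6 W)"
  by (cases W; simp)+

lemma discriminant_map: "discriminant (map_weierstrass f W) = f (discriminant W)"
  by (simp add: discriminant_def Let_def)

lemma elliptic_curve_map: "elliptic_curve (map_weierstrass f W) \<longleftrightarrow> elliptic_curve W"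
  by (simp add: elliptic_curve_def discriminant_map)

lemma on_curve_map: "on_curve (map_weierstrass f W) (map_ec_point f P) \<longleftrightarrow> on_curve W P"
proof (cases P)
  case (Affine x y)
  have "on_curve (map_weierstrass f W) (map_ec_point f P) \<longleftrightarrow>
    f (y^2 + wa1 W * x * y + wa3 W * y) = f (x^3 + wa2 W * x^2 + wa4 W * x + wa6 W)"
    by (simp add: Affine del: eq_iff)
  then show ?thesis by (simp only: eq_iff Affine on_curve.simps)
qed simp

lemma ec_add_map:
  "map_ec_point f (ec_add W P Q) = ec_add (map_weierstrass f W) (map_ec_point f P) (map_ec_point f Q)"
proof (cases "P = Infinity \<or> Q = Infinity")
  case True
  then show ?thesis by auto
next
  case False
  then obtain x1 y1 x2 y2 where PQ: "P = Affine x1 y1" "Q = Affine x2 y2" by (metis ec_point.exhaust)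
  have "f y1 + f y2 + f (wa1 W) * f x2 + f (wa3 W) = 0 \<longleftrightarrow> y1 + y2 + wa1 W * x2 + wa3 W = 0"
    using eq_zero_iff[of "y1 + y2 + wa1 W * x2 + wa3 W"] by simp
  then show ?thesis by (simp add: PQ Let_def)
qed

end

section \<open>The Galois action on geometric points\<close>

lemma field_embedding_to_ac: "field_embedding to_ac"
  by unfold_locales simp_all

lemma field_embedding_galois:
  assumes "\<sigma> \<in> absolute_galois"
  shows "field_embedding \<sigma>"
proof -
  have "\<sigma> (to_ac 1) = to_ac 1" using assms unfolding absolute_galois_def by blast
  then show ?thesis using assms by unfold_locales (auto simp: absolute_galois_def)
qed

lemma galois_map_weierstrass:
  assumes "\<sigma> \<in> absolute_galois"
  shows "map_weierstrass \<sigma> (map_weierstrass to_ac W) = map_weierstrass to_ac W"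
  using assms by (cases W) (simp add: absolute_galois_def)

lemma geometric_points_sel [simp]:
  "P \<in> carrier (geometric_points W) \<longleftrightarrow> on_curve (map_weierstrass to_ac W) P"
  "P \<otimes>\<^bsub>geometric_points W\<^esub> Q = ec_add (map_weierstrass to_ac W) P Q"
  "\<one>\<^bsub>geometric_points W\<^esub> = Infinity"
  by (simp_all add: geometric_points_def ec_group_def)

lemma galois_module_geometric_points:
  assumes "elliptic_curve W"
  shows "galois_module (geometric_points W) map_ec_point"
proof (intro galois_module.intro galois_module_axioms.intro)
  show "comm_group (geometric_points W)"
    unfolding geometric_points_def
    by (rule ec_group_comm_group) (simp add: field_embedding.elliptic_curve_map[OF field_embedding_to_ac] assms)
next
  fix \<sigma> :: "'a alg_closure \<Rightarrow> 'a alg_closure" and P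
  assume s: "\<sigma> \<in> absolute_galois" and P: "P \<in> carrier (geometric_points W)"
  show "map_ec_point \<sigma> P \<in> carrier (geometric_points W)"
    using P field_embedding.on_curve_map[OF field_embedding_galois[OF s], of "map_weierstrass to_ac W" P]
    unfolding galois_map_weierstrass[OF s] by simp
  show "map_ec_point \<sigma> (P \<otimes>\<^bsub>geometric_points W\<^esub> Q) =
      map_ec_point \<sigma> P \<otimes>\<^bsub>geometric_points W\<^esub> map_ec_point \<sigma> Q" for Q
    using field_embedding.ec_add_map[OF field_embedding_galois[OF s], of "map_weierstrass to_ac W" P Q]
    unfolding galois_map_weierstrass[OF s] by simp
next
  fix P :: "'a alg_closure ec_point"
  show "\<exists>S. finite S \<and> (\<forall>\<sigma>\<in>absolute_galois. (\<forall>s\<in>S. \<sigma> s = s) \<longrightarrow> map_ec_point \<sigma> P = P)"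
  proof (cases P)
    case (Affine x y)
    then show ?thesis by (intro exI[of _ "{x, y}"]) simp
  qed auto
qed (simp_all add: ec_point.map_id ec_point.map_comp)

lemma geometric_points_divisible:
  fixes W :: "'k::field_char_0 weierstrass"
  assumes "elliptic_curve W" "m > 1" "Q \<in> carrier (geometric_points W)"
  shows "\<exists>P\<in>carrier (geometric_points W). P [^]\<^bsub>geometric_points W\<^esub> (m::nat) = Q"
  using assms unfolding geometric_points_def
  by (intro ec_group_divisible) (simp_all add: field_embedding.elliptic_curve_map[OF field_embedding_to_ac])

text \<open>The fixed field theorem applies to each coordinate of an invariant point, and
  injectivity of \<open>to_ac\<close> pulls the curve equation back to K.\<close>

lemma rational_points_eq_invariants:
  fixes W :: "'k::field_char_0 weierstrass"
  assumes "elliptic_curve W"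
  shows "rational_points W = galois_module.invariants (geometric_points W) map_ec_point"
proof -
  interpret galois_module "geometric_points W" map_ec_point
    by (rule galois_module_geometric_points[OF assms])
  note curve = field_embedding.on_curve_map[OF field_embedding_to_ac, of W]
  have "map_ec_point to_ac ` carrier (ec_group W) =
    {P \<in> carrier (geometric_points W). \<forall>\<sigma>\<in>absolute_galois. map_ec_point \<sigma> P = P}" (is "?L = ?R")
  proof (intro equalityI subsetI)
    fix P assume "P \<in> ?L"
    then obtain P0 where P0: "P = map_ec_point to_ac P0" "on_curve W P0" by (auto simp: ec_group_def)
    have "map_ec_point \<sigma> P = P" if s: "\<sigma> \<in> absolute_galois" for \<sigma>
      using s by (cases P0) (simp_all add: P0(1) absolute_galois_def)
    then show "P \<in> ?R" using P0 curve by simp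
  next
    fix P assume P: "P \<in> ?R"
    show "P \<in> ?L"
    proof (cases P)
      case Infinity
      then have "P = map_ec_point to_ac Infinity" by simp
      then show ?thesis by (rule image_eqI) (simp add: ec_group_def)
    next
      case (Affine x y)
      have "\<sigma> x = x" "\<sigma> y = y" if "\<sigma> \<in> absolute_galois" for \<sigma> using P that Affine by auto
      then obtain x0 y0 where xy: "x = to_ac x0" "y = to_ac y0" using galois_fixed_field by blast
      have eq: "P = map_ec_point to_ac (Affine x0 y0)" using Affine xy by simp
      then have "on_curve W (Affine x0 y0)" using P curve[of "Affine x0 y0"] by simp
      then show ?thesis using eq by (intro image_eqI[where x = "Affine x0 y0"]) (simp_all add: ec_group_def)
    qed
  qed
  then show ?thesis unfolding rational_points_def invariants_def by (simp only:)
qed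

theorem theorem3p1:
  fixes E1 E2 :: "'k::field_char_0 weierstrass"
    and m :: nat
    and \<phi> :: "'k alg_closure ec_point \<Rightarrow> 'k alg_closure ec_point"
  assumes "m > 1"
    and "elliptic_curve E1"
    and "elliptic_curve E2"
    and "torsion_isomorphism E1 E2 m \<phi>"
  shows "(\<forall>a \<in> carrier (quotient_rational_points E1 E2 m \<phi>).
            mu1 E1 E2 m \<phi> (p_push E1 E2 m a) =
              inv\<^bsub>H1_Delta E2 m\<^esub> (mu2 E2 m (q_push E1 E2 m a))) \<and>
         exact_at_middle
           (rational_points E1 \<times>\<times> rational_points E2)
           (pq_pull E1 E2 m \<phi>)
           (quotient_rational_points E1 E2 m \<phi>)
           (\<lambda>a. mu1 E1 E2 m \<phi> (p_push E1 E2 m a))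
           (H1_Delta E2 m) \<and>
         exact_at_middle
           (quotient_rational_points E1 E2 m \<phi>)
           (\<lambda>a. (p_push E1 E2 m a, q_push E1 E2 m a))
           (rational_points E1 \<times>\<times> rational_points E2)
           (\<lambda>(e1, e2). mu1 E1 E2 m \<phi> e1 \<otimes>\<^bsub>H1_Delta E2 m\<^esub> mu2 E2 m e2)
           (H1_Delta E2 m)"
proof -
  interpret kummer_pair "geometric_points E1" map_ec_point "geometric_points E2" map_ec_point m \<phi>
  proof (intro kummer_pair.intro kummer_pair_axioms.intro)
    show "galois_module (geometric_points E1) map_ec_point" "galois_module (geometric_points E2) map_ec_point"
      using galois_module_geometric_points assms(2,3) by blast+
    show "\<phi> \<in> Group.iso (torsion (geometric_points E1) m) (torsion (geometric_points E2) m)"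
      "\<And>\<sigma> T. \<sigma> \<in> absolute_galois \<Longrightarrow> T \<in> carrier (torsion (geometric_points E1) m) \<Longrightarrow>
         \<phi> (map_ec_point \<sigma> T) = map_ec_point \<sigma> (\<phi> T)"
      using assms(4) unfolding torsion_isomorphism_def by blast+
  qed (use geometric_points_divisible assms(1-3) in blast)+
  \<comment> \<open>The remaining equations match the concrete definitions with their copies in the
    locale; only \<open>rational\<close> has content, namely the description of K-points as
    invariants.\<close>
  have Delta: "antidiagonal E1 E2 m \<phi> = Delta"
    unfolding antidiagonal_def Delta_def ..
  have quot: "quotient_surface E1 E2 m \<phi> = quot"
    unfolding quotient_surface_def quot_def Delta ..
  have quot_invariants: "quotient_rational_points E1 E2 m \<phi> = quot_invariants"
    unfolding quotient_rational_points_def quot_invariants_def quot ..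
  have pull: "pq_pull E1 E2 m \<phi> =
      (\<lambda>(P, Q). coset P \<one>\<^bsub>geometric_points E2\<^esub> \<otimes>\<^bsub>quot\<^esub> coset \<one>\<^bsub>geometric_points E1\<^esub> Q)"
    unfolding pq_pull_def p_pull_def q_pull_def coset_def quot Delta ..
  have push: "pq_push E1 E2 m = push"
    unfolding pq_push_def push_def ..
  have p_push: "p_push E1 E2 m = (\<lambda>a. fst (push a))" and q_push: "q_push E1 E2 m = (\<lambda>a. snd (push a))"
    unfolding p_push_def q_push_def push by (rule refl)+
  have mu1: "mu1 E1 E2 m \<phi> = mu_1" and mu2: "mu2 E2 m = mu_2"
    unfolding mu1_def mu2_def mu_1_def mu_2_def kummer_def by (rule refl)+
  have H1: "H1_Delta E2 m = H1 (torsion (geometric_points E2) m) map_ec_point"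
    unfolding H1_Delta_def ..
  have rational: "rational_points E1 = M1.invariants" "rational_points E2 = M2.invariants"
    using rational_points_eq_invariants assms(2,3) by blast+
  show ?thesis
    unfolding quot_invariants pull p_push q_push mu1 mu2 H1 rational
    using mu_1_push_eq_inv_mu_2_push exact_pull exact_push by blast
qed

end
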